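(* Let $n\ge 1$ and let $\varphi:\mathbb{H}^n\to\mathbb{R}$ be an $H$-convex function with round $H$-sections, with constant $K_0\in(0,1)$. Then: (i) there exists $K>1$ such that $\varphi$ satisfies the engulfing property $E(\mathbb{H}^n,K)$; consequently, in the class of $H$-convex functions with round $H$-sections, the engulfing property for $H$-sections (i.e. $E(H,K)$ for some $K>1$) and the engulfing property for $\mathbb{H}^n$-sections (i.e. $E(\mathbb{H}^n,K)$ for some $K>1$) are equivalent; (ii) the function $d_\varphi:\mathbb{H}^n\times\mathbb{H}^n\to[0,+\infty)$ defined by $$d_\varphi(\xi,\xi')=\inf\left\{s>0:\ \xi\in\mathbb{S}_\varphi^{\mathbb{H}^n}(\xi',s),\ \xi'\in\mathbb{S}_\varphi^{\mathbb{H}^n}(\xi,s)\right\}$$ is a quasi-metric on $\mathbb{H}^n$; moreover, denoting by $B_\varphi(\xi,r)$ the $d_\varphi$-ball of center $\xi$ and radius $r$, there exists a constant $H>0$, depending only on $K_0$, such that for every $\xi\in\mathbb{H}^n$ and $r>0$ $$\mathbb{S}_\varphi^{\mathbb{H}^n}\left(\xi,\tfrac{r}{2H}\right)\subset B_\varphi(\xi,r)\subset\mathbb{S}_\varphi^{\mathbb{H}^n}(\xi,r).$$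
   Context: Heisenberg group: $\mathbb{H}^n=\mathbb{R}^n\times\mathbb{R}^n\times\mathbb{R}$ with group law $(x,y,t)\circ(x',y',t')=(x+x',y+y',t+t'+2(x'\cdot y-x\cdot y'))$, neutral element $e$, dilations $\delta_\lambda(x,y,t)=(\lambda x,\lambda y,\lambda^2t)$, and $\mathrm{Pr}_1(x,y,t)=(x,y)\in\mathbb{R}^{2n}$. The first layer $V_1$ of the Lie algebra is identified with $\mathbb{R}^{2n}$, and $\exp v=(v,0)$ for $v\in V_1$. Gauge norm $N(x,y,t)=((\|x\|^2+\|y\|^2)^2+t^2)^{1/4}$, $\|\xi\|_g=N(\xi)$, $d_g(\xi,\xi')=N((\xi')^{-1}\circ\xi)$, $B_g(\xi_0,r)=\{\xi:\ d_g(\xi_0,\xi)\le r\}$. The horizontal plane at $\xi_0=(x_0,y_0,t_0)$ is $H_{\xi_0}=\{(x,y,t):\ t=t_0+2(y_0\cdot x-x_0\cdot y)\}=\{\xi_0\circ\exp v:\ v\in V_1\}$. $H$-convexity: $\varphi:\mathbb{H}^n\to\mathbb{R}$ is $H$-convex if $\varphi(\xi_1\circ\delta_\lambda(\xi_1^{-1}\circ\xi_2))\le(1-\lambda)\varphi(\xi_1)+\lambda\varphi(\xi_2)$ for all $\xi_1\in\mathbb{H}^n$, $\xi_2\in H_{\xi_1}$, $\lambda\in[0,1]$. Horizontal subdifferential: $\partial_H\varphi(\xi_0)=\{p\in\mathbb{R}^{2n}:\ \varphi(\xi)\ge\varphi(\xi_0)+p\cdot(\mathrm{Pr}_1(\xi)-\mathrm{Pr}_1(\xi_0))\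 \forall\xi\in H_{\xi_0}\}$ (nonempty at every point when $\varphi$ is $H$-convex). $\varphi$ is $H$-differentiable at $\xi$ if there is $\nabla_H\varphi(\xi)\in\mathbb{R}^{2n}$ with $\varphi(\xi\circ\xi')=\varphi(\xi)+\nabla_H\varphi(\xi)\cdot\mathrm{Pr}_1(\xi')+o(\|\xi'\|_g)$ as $\xi'\to e$; for an $H$-convex $\varphi$ which is $H$-differentiable at $\xi$, $\partial_H\varphi(\xi)=\{\nabla_H\varphi(\xi)\}$. $H$-sections: for $\varphi$ $H$-convex, $p_0\in\partial_H\varphi(\xi_0)$, $s>0$, $S_\varphi^H(\xi_0,p_0,s)=\{\xi\in H_{\xi_0}:\ \varphi(\xi)-\varphi(\xi_0)-p_0\cdot(\mathrm{Pr}_1(\xi)-\mathrm{Pr}_1(\xi_0))<s\}$. $\mathbb{H}^n$-sections: $\mathbb{S}_\varphi^{\mathbb{H}^n}(\xi_0,p_0,s)=\bigcup S_\varphi^H(\xi_2,p_2,s)$, the union being over all $\xi_1\in S_\varphi^H(\xi_0,p_0,s)$, $p_1\in\partial_H\varphi(\xi_1)$, $\xi_2\in S_\varphi^H(\xi_1,p_1,s)$, $p_2\in\partial_H\varphi(\xi_2)$. If $\varphi$ is $H$-differentiable one writes $S_\varphi^H(\xi_0,s)$, $\mathbb{S}_\varphi^{\mathbb{H}^n}(\xi_0,s)$ (with $p_0=\nabla_H\varphi(\xi_0)$). An $H$-convex function with round $H$-sections is $H$-differentiable everywhere, so this notation makes sense in (ii). Round $H$-sections: an $H$-convex $\varphi$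 has round $H$-sections (with constant $K_0\in(0,1)$) if for every $\xi\in\mathbb{H}^n$, $p\in\partial_H\varphi(\xi)$, $s>0$ there is $R>0$ with $B_g(\xi,K_0R)\cap H_\xi\subset S_\varphi^H(\xi,p,s)\subset B_g(\xi,R)\cap H_\xi$. Engulfing for $H$-sections, $E(H,K)$ ($K>1$): for all $\xi\in\mathbb{H}^n$, $p\in\partial_H\varphi(\xi)$, $s>0$, if $\xi'\in S_\varphi^H(\xi,p,s)$ then $S_\varphi^H(\xi,p,s)\cap H_{\xi'}\subset S_\varphi^H(\xi',q,Ks)\cap H_\xi$ for every $q\in\partial_H\varphi(\xi')$. Engulfing for $\mathbb{H}^n$-sections, $E(\mathbb{H}^n,K)$ ($K>1$): for all $\xi\in\mathbb{H}^n$, $p\in\partial_H\varphi(\xi)$, $s>0$, if $\xi'\in\mathbb{S}_\varphi^{\mathbb{H}^n}(\xi,p,s)$ then $\mathbb{S}_\varphi^{\mathbb{H}^n}(\xi,p,s)\subset\mathbb{S}_\varphi^{\mathbb{H}^n}(\xi',q,Ks)$ for every $q\in\partial_H\varphi(\xi')$. A quasi-metric on a set $X$ is a symmetric function $d:X\times X\to[0,+\infty)$ with $d(x,y)=0$ iff $x=y$ and $d(x,y)\le C(d(x,z)+d(z,y))$ for all $x,y,z$, for some constant $C\ge1$; the $d$-ball of center $x$ and radius $r$ is $\{y:\ d(x,y)<r\}$. *)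

theory Defs
  imports "HOL-Analysis.Analysis" "HOL-Library.Landau_Symbols"
begin

text \<open>
  The dimension is an explicit natural number \<open>n\<close> rather than a type, so that a constant can be
  chosen before \<open>n\<close>. Vectors of \<open>\<real>\<^sup>n\<close> are elements of \<^term>\<open>topspace (Euclidean_space n)\<close>, i.e.
  sequences vanishing at all indices \<open>i \<ge> n\<close>. Functions on the Heisenberg group are total HOL
  functions; only their values on the carrier \<open>heis n\<close> are ever used.
\<close>

type_synonym hpoint = "(nat \<Rightarrow> real) \<times> (nat \<Rightarrow> real) \<times> real"
type_synonym hvec = "(nat \<Rightarrow> real) \<times> (nat \<Rightarrow> real)"

definition dot :: "nat \<Rightarrow> (nat \<Rightarrow> real) \<Rightarrow> (nat \<Rightarrow> real) \<Rightarrow> real" where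
  "dot n x y = (\<Sum>i<n. x i * y i)"

definition heis :: "nat \<Rightarrow> hpoint set" where
  "heis n = topspace (Euclidean_space n) \<times> topspace (Euclidean_space n) \<times> UNIV"

text \<open>\<open>\<real>\<^sup>2\<^sup>n = \<real>\<^sup>n \<times> \<real>\<^sup>n\<close>, the first layer of the Lie algebra.\<close>
definition hlayer :: "nat \<Rightarrow> hvec set" where
  "hlayer n = topspace (Euclidean_space n) \<times> topspace (Euclidean_space n)"

fun hdot :: "nat \<Rightarrow> hvec \<Rightarrow> hvec \<Rightarrow> real" where
  "hdot n (a, b) (x, y) = dot n a x + dot n b y"

fun hmul :: "nat \<Rightarrow> hpoint \<Rightarrow> hpoint \<Rightarrow> hpoint" where
  "hmul n (x, y, t) (x', y', t') =
     ((\<lambda>i. x i + x' i), (\<lambda>i. y i + y' i), t + t' + 2 * (dot n x' y - dot n x y'))"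

definition hzero :: hpoint where
  "hzero = ((\<lambda>i. 0), (\<lambda>i. 0), 0)"

fun hinv :: "hpoint \<Rightarrow> hpoint" where
  "hinv (x, y, t) = ((\<lambda>i. - x i), (\<lambda>i. - y i), - t)"

fun hdil :: "real \<Rightarrow> hpoint \<Rightarrow> hpoint" where
  "hdil l (x, y, t) = ((\<lambda>i. l * x i), (\<lambda>i. l * y i), l\<^sup>2 * t)"

fun Pr1 :: "hpoint \<Rightarrow> hvec" where
  "Pr1 (x, y, t) = (x, y)"

fun gauge_norm :: "nat \<Rightarrow> hpoint \<Rightarrow> real" where
  "gauge_norm n (x, y, t) =
     root 4 (((L2_set x {..<n})\<^sup>2 + (L2_set y {..<n})\<^sup>2)\<^sup>2 + t\<^sup>2)"

definition gauge_dist :: "nat \<Rightarrow> hpoint \<Rightarrow> hpoint \<Rightarrow> real" where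
  "gauge_dist n \<xi> \<xi>' = gauge_norm n (hmul n (hinv \<xi>') \<xi>)"

definition gauge_ball :: "nat \<Rightarrow> hpoint \<Rightarrow> real \<Rightarrow> hpoint set" where
  "gauge_ball n \<xi>0 r = {\<xi> \<in> heis n. gauge_dist n \<xi>0 \<xi> \<le> r}"

fun hplane :: "nat \<Rightarrow> hpoint \<Rightarrow> hpoint set" where
  "hplane n (x0, y0, t0) =
     {(x, y, t). (x, y, t) \<in> heis n \<and> t = t0 + 2 * (dot n y0 x - dot n x0 y)}"

definition hconvex :: "nat \<Rightarrow> (hpoint \<Rightarrow> real) \<Rightarrow> bool" where
  "hconvex n \<phi> \<longleftrightarrow>
     (\<forall>\<xi>1 \<in> heis n. \<forall>\<xi>2 \<in> hplane n \<xi>1. \<forall>l \<in> {0..1}.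
        \<phi> (hmul n \<xi>1 (hdil l (hmul n (hinv \<xi>1) \<xi>2))) \<le> (1 - l) * \<phi> \<xi>1 + l * \<phi> \<xi>2)"

definition hsubdiff :: "nat \<Rightarrow> (hpoint \<Rightarrow> real) \<Rightarrow> hpoint \<Rightarrow> hvec set" where
  "hsubdiff n \<phi> \<xi>0 =
     {p \<in> hlayer n. \<forall>\<xi> \<in> hplane n \<xi>0. \<phi> \<xi> \<ge> \<phi> \<xi>0 + hdot n p (Pr1 \<xi> - Pr1 \<xi>0)}"

text \<open>
  On \<open>heis n\<close> the product topology of the type \<open>hpoint\<close> induces the Euclidean topology.
\<close>
definition has_hgrad :: "nat \<Rightarrow> (hpoint \<Rightarrow> real) \<Rightarrow> hvec \<Rightarrow> hpoint \<Rightarrow> bool" where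
  "has_hgrad n \<phi> p \<xi> \<longleftrightarrow> p \<in> hlayer n \<and>
     (\<lambda>\<eta>. \<phi> (hmul n \<xi> \<eta>) - \<phi> \<xi> - hdot n p (Pr1 \<eta>)) \<in> o[at hzero within heis n](gauge_norm n)"

text \<open>
  Meaningful only where \<open>\<phi>\<close> is \<open>H\<close>-differentiable, i.e. where some (and then exactly one) vector
  satisfies \<open>has_hgrad\<close>.
\<close>
definition hgrad :: "nat \<Rightarrow> (hpoint \<Rightarrow> real) \<Rightarrow> hpoint \<Rightarrow> hvec" where
  "hgrad n \<phi> \<xi> = (THE p. has_hgrad n \<phi> p \<xi>)"

definition hsection :: "nat \<Rightarrow> (hpoint \<Rightarrow> real) \<Rightarrow> hpoint \<Rightarrow> hvec \<Rightarrow> real \<Rightarrow> hpoint set" where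
  "hsection n \<phi> \<xi>0 p0 s =
     {\<xi> \<in> hplane n \<xi>0. \<phi> \<xi> - \<phi> \<xi>0 - hdot n p0 (Pr1 \<xi> - Pr1 \<xi>0) < s}"

definition Hn_section :: "nat \<Rightarrow> (hpoint \<Rightarrow> real) \<Rightarrow> hpoint \<Rightarrow> hvec \<Rightarrow> real \<Rightarrow> hpoint set" where
  "Hn_section n \<phi> \<xi>0 p0 s =
     (\<Union>\<xi>1 \<in> hsection n \<phi> \<xi>0 p0 s. \<Union>p1 \<in> hsubdiff n \<phi> \<xi>1.
      \<Union>\<xi>2 \<in> hsection n \<phi> \<xi>1 p1 s. \<Union>p2 \<in> hsubdiff n \<phi> \<xi>2. hsection n \<phi> \<xi>2 p2 s)"

definition Hn_section_grad :: "nat \<Rightarrow> (hpoint \<Rightarrow> real) \<Rightarrow> hpoint \<Rightarrow> real \<Rightarrow> hpoint set" where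
  "Hn_section_grad n \<phi> \<xi>0 s = Hn_section n \<phi> \<xi>0 (hgrad n \<phi> \<xi>0) s"

definition round_hsections :: "nat \<Rightarrow> real \<Rightarrow> (hpoint \<Rightarrow> real) \<Rightarrow> bool" where
  "round_hsections n K0 \<phi> \<longleftrightarrow>
     (\<forall>\<xi> \<in> heis n. \<forall>p \<in> hsubdiff n \<phi> \<xi>. \<forall>s>0. \<exists>R>0.
        gauge_ball n \<xi> (K0 * R) \<inter> hplane n \<xi> \<subseteq> hsection n \<phi> \<xi> p s \<and>
        hsection n \<phi> \<xi> p s \<subseteq> gauge_ball n \<xi> R \<inter> hplane n \<xi>)"

definition engulfing_H :: "nat \<Rightarrow> real \<Rightarrow> (hpoint \<Rightarrow> real) \<Rightarrow> bool" where
  "engulfing_H n K \<phi> \<longleftrightarrow>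
     (\<forall>\<xi> \<in> heis n. \<forall>p \<in> hsubdiff n \<phi> \<xi>. \<forall>s>0. \<forall>\<xi>' \<in> hsection n \<phi> \<xi> p s.
        \<forall>q \<in> hsubdiff n \<phi> \<xi>'.
          hsection n \<phi> \<xi> p s \<inter> hplane n \<xi>' \<subseteq> hsection n \<phi> \<xi>' q (K * s) \<inter> hplane n \<xi>)"

definition engulfing_Hn :: "nat \<Rightarrow> real \<Rightarrow> (hpoint \<Rightarrow> real) \<Rightarrow> bool" where
  "engulfing_Hn n K \<phi> \<longleftrightarrow>
     (\<forall>\<xi> \<in> heis n. \<forall>p \<in> hsubdiff n \<phi> \<xi>. \<forall>s>0. \<forall>\<xi>' \<in> Hn_section n \<phi> \<xi> p s.
        \<forall>q \<in> hsubdiff n \<phi> \<xi>'.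
          Hn_section n \<phi> \<xi> p s \<subseteq> Hn_section n \<phi> \<xi>' q (K * s))"

definition quasi_metric_on :: "'a set \<Rightarrow> ('a \<Rightarrow> 'a \<Rightarrow> real) \<Rightarrow> bool" where
  "quasi_metric_on X d \<longleftrightarrow>
     (\<forall>x\<in>X. \<forall>y\<in>X. 0 \<le> d x y \<and> d x y = d y x \<and> (d x y = 0 \<longleftrightarrow> x = y)) \<and>
     (\<exists>C\<ge>1. \<forall>x\<in>X. \<forall>y\<in>X. \<forall>z\<in>X. d x y \<le> C * (d x z + d z y))"

definition dphi_set :: "nat \<Rightarrow> (hpoint \<Rightarrow> real) \<Rightarrow> hpoint \<Rightarrow> hpoint \<Rightarrow> real set" where
  "dphi_set n \<phi> \<xi> \<xi>' =
     {s. s > 0 \<and> \<xi> \<in> Hn_section_grad n \<phi> \<xi>' s \<and> \<xi>' \<in> Hn_section_grad n \<phi> \<xi> s}"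

text \<open>
  The infimum is that of the reals, so it carries its usual meaning only if \<open>dphi_set\<close> is
  nonempty, i.e. if the infimum taken in \<open>[0,\<infinity>]\<close> is finite.
\<close>
definition dphi :: "nat \<Rightarrow> (hpoint \<Rightarrow> real) \<Rightarrow> hpoint \<Rightarrow> hpoint \<Rightarrow> real" where
  "dphi n \<phi> \<xi> \<xi>' = Inf (dphi_set n \<phi> \<xi> \<xi>')"

definition dphi_ball :: "nat \<Rightarrow> (hpoint \<Rightarrow> real) \<Rightarrow> hpoint \<Rightarrow> real \<Rightarrow> hpoint set" where
  "dphi_ball n \<phi> \<xi> r = {\<xi>' \<in> heis n. dphi n \<phi> \<xi> \<xi>' < r}"

end

theory Submission
  imports Defs "HOL-Library.Function_Algebras"
begin

text \<open>
  An \<open>H\<close>-convex function is bounded on bounded sets: first on vertical segments, whose points are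
  midpoints of horizontal segments with endpoints on two fixed horizontal lines, then on boxes, adding
  one coordinate at a time. Since any two points are joined by three horizontal steps of comparable
  length, it is then locally Lipschitz. Subgradients exist at the minimisers of \<open>\<phi> + c Q\<close> with \<open>Q\<close> a
  squared Euclidean distance to a given point, hence at every point by letting \<open>c \<rightarrow> \<infinity>\<close>.

  With round \<open>H\<close>-sections the subgradient is unique and depends continuously on the point, so \<open>\<phi>\<close> is
  \<open>H\<close>-differentiable. Let \<open>G \<xi> r\<close> be the excess of \<open>\<phi>\<close> over its tangent at \<open>\<xi>\<close>, at distance \<open>r\<close> in a
  fixed horizontal direction. Roundness makes the excess comparable in all horizontal directions, and
  on each horizontal line it makes \<open>G\<close> doubling in \<open>r\<close> and comparable at the two endpoints of a segment
  of length \<open>r\<close>. Moving along three horizontal steps, \<open>G \<xi> r\<close> and \<open>G \<xi>' r\<close> are comparable whenever the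
  distance of \<open>\<xi>\<close> and \<open>\<xi>'\<close> is at most a multiple of \<open>r\<close>. Hence a section of height \<open>s\<close> at \<open>\<xi>\<close> lies
  between two balls of radius comparable to \<open>r\<close>, where \<open>G \<xi> r \<approx> s\<close>, and \<open>r\<close> is comparable for all points
  of the section. All constants depend only on \<open>K0\<close>.
\<close>

section \<open>Horizontal steps in the Heisenberg group\<close>

text \<open>Together with the pointwise addition of functions this makes \<open>hvec\<close> a real
  vector space, so that horizontal vectors can be added and scaled.\<close>

instantiation "fun" :: (type, scaleR) scaleR
begin
definition scaleR_fun_def: "c *\<^sub>R f = (\<lambda>x. c *\<^sub>R f x)"
instance ..
end

instance "fun" :: (type, real_vector) real_vector
  by standard (simp_all add: scaleR_fun_def fun_eq_iff scaleR_add_right scaleR_add_left)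

lemma scaleR_fun_apply [simp]: "(c *\<^sub>R f) x = c *\<^sub>R f x"
  by (simp add: scaleR_fun_def)

text \<open>Only a seminorm on \<open>hvec\<close>: entries at indices \<open>i \<ge> n\<close> are
  invisible to it. On \<open>hlayer n\<close> it is the Euclidean norm.\<close>

definition nrm :: "nat \<Rightarrow> hvec \<Rightarrow> real" where
  "nrm n v = sqrt (hdot n v v)"

text \<open>The symplectic form: the last coordinate of \<open>\<xi> \<circ> \<xi>'\<close> is \<open>t + t' + 2 * hsymp n (Pr1 \<xi>') (Pr1 \<xi>)\<close>.\<close>
definition hsymp :: "nat \<Rightarrow> hvec \<Rightarrow> hvec \<Rightarrow> real" where
  "hsymp n v w = dot n (fst v) (snd w) - dot n (fst w) (snd v)"

abbreviation ht :: "hpoint \<Rightarrow> real" where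
  "ht \<xi> \<equiv> snd (snd \<xi>)"

text \<open>\<open>hstep n \<xi> v = \<xi> \<circ> exp v\<close>.\<close>
definition hstep :: "nat \<Rightarrow> hpoint \<Rightarrow> hvec \<Rightarrow> hpoint" where
  "hstep n \<xi> v = (fst (Pr1 \<xi> + v), snd (Pr1 \<xi> + v), ht \<xi> + 2 * hsymp n v (Pr1 \<xi>))"

definition vtrunc :: "nat \<Rightarrow> hvec \<Rightarrow> hvec" where
  "vtrunc n v = ((\<lambda>i. if i < n then fst v i else 0), (\<lambda>i. if i < n then snd v i else 0))"

definition ptrunc :: "nat \<Rightarrow> hpoint \<Rightarrow> hpoint" where
  "ptrunc n \<xi> = (fst (vtrunc n (Pr1 \<xi>)), snd (vtrunc n (Pr1 \<xi>)), ht \<xi>)"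

text \<open>\<open>max \<bar>z\<bar> (sqrt \<bar>t\<bar>) \<le> r\<close>, where \<open>(z, t) = \<xi>\<^sup>-\<^sup>1 \<circ> \<xi>'\<close>; this left-invariant distance satisfies the
  triangle inequality and is equivalent to the gauge distance.\<close>
definition near :: "nat \<Rightarrow> real \<Rightarrow> hpoint \<Rightarrow> hpoint \<Rightarrow> bool" where
  "near n r \<xi> \<xi>' \<longleftrightarrow> nrm n (Pr1 \<xi>' - Pr1 \<xi>) \<le> r \<and>
     \<bar>ht \<xi>' - ht \<xi> - 2 * hsymp n (Pr1 \<xi>') (Pr1 \<xi>)\<bar> \<le> r\<^sup>2"

section \<open>Linear algebra of the first layer and of the left-invariant distance\<close>

lemma Pr1_eq: "Pr1 \<xi> = (fst \<xi>, fst (snd \<xi>))"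
  by (cases \<xi>) auto

lemma hpoint_eqI: "Pr1 \<xi> = Pr1 \<eta> \<Longrightarrow> ht \<xi> = ht \<eta> \<Longrightarrow> \<xi> = \<eta>"
  by (cases \<xi>; cases \<eta>) auto

lemma dot_linear [simp]:
  "dot n (x + x') y = dot n x y + dot n x' y" "dot n y (x + x') = dot n y x + dot n y x'"
  "dot n (x - x') y = dot n x y - dot n x' y" "dot n y (x - x') = dot n y x - dot n y x'"
  "dot n (- x) y = - dot n x y" "dot n y (- x) = - dot n y x"
  "dot n (c *\<^sub>R x) y = c * dot n x y" "dot n y (c *\<^sub>R x) = c * dot n y x"
  "dot n 0 y = 0" "dot n y 0 = 0"
  by (simp_all add: dot_def algebra_simps sum.distrib sum_subtractf sum_negf sum_distrib_left)

lemma dot_sym: "dot n x y = dot n y x"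
  by (simp add: dot_def mult.commute)

lemma hdot_eq: "hdot n v w = dot n (fst v) (fst w) + dot n (snd v) (snd w)"
  by (cases v; cases w) auto

lemma hdot_linear [simp]:
  "hdot n (v + v') w = hdot n v w + hdot n v' w" "hdot n w (v + v') = hdot n w v + hdot n w v'"
  "hdot n (v - v') w = hdot n v w - hdot n v' w" "hdot n w (v - v') = hdot n w v - hdot n w v'"
  "hdot n (- v) w = - hdot n v w" "hdot n w (- v) = - hdot n w v"
  "hdot n (c *\<^sub>R v) w = c * hdot n v w" "hdot n w (c *\<^sub>R v) = c * hdot n w v"
  "hdot n 0 w = 0" "hdot n w 0 = 0"
  by (simp_all add: hdot_eq algebra_simps)

lemma hdot_sym: "hdot n v w = hdot n w v"
  by (simp add: hdot_eq dot_sym)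

lemma hsymp_linear [simp]:
  "hsymp n (v + v') w = hsymp n v w + hsymp n v' w" "hsymp n w (v + v') = hsymp n w v + hsymp n w v'"
  "hsymp n (v - v') w = hsymp n v w - hsymp n v' w" "hsymp n w (v - v') = hsymp n w v - hsymp n w v'"
  "hsymp n (- v) w = - hsymp n v w" "hsymp n w (- v) = - hsymp n w v"
  "hsymp n (c *\<^sub>R v) w = c * hsymp n v w" "hsymp n w (c *\<^sub>R v) = c * hsymp n w v"
  "hsymp n 0 w = 0" "hsymp n w 0 = 0" "hsymp n v v = 0"
  by (simp_all add: hsymp_def algebra_simps)

lemma hsymp_swap: "hsymp n w v = - hsymp n v w"
  by (simp add: hsymp_def)

lemma hsymp_eq_hdot: "hsymp n v w = hdot n v (snd w, - fst w)"
  by (simp add: hsymp_def hdot_eq dot_sym)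

text \<open>The \<open>2n\<close> real coordinates as one family over
  \<open>{..<n} \<times> UNIV\<close>, which makes the inequalities for \<open>L2_set\<close>
  available for \<open>nrm\<close>.\<close>

abbreviation coord :: "hvec \<Rightarrow> nat \<times> bool \<Rightarrow> real" where
  "coord v \<equiv> \<lambda>(i, b). if b then fst v i else snd v i"

lemma sum_times_bool: "(\<Sum>p\<in>{..<n} \<times> UNIV. f p) = (\<Sum>i<n. f (i, True) + f (i, False))"
  for f :: "nat \<times> bool \<Rightarrow> real"
  by (simp add: sum.cartesian_product' UNIV_bool add.commute)

lemma hdot_sum: "hdot n v w = (\<Sum>p\<in>{..<n} \<times> UNIV. coord v p * coord w p)"
  by (simp add: hdot_eq dot_def sum_times_bool sum.distrib)

lemma nrm_L2_set: "nrm n v = L2_set (coord v) ({..<n} \<times> UNIV)"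
  by (simp add: nrm_def hdot_sum L2_set_def power2_eq_square)

lemma nrm_nonneg [simp]: "0 \<le> nrm n v"
  by (simp add: nrm_L2_set L2_set_nonneg)

lemma nrm_square: "(nrm n v)\<^sup>2 = hdot n v v"
proof -
  have "0 \<le> hdot n v v"
    by (auto simp: hdot_sum intro!: sum_nonneg)
  then show ?thesis by (simp add: nrm_def)
qed

lemma nrm_triangle: "nrm n (v + w) \<le> nrm n v + nrm n w"
proof -
  have "coord (v + w) = (\<lambda>p. coord v p + coord w p)"
    by auto
  then show ?thesis
    using L2_set_triangle_ineq[of "coord v" "coord w" "{..<n} \<times> UNIV"] by (simp add: nrm_L2_set)
qed

lemma hdot_le_nrm: "\<bar>hdot n v w\<bar> \<le> nrm n v * nrm n w"
proof -
  have "\<bar>hdot n v w\<bar> \<le> (\<Sum>p\<in>{..<n} \<times> UNIV. \<bar>coord v p\<bar> * \<bar>coord w p\<bar>)"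
    unfolding hdot_sum abs_mult[symmetric] by (rule sum_abs)
  also have "\<dots> \<le> nrm n v * nrm n w"
    unfolding nrm_L2_set by (rule L2_set_mult_ineq)
  finally show ?thesis .
qed

text \<open>The symplectic form is the inner product with \<open>w\<close> turned by a right angle
  in each coordinate plane, and this turn preserves the norm.\<close>

lemma hsymp_le_nrm: "\<bar>hsymp n v w\<bar> \<le> nrm n v * nrm n w"
proof -
  have "nrm n (snd w, - fst w) = nrm n w"
    by (simp add: nrm_def hdot_eq)
  then show ?thesis
    using hdot_le_nrm[of n v "(snd w, - fst w)"] by (simp add: hsymp_eq_hdot)
qed

lemma nrm_minus [simp]: "nrm n (- v) = nrm n v"
  by (simp add: nrm_def)

lemma nrm_zero [simp]: "nrm n 0 = 0"
  by (simp add: nrm_def)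

lemma nrm_scaleR [simp]: "nrm n (c *\<^sub>R v) = \<bar>c\<bar> * nrm n v"
  by (simp add: nrm_def real_sqrt_mult mult.assoc[symmetric])

lemma nrm_minus_commute: "nrm n (v - w) = nrm n (w - v)"
  by (metis nrm_minus minus_diff_eq)

lemma nrm_triangle_diff: "nrm n (v - w) \<le> nrm n v + nrm n w"
  using nrm_triangle[of n v "- w"] by simp

lemma coord_le_nrm:
  assumes "i < n"
  shows "\<bar>fst v i\<bar> \<le> nrm n v" "\<bar>snd v i\<bar> \<le> nrm n v"
proof -
  have abs: "\<bar>coord v p\<bar> \<le> nrm n v" if "p \<in> {..<n} \<times> UNIV" for p
  proof -
    have "\<bar>coord v p\<bar> \<le> L2_set (\<lambda>p. \<bar>coord v p\<bar>) ({..<n} \<times> UNIV)"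
      using that by (intro member_le_L2_set) auto
    then show ?thesis by (simp add: nrm_L2_set L2_set_def)
  qed
  show "\<bar>fst v i\<bar> \<le> nrm n v" "\<bar>snd v i\<bar> \<le> nrm n v"
    using abs[of "(i, True)"] abs[of "(i, False)"] assms by auto
qed

lemma nrm_le_sum: "nrm n v \<le> (\<Sum>i<n. \<bar>fst v i\<bar> + \<bar>snd v i\<bar>)"
proof -
  have "nrm n v \<le> (\<Sum>p\<in>{..<n} \<times> UNIV. \<bar>coord v p\<bar>)"
    unfolding nrm_L2_set by (rule L2_set_le_sum_abs)
  then show ?thesis
    by (simp add: sum_times_bool)
qed

lemma hlayer_iff: "v \<in> hlayer n \<longleftrightarrow> (\<forall>i\<ge>n. fst v i = 0 \<and> snd v i = 0)"
  by (cases v) (auto simp: hlayer_def topspace_Euclidean_space)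

lemma heis_iff: "\<xi> \<in> heis n \<longleftrightarrow> Pr1 \<xi> \<in> hlayer n"
  by (cases \<xi>) (auto simp: hlayer_def heis_def)

lemma hlayer_closed [simp, intro]:
  "0 \<in> hlayer n" "v \<in> hlayer n \<Longrightarrow> w \<in> hlayer n \<Longrightarrow> v + w \<in> hlayer n"
  "v \<in> hlayer n \<Longrightarrow> w \<in> hlayer n \<Longrightarrow> v - w \<in> hlayer n"
  "v \<in> hlayer n \<Longrightarrow> - v \<in> hlayer n" "v \<in> hlayer n \<Longrightarrow> c *\<^sub>R v \<in> hlayer n"
  "vtrunc n v \<in> hlayer n"
  by (auto simp: hlayer_iff vtrunc_def)

lemma vtrunc_ident [simp]: "v \<in> hlayer n \<Longrightarrow> vtrunc n v = v"
  by (cases v) (auto simp: hlayer_iff vtrunc_def fun_eq_iff not_less)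

lemma ptrunc_ident [simp]: "\<xi> \<in> heis n \<Longrightarrow> ptrunc n \<xi> = \<xi>"
  by (rule hpoint_eqI) (auto simp: heis_iff ptrunc_def)

lemma ptrunc_heis [simp]: "ptrunc n \<xi> \<in> heis n"
  by (auto simp: heis_iff ptrunc_def)

lemma dot_trunc: "dot n (\<lambda>i. if i < n then x i else 0) y = dot n x y"
  "dot n y (\<lambda>i. if i < n then x i else 0) = dot n y x"
  by (auto simp: dot_def intro: sum.cong)

lemma hdot_vtrunc [simp]: "hdot n (vtrunc n v) w = hdot n v w" "hdot n w (vtrunc n v) = hdot n w v"
  by (simp_all add: hdot_eq vtrunc_def dot_trunc)

lemma hsymp_vtrunc [simp]: "hsymp n (vtrunc n v) w = hsymp n v w" "hsymp n w (vtrunc n v) = hsymp n w v"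
  by (simp_all add: hsymp_def vtrunc_def dot_trunc)

lemma nrm_vtrunc [simp]: "nrm n (vtrunc n v) = nrm n v"
  by (simp add: nrm_def)

lemma vtrunc_add: "vtrunc n (v + w) = vtrunc n v + vtrunc n w"
  by (auto simp: vtrunc_def fun_eq_iff prod_eq_iff)

lemma nrm_zero_imp_vtrunc:
  assumes "nrm n v = 0"
  shows "vtrunc n v = 0"
  using coord_le_nrm[of _ n v] assms by (auto simp: vtrunc_def fun_eq_iff prod_eq_iff)

lemma Pr1_ptrunc [simp]: "Pr1 (ptrunc n \<xi>) = vtrunc n (Pr1 \<xi>)"
  by (simp add: ptrunc_def)

lemma ht_ptrunc [simp]: "ht (ptrunc n \<xi>) = ht \<xi>"
  by (simp add: ptrunc_def)

lemma Pr1_hstep [simp]: "Pr1 (hstep n \<xi> v) = Pr1 \<xi> + v"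
  by (simp add: hstep_def prod_eq_iff)

lemma ht_hstep [simp]: "ht (hstep n \<xi> v) = ht \<xi> + 2 * hsymp n v (Pr1 \<xi>)"
  by (simp add: hstep_def)

lemma ptrunc_hstep: "ptrunc n (hstep n \<xi> v) = hstep n (ptrunc n \<xi>) (vtrunc n v)"
  by (rule hpoint_eqI) (simp_all add: vtrunc_add)

lemma hstep_heis [simp, intro]: "\<xi> \<in> heis n \<Longrightarrow> v \<in> hlayer n \<Longrightarrow> hstep n \<xi> v \<in> heis n"
  by (simp add: heis_iff)

lemma hstep_zero [simp]: "hstep n \<xi> 0 = \<xi>"
  by (rule hpoint_eqI) auto

text \<open>The symplectic form vanishes on parallel vectors, so steps along one direction simply
  add up: a horizontal line is a coset of a one-parameter subgroup.\<close>

lemma hstep_collinear: "hstep n (hstep n \<xi> (a *\<^sub>R v)) (b *\<^sub>R v) = hstep n \<xi> ((a + b) *\<^sub>R v)"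
  by (rule hpoint_eqI) (auto simp: algebra_simps)

lemma hstep_minus_cancel [simp]: "hstep n (hstep n \<xi> v) (- v) = \<xi>" "hstep n (hstep n \<xi> (- v)) v = \<xi>"
  by (rule hpoint_eqI; simp)+

lemma near_sym: "near n r \<xi> \<xi>' \<Longrightarrow> near n r \<xi>' \<xi>"
  unfolding near_def using nrm_minus_commute[of n "Pr1 \<xi>" "Pr1 \<xi>'"] hsymp_swap[of n "Pr1 \<xi>" "Pr1 \<xi>'"] by auto

text \<open>The height defects of the two legs add up to that of the composite, except for a
  symplectic cross term of size at most \<open>2 * q * r\<close>, which exactly completes the square
  \<open>(r + q)\<^sup>2\<close>.\<close>

lemma near_triangle:
  assumes "near n r a b" "near n q b c"
  shows "near n (r + q) a c"
proof -
  let ?u = "Pr1 b - Pr1 a" and ?w = "Pr1 c - Pr1 b"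
  have u: "nrm n ?u \<le> r" and w: "nrm n ?w \<le> q"
    using assms by (auto simp: near_def)
  have 1: "nrm n (Pr1 c - Pr1 a) \<le> r + q"
    using nrm_triangle[of n ?u ?w] u w by (simp add: algebra_simps)
  have "\<bar>hsymp n ?w ?u\<bar> \<le> q * r"
    using hsymp_le_nrm[of n ?w ?u] mult_mono[OF w u] nrm_nonneg order_trans[OF nrm_nonneg w] by fastforce
  moreover have "ht c - ht a - 2 * hsymp n (Pr1 c) (Pr1 a)
     = (ht b - ht a - 2 * hsymp n (Pr1 b) (Pr1 a)) + (ht c - ht b - 2 * hsymp n (Pr1 c) (Pr1 b)) + 2 * hsymp n ?w ?u"
    by simp
  ultimately have "\<bar>ht c - ht a - 2 * hsymp n (Pr1 c) (Pr1 a)\<bar> \<le> r\<^sup>2 + q\<^sup>2 + 2 * (q * r)"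
    using assms unfolding near_def by linarith
  with 1 show ?thesis
    by (simp add: near_def power2_sum mult_ac)
qed

lemma near_mono: "near n r \<xi> \<xi>' \<Longrightarrow> r \<le> q \<Longrightarrow> near n q \<xi> \<xi>'"
  unfolding near_def using nrm_nonneg[of n "Pr1 \<xi>' - Pr1 \<xi>"] power_mono[of r q 2] by linarith

lemma near_refl: "0 \<le> r \<Longrightarrow> near n r \<xi> \<xi>"
  by (simp add: near_def)

lemma near_hstep: "nrm n v \<le> r \<Longrightarrow> near n r \<xi> (hstep n \<xi> v)"
  by (simp add: near_def)

section \<open>Connecting points by three horizontal steps\<close>

definition eX :: hvec where "eX = ((\<lambda>i. if i = 0 then 1 else 0), 0)"
definition eY :: hvec where "eY = (0, (\<lambda>i. if i = 0 then 1 else 0))"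

lemma dot_delta: "j < n \<Longrightarrow> dot n (\<lambda>i. if i = j then c else 0) y = c * y j"
  by (simp add: dot_def if_distrib[of "\<lambda>x. x * _"] cong: if_cong)

lemma dot_delta': "j < n \<Longrightarrow> dot n y (\<lambda>i. if i = j then c else 0) = c * y j"
  using dot_delta dot_sym by metis

lemma basis_facts:
  assumes "1 \<le> n"
  shows "eX \<in> hlayer n" "eY \<in> hlayer n" "nrm n eX = 1" "nrm n eY = 1" "hsymp n eX eY = 1" "hsymp n eY eX = - 1"
  using assms by (auto simp: eX_def eY_def hlayer_iff nrm_def hdot_eq hsymp_def dot_delta)

text \<open>The steps \<open>z + u\<close>, \<open>w - z - u\<close>, \<open>z - w\<close> add up to
  the required displacement \<open>z\<close>, and their cross terms leave exactly the extra height
  \<open>2 * hsymp n w u\<close>. Taking \<open>w\<close> and \<open>u\<close> along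
  \<open>eX\<close> and \<open>eY\<close>, with lengths of order
  \<open>sqrt \<bar>\<tau>\<bar>\<close>, produces the missing height \<open>\<tau>\<close>.\<close>

lemma near_three_steps:
  assumes n: "1 \<le> n" and near: "near n r \<xi> \<xi>'"
  obtains v1 v2 v3 where "\<xi>' = hstep n (hstep n (hstep n \<xi> v1) v2) v3"
    "nrm n v1 \<le> 3 * r" "nrm n v2 \<le> 3 * r" "nrm n v3 \<le> 3 * r"
    "\<xi> \<in> heis n \<Longrightarrow> \<xi>' \<in> heis n \<Longrightarrow> v1 \<in> hlayer n \<and> v2 \<in> hlayer n \<and> v3 \<in> hlayer n"
proof -
  define z where "z = Pr1 \<xi>' - Pr1 \<xi>"
  define \<tau> where "\<tau> = ht \<xi>' - ht \<xi> - 2 * hsymp n (Pr1 \<xi>') (Pr1 \<xi>)"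
  define c where "c = sqrt \<bar>\<tau>\<bar>"
  define u where "u = (sgn \<tau> * c / 2) *\<^sub>R eY"
  define w where "w = c *\<^sub>R eX"
  have z: "nrm n z \<le> r" and \<tau>: "\<bar>\<tau>\<bar> \<le> r\<^sup>2"
    using near by (auto simp: near_def z_def \<tau>_def)
  have r: "0 \<le> r" using z nrm_nonneg order_trans by blast
  have c: "c \<le> r" "0 \<le> c" using \<tau> r by (auto simp: c_def real_le_lsqrt)
  have w: "nrm n w \<le> r" using c by (simp add: w_def basis_facts[OF n])
  have "nrm n u = \<bar>sgn \<tau>\<bar> * c / 2" using c by (simp add: u_def basis_facts[OF n] abs_mult)
  also have "\<dots> \<le> r" using c r by (auto simp: abs_sgn_eq)
  finally have u: "nrm n u \<le> r" .
  have B: "2 * hsymp n w u = \<tau>"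
  proof -
    have "2 * hsymp n w u = sgn \<tau> * (c * c)" by (simp add: w_def u_def basis_facts[OF n])
    also have "\<dots> = \<tau>" by (simp add: c_def sgn_mult_abs)
    finally show ?thesis .
  qed
  show thesis
  proof (rule that[of "z + u" "w - z - u" "z - w"])
    show "\<xi>' = hstep n (hstep n (hstep n \<xi> (z + u)) (w - z - u)) (z - w)"
    proof (rule hpoint_eqI)
      show "Pr1 \<xi>' = Pr1 (hstep n (hstep n (hstep n \<xi> (z + u)) (w - z - u)) (z - w))"
        by (simp add: z_def)
      have "ht (hstep n (hstep n (hstep n \<xi> (z + u)) (w - z - u)) (z - w))
          = ht \<xi> + 2 * hsymp n w u + 2 * hsymp n z (Pr1 \<xi>)"
        using hsymp_swap[of n w z] hsymp_swap[of n z u] by (simp add: algebra_simps)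
      then show "ht \<xi>' = ht (hstep n (hstep n (hstep n \<xi> (z + u)) (w - z - u)) (z - w))"
        unfolding B by (simp add: \<tau>_def z_def)
    qed
    show "nrm n (z + u) \<le> 3 * r" using nrm_triangle[of n z u] z u r by linarith
    show "nrm n (w - z - u) \<le> 3 * r"
      using nrm_triangle_diff[of n "w - z" u] nrm_triangle_diff[of n w z] z u w by linarith
    show "nrm n (z - w) \<le> 3 * r" using nrm_triangle_diff[of n z w] z w r by linarith
    assume "\<xi> \<in> heis n" "\<xi>' \<in> heis n"
    then have "z \<in> hlayer n" by (auto simp: z_def heis_iff)
    moreover have "u \<in> hlayer n" "w \<in> hlayer n" by (auto simp: u_def w_def basis_facts[OF n])
    ultimately show "z + u \<in> hlayer n \<and> w - z - u \<in> hlayer n \<and> z - w \<in> hlayer n" by auto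
  qed
qed

section \<open>Local Lipschitz continuity\<close>

text \<open>Working with \<open>F = \<phi> \<circ> ptrunc n\<close> instead of \<open>\<phi>\<close> makes all statements meaningful for arbitrary
  points and vectors, so that no carrier conditions are needed.\<close>
locale hconvex_fun =
  fixes n :: nat and F :: "hpoint \<Rightarrow> real"
  assumes n: "1 \<le> n"
    and F_ptrunc: "F (ptrunc n \<xi>) = F \<xi>"
    and conv: "0 \<le> s \<Longrightarrow> s \<le> 1 \<Longrightarrow>
      F (hstep n \<xi> (s *\<^sub>R v)) \<le> (1 - s) * F \<xi> + s * F (hstep n \<xi> v)"
begin

lemma convex_line: "convex_on UNIV (\<lambda>s. F (hstep n \<xi> (s *\<^sub>R v)))"
proof (rule convex_onI)
  fix t a b :: real
  assume t: "0 < t" "t < 1"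
  have "hstep n \<xi> (((1 - t) *\<^sub>R a + t *\<^sub>R b) *\<^sub>R v)
      = hstep n (hstep n \<xi> (a *\<^sub>R v)) (t *\<^sub>R (b - a) *\<^sub>R v)"
    unfolding scaleR_scaleR hstep_collinear by (simp add: algebra_simps)
  moreover have "hstep n \<xi> (b *\<^sub>R v) = hstep n (hstep n \<xi> (a *\<^sub>R v)) ((b - a) *\<^sub>R v)"
    by (simp add: hstep_collinear)
  ultimately show "F (hstep n \<xi> (((1 - t) *\<^sub>R a + t *\<^sub>R b) *\<^sub>R v))
      \<le> (1 - t) * F (hstep n \<xi> (a *\<^sub>R v)) + t * F (hstep n \<xi> (b *\<^sub>R v))"
    using conv[of t "hstep n \<xi> (a *\<^sub>R v)" "(b - a) *\<^sub>R v"] t by simp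
qed auto

lemma segment_le_max:
  assumes "a \<le> s" "s \<le> b"
  shows "F (hstep n \<xi> (s *\<^sub>R v)) \<le> max (F (hstep n \<xi> (a *\<^sub>R v))) (F (hstep n \<xi> (b *\<^sub>R v)))"
  using convex_on_le_max[of a b "\<lambda>s. F (hstep n \<xi> (s *\<^sub>R v))" s]
    convex_on_subset[OF convex_line] assms by auto

text \<open>Used in both directions: an upper bound at both ends bounds the middle, and an upper
  bound at one end turns a lower bound in the middle into one at the other end.\<close>

lemma midpoint: "2 * F \<xi> \<le> F (hstep n \<xi> v) + F (hstep n \<xi> (- v))"
proof -
  have "hstep n (hstep n \<xi> (- v)) ((1/2) *\<^sub>R 2 *\<^sub>R v) = \<xi>" "hstep n (hstep n \<xi> (- v)) (2 *\<^sub>R v) = hstep n \<xi> v"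
    using hstep_collinear[of n \<xi> "-1" v 1] hstep_collinear[of n \<xi> "-1" v 2] by simp_all
  then show ?thesis
    using conv[of "1/2" "hstep n \<xi> (- v)" "2 *\<^sub>R v"] by simp
qed

text \<open>The point at height \<open>2s\<close> above \<open>\<xi> = (x, y, 0)\<close> is the midpoint of the horizontal segment joining
  \<open>\<xi> \<circ> exp eY \<circ> exp (s eX)\<close> and \<open>\<xi> \<circ> exp (- eY) \<circ> exp (- s eX)\<close>, and as \<open>s\<close> varies each endpoint
  runs along one horizontal line, on which \<open>F\<close> is convex.\<close>
lemma bounded_above_vertical: "\<exists>M. \<forall>t. \<bar>t\<bar> \<le> T \<longrightarrow> F (x, y, t) \<le> M"
proof -
  let ?p = "hstep n (x, y, 0) eY" and ?m = "hstep n (x, y, 0) (- eY)"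
  let ?h = "\<lambda>\<xi> s. F (hstep n \<xi> (s *\<^sub>R eX))"
  let ?M = "max (max (?h ?p (- T)) (?h ?p T)) (max (?h ?m (- T)) (?h ?m T))"
  have "F (x, y, t) \<le> ?M" if t: "\<bar>t\<bar> \<le> T" for t
  proof -
    define s where "s = t / 2"
    define v where "v = s *\<^sub>R eX + eY"
    have "hstep n (x, y, t) v = hstep n ?p (s *\<^sub>R eX)" "hstep n (x, y, t) (- v) = hstep n ?m ((- s) *\<^sub>R eX)"
      by (rule hpoint_eqI; simp add: v_def basis_facts[OF n] s_def algebra_simps)+
    with midpoint[of "(x, y, t)" v]
    have "2 * F (x, y, t) \<le> ?h ?p s + ?h ?m (- s)" by simp
    moreover have "?h ?p s \<le> ?M" "?h ?m (- s) \<le> ?M"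
      using segment_le_max[of "- T" s T ?p eX] segment_le_max[of "- T" "- s" T ?m eX] t
      by (auto simp: s_def abs_le_iff)
    ultimately show ?thesis by linarith
  qed
  then show ?thesis by blast
qed

text \<open>The horizontal line in the \<open>j\<close>-th x-direction carries the point to
  \<open>x j = R\<close> and \<open>x j = - R\<close>, where the induction hypothesis applies. The
  height changes by at most \<open>4 * R * \<bar>y j\<bar>\<close> on the way, hence the enlarged
  height range.\<close>

lemma bounded_above_x:
  assumes "j \<le> n"
  shows "\<exists>M. \<forall>x' t. (\<forall>i. if i < j then \<bar>x' i\<bar> \<le> R else x' i = x i) \<and> \<bar>t\<bar> \<le> T \<longrightarrow> F (x', y, t) \<le> M"
  using assms
proof (induction j arbitrary: x T)
  case 0
  have "x' = x" if "\<forall>i. x' i = x i" for x' using that by (simp add: fun_eq_iff)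
  then show ?case using bounded_above_vertical[of T x y] by auto
next
  case (Suc j)
  let ?T = "T + 4 * R * \<bar>y j\<bar>"
  have j: "j \<le> n" using Suc.prems by simp
  obtain M1 where
    M1: "\<forall>x' t. (\<forall>i. if i < j then \<bar>x' i\<bar> \<le> R else x' i = (x(j := R)) i) \<and> \<bar>t\<bar> \<le> ?T \<longrightarrow> F (x', y, t) \<le> M1"
    using Suc.IH[OF j, of "x(j := R)" ?T] by blast
  obtain M2 where
    M2: "\<forall>x' t. (\<forall>i. if i < j then \<bar>x' i\<bar> \<le> R else x' i = (x(j := - R)) i) \<and> \<bar>t\<bar> \<le> ?T \<longrightarrow> F (x', y, t) \<le> M2"
    using Suc.IH[OF j, of "x(j := - R)" ?T] by blast
  have "F (x', y, t) \<le> max M2 M1"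
    if x': "\<forall>i. if i < Suc j then \<bar>x' i\<bar> \<le> R else x' i = x i" and t: "\<bar>t\<bar> \<le> T" for x' t
  proof -
    define v :: hvec where "v = ((\<lambda>i. if i = j then 1 else 0), 0)"
    have xj: "\<bar>x' j\<bar> \<le> R" and R: "0 \<le> R" using x' abs_ge_zero order_trans by (metis lessI)+
    have step: "hstep n (x', y, t) ((b - x' j) *\<^sub>R v) = (x'(j := b), y, t + 2 * (b - x' j) * y j)" for b
      using Suc.prems by (intro hpoint_eqI) (auto simp: v_def hsymp_def dot_delta)
    have small: "\<bar>t + 2 * (b - x' j) * y j\<bar> \<le> ?T" if "\<bar>b\<bar> \<le> R" for b
    proof -
      have "\<bar>2 * (b - x' j) * y j\<bar> = 2 * \<bar>b - x' j\<bar> * \<bar>y j\<bar>" by (simp only: abs_mult abs_numeral)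
      also have "\<dots> \<le> 2 * (2 * R) * \<bar>y j\<bar>"
        using that xj by (intro mult_right_mono mult_left_mono) auto
      finally show ?thesis using t by linarith
    qed
    have "F (x', y, t) \<le> max (F (x'(j := - R), y, t + 2 * (- R - x' j) * y j)) (F (x'(j := R), y, t + 2 * (R - x' j) * y j))"
      using segment_le_max[of "- R - x' j" 0 "R - x' j" "(x', y, t)" v] xj unfolding step[symmetric] by simp
    also have "\<dots> \<le> max M2 M1"
      using xj x' R by (intro max.mono M1[rule_format, OF conjI] M2[rule_format, OF conjI] small) auto
    finally show ?thesis .
  qed
  then show ?case by blast
qed

text \<open>The same induction over the y-coordinates, started from a full box in the x-coordinates.
  The height change is now governed by \<open>x' j\<close>, which is bounded by
  \<open>R\<close>.\<close>

lemma bounded_above_xy: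
  assumes "j \<le> n"
  shows "\<exists>M. \<forall>x' y' t. (\<forall>i<n. \<bar>x' i\<bar> \<le> R) \<and> (\<forall>i\<ge>n. x' i = 0) \<and>
    (\<forall>i. if i < j then \<bar>y' i\<bar> \<le> R else y' i = y i) \<and> \<bar>t\<bar> \<le> T \<longrightarrow> F (x', y', t) \<le> M"
  using assms
proof (induction j arbitrary: y T)
  case 0
  obtain M where M: "\<forall>x' t. (\<forall>i. if i < n then \<bar>x' i\<bar> \<le> R else x' i = 0) \<and> \<bar>t\<bar> \<le> T \<longrightarrow> F (x', y, t) \<le> M"
    using bounded_above_x[of n R "\<lambda>i. 0" T y] by blast
  show ?case
  proof (intro exI[of _ M] allI impI, elim conjE)
    fix x' y' t
    assume a: "\<forall>i<n. \<bar>x' i\<bar> \<le> R" "\<forall>i\<ge>n. x' i = 0" "\<forall>i. if i < 0 then \<bar>y' i\<bar> \<le> R else y' i = y i" "\<bar>t\<bar> \<le> T"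
    have "y' = y" using a(3) by (simp add: fun_eq_iff)
    then show "F (x', y', t) \<le> M" using a M by auto
  qed
next
  case (Suc j)
  let ?T = "T + 4 * R * R"
  have j: "j \<le> n" using Suc.prems by simp
  obtain M1 where
    M1: "\<forall>x' y' t. (\<forall>i<n. \<bar>x' i\<bar> \<le> R) \<and> (\<forall>i\<ge>n. x' i = 0) \<and>
      (\<forall>i. if i < j then \<bar>y' i\<bar> \<le> R else y' i = (y(j := R)) i) \<and> \<bar>t\<bar> \<le> ?T \<longrightarrow> F (x', y', t) \<le> M1"
    using Suc.IH[OF j, of "y(j := R)" ?T] by blast
  obtain M2 where
    M2: "\<forall>x' y' t. (\<forall>i<n. \<bar>x' i\<bar> \<le> R) \<and> (\<forall>i\<ge>n. x' i = 0) \<and>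
      (\<forall>i. if i < j then \<bar>y' i\<bar> \<le> R else y' i = (y(j := - R)) i) \<and> \<bar>t\<bar> \<le> ?T \<longrightarrow> F (x', y', t) \<le> M2"
    using Suc.IH[OF j, of "y(j := - R)" ?T] by blast
  have "F (x', y', t) \<le> max M2 M1"
    if x': "\<forall>i<n. \<bar>x' i\<bar> \<le> R" "\<forall>i\<ge>n. x' i = 0"
      and y': "\<forall>i. if i < Suc j then \<bar>y' i\<bar> \<le> R else y' i = y i" and t: "\<bar>t\<bar> \<le> T" for x' y' t
  proof -
    define v :: hvec where "v = (0, (\<lambda>i. if i = j then 1 else 0))"
    have yj: "\<bar>y' j\<bar> \<le> R" and xj: "\<bar>x' j\<bar> \<le> R" using x' y' Suc.prems by auto
    then have R: "0 \<le> R" by linarith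
    have step: "hstep n (x', y', t) ((b - y' j) *\<^sub>R v) = (x', y'(j := b), t - 2 * (b - y' j) * x' j)" for b
      using Suc.prems by (intro hpoint_eqI) (auto simp: v_def hsymp_def dot_delta')
    have small: "\<bar>t - 2 * (b - y' j) * x' j\<bar> \<le> ?T" if "\<bar>b\<bar> \<le> R" for b
    proof -
      have "\<bar>2 * (b - y' j) * x' j\<bar> = 2 * \<bar>b - y' j\<bar> * \<bar>x' j\<bar>" by (simp only: abs_mult abs_numeral)
      also have "\<dots> \<le> 2 * (2 * R) * R"
        using that yj xj by (intro mult_mono) auto
      finally show ?thesis using t by linarith
    qed
    have "F (x', y', t) \<le> max (F (x', y'(j := - R), t - 2 * (- R - y' j) * x' j)) (F (x', y'(j := R), t - 2 * (R - y' j) * x' j))"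
      using segment_le_max[of "- R - y' j" 0 "R - y' j" "(x', y', t)" v] yj unfolding step[symmetric] by simp
    also have "\<dots> \<le> max M2 M1"
      using yj x' y' R by (intro max.mono M1[rule_format, OF conjI] M2[rule_format, OF conjI] conjI small) auto
    finally show ?thesis .
  qed
  then show ?case by blast
qed

lemma near_hzero_iff: "near n r hzero \<xi> \<longleftrightarrow> nrm n (Pr1 \<xi>) \<le> r \<and> \<bar>ht \<xi>\<bar> \<le> r\<^sup>2"
proof -
  have "Pr1 hzero = 0" "ht hzero = 0"
    by (simp_all add: hzero_def zero_prod_def zero_fun_def)
  then show ?thesis by (simp add: near_def)
qed

lemma bounded_above: "\<exists>M. \<forall>\<xi>. near n r hzero \<xi> \<longrightarrow> F \<xi> \<le> M"
proof -
  obtain M where M: "\<forall>x' y' t. (\<forall>i<n. \<bar>x' i\<bar> \<le> r) \<and> (\<forall>i\<ge>n. x' i = 0) \<and>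
      (\<forall>i. if i < n then \<bar>y' i\<bar> \<le> r else y' i = 0) \<and> \<bar>t\<bar> \<le> r\<^sup>2 \<longrightarrow> F (x', y', t) \<le> M"
    using bounded_above_xy[of n r "\<lambda>i. 0" "r\<^sup>2"] by blast
  have "F \<xi> \<le> M" if "near n r hzero \<xi>" for \<xi>
  proof -
    have "\<bar>fst (Pr1 \<xi>) i\<bar> \<le> r \<and> \<bar>snd (Pr1 \<xi>) i\<bar> \<le> r" if "i < n" for i
      using coord_le_nrm[OF that, of "Pr1 \<xi>"] \<open>near n r hzero \<xi>\<close> by (auto simp: near_hzero_iff)
    then have "F (ptrunc n \<xi>) \<le> M"
      using that unfolding ptrunc_def by (intro M[rule_format]) (auto simp: vtrunc_def near_hzero_iff)
    then show ?thesis by (simp add: F_ptrunc)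
  qed
  then show ?thesis by blast
qed

text \<open>Lower bounds are carried outwards from \<open>hzero\<close>: by \<open>midpoint\<close>,
  a step loses at most \<open>F (hstep n \<xi> v) \<ge> 2 * F \<xi> - M\<close>, since the reflected
  endpoint still lies in the ball where \<open>F \<le> M\<close>. Three steps give
  \<open>8 * F hzero - 7 * M\<close>.\<close>

lemma bounded_local: "\<exists>M\<ge>0. \<forall>\<xi>. near n r hzero \<xi> \<longrightarrow> \<bar>F \<xi>\<bar> \<le> M"
proof -
  obtain M where M: "\<And>\<xi>. near n (12 * \<bar>r\<bar>) hzero \<xi> \<Longrightarrow> F \<xi> \<le> M"
    using bounded_above by blast
  have lower: "F (hstep n \<xi> v) \<ge> 2 * F \<xi> - M" if "near n q hzero \<xi>" "q \<le> 9 * \<bar>r\<bar>" "nrm n v \<le> 3 * \<bar>r\<bar>" for q \<xi> v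
  proof -
    have "near n (q + 3 * \<bar>r\<bar>) hzero (hstep n \<xi> (- v))"
      using that by (intro near_triangle[OF that(1)] near_hstep) auto
    then have "F (hstep n \<xi> (- v)) \<le> M"
      using that(2) by (intro M) (erule near_mono, simp)
    then show ?thesis using midpoint[of \<xi> v] by linarith
  qed
  have "F \<xi> \<le> M \<and> F \<xi> \<ge> 8 * F hzero - 7 * M" if "near n r hzero \<xi>" for \<xi>
  proof -
    have nr: "near n \<bar>r\<bar> hzero \<xi>" using near_mono[OF that] by auto
    then obtain v1 v2 v3 where \<xi>: "\<xi> = hstep n (hstep n (hstep n hzero v1) v2) v3"
      and v: "nrm n v1 \<le> 3 * \<bar>r\<bar>" "nrm n v2 \<le> 3 * \<bar>r\<bar>" "nrm n v3 \<le> 3 * \<bar>r\<bar>"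
      by (rule near_three_steps[OF n])
    have 0: "near n 0 hzero hzero" by (simp add: near_refl)
    have 1: "near n (0 + 3 * \<bar>r\<bar>) hzero (hstep n hzero v1)"
      by (rule near_triangle[OF 0 near_hstep[OF v(1)]])
    have 2: "near n (0 + 3 * \<bar>r\<bar> + 3 * \<bar>r\<bar>) hzero (hstep n (hstep n hzero v1) v2)"
      by (rule near_triangle[OF 1 near_hstep[OF v(2)]])
    have "F \<xi> \<le> M" using near_mono[OF nr] by (intro M) auto
    moreover have "F (hstep n hzero v1) \<ge> 2 * F hzero - M" using lower[OF 0 _ v(1)] by simp
    moreover have "F (hstep n (hstep n hzero v1) v2) \<ge> 2 * F (hstep n hzero v1) - M"
      using lower[OF 1 _ v(2)] by simp
    moreover have "F \<xi> \<ge> 2 * F (hstep n (hstep n hzero v1) v2) - M"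
      unfolding \<xi> using lower[OF 2 _ v(3)] by simp
    ultimately show ?thesis by linarith
  qed
  then show ?thesis
    by (intro exI[of _ "max \<bar>M\<bar> \<bar>8 * F hzero - 7 * M\<bar>"]) fastforce
qed

text \<open>A step of length \<open>\<tau>\<close> is stretched to length at most 1; convexity then
  bounds the increment by \<open>\<tau>\<close> times the oscillation \<open>2 * M\<close>, and the
  reversed step gives the other sign. Three steps of length \<open>3 * \<tau> \<le> 1\<close> yield
  the constant \<open>18 * M\<close>.\<close>

lemma lipschitz_local:
  "\<exists>C\<ge>0. \<forall>\<xi> \<xi>' \<tau>. near n r hzero \<xi> \<and> near n \<tau> \<xi> \<xi>' \<and> 0 < \<tau> \<and> \<tau> \<le> 1/3 \<longrightarrow> \<bar>F \<xi>' - F \<xi>\<bar> \<le> C * \<tau>"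
proof -
  obtain M where M: "0 \<le> M" "\<And>\<xi>. near n (r + 4) hzero \<xi> \<Longrightarrow> \<bar>F \<xi>\<bar> \<le> M"
    using bounded_local by blast
  have upper: "F (hstep n \<xi> v) - F \<xi> \<le> 2 * M * \<tau>"
    if "near n q hzero \<xi>" "q \<le> r + 3" "nrm n v \<le> \<tau>" "0 < \<tau>" "\<tau> \<le> 1" for q \<xi> v \<tau>
  proof -
    let ?w = "(1 / \<tau>) *\<^sub>R v"
    have "near n (q + 1) hzero (hstep n \<xi> ?w)"
      using that by (intro near_triangle[OF that(1)] near_hstep) auto
    then have "\<bar>F (hstep n \<xi> ?w)\<bar> \<le> M" "\<bar>F \<xi>\<bar> \<le> M"
      using that(2) near_mono[OF that(1), of "r + 4"] near_mono[of n "q + 1" hzero "hstep n \<xi> ?w" "r + 4"]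
      by (auto intro!: M(2))
    then have *: "F (hstep n \<xi> ?w) - F \<xi> \<le> 2 * M" by linarith
    have "F (hstep n \<xi> v) - F \<xi> \<le> \<tau> * (F (hstep n \<xi> ?w) - F \<xi>)"
      using conv[of \<tau> \<xi> ?w] that by (simp add: algebra_simps)
    also have "\<dots> \<le> \<tau> * (2 * M)" using * that by (intro mult_left_mono) auto
    finally show ?thesis by (simp add: mult_ac)
  qed
  have both: "\<bar>F (hstep n \<xi> v) - F \<xi>\<bar> \<le> 2 * M * \<tau>"
    if "near n q hzero \<xi>" "q \<le> r + 2" "nrm n v \<le> \<tau>" "0 < \<tau>" "\<tau> \<le> 1" for q \<xi> v \<tau>
  proof -
    have "near n (q + 1) hzero (hstep n \<xi> v)"
      using that by (intro near_triangle[OF that(1)] near_hstep) auto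
    then show ?thesis
      using upper[of q \<xi> v \<tau>] upper[of "q + 1" "hstep n \<xi> v" "- v" \<tau>] that by auto
  qed
  have "\<bar>F \<xi>' - F \<xi>\<bar> \<le> (18 * M) * \<tau>" if nr: "near n r hzero \<xi>" "near n \<tau> \<xi> \<xi>'" and \<tau>: "0 < \<tau>" "\<tau> \<le> 1/3" for \<xi> \<xi>' \<tau>
  proof -
    obtain v1 v2 v3 where \<xi>': "\<xi>' = hstep n (hstep n (hstep n \<xi> v1) v2) v3"
      and v: "nrm n v1 \<le> 3 * \<tau>" "nrm n v2 \<le> 3 * \<tau>" "nrm n v3 \<le> 3 * \<tau>"
      by (rule near_three_steps[OF n nr(2)])
    have 1: "near n (r + 3 * \<tau>) hzero (hstep n \<xi> v1)"
      by (rule near_triangle[OF nr(1) near_hstep[OF v(1)]])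
    have 2: "near n (r + 3 * \<tau> + 3 * \<tau>) hzero (hstep n (hstep n \<xi> v1) v2)"
      by (rule near_triangle[OF 1 near_hstep[OF v(2)]])
    show ?thesis
      using both[OF nr(1) _ v(1)] both[OF 1 _ v(2)] both[OF 2 _ v(3)] \<tau> unfolding \<xi>' by auto
  qed
  then show ?thesis using M(1) by (intro exI[of _ "18 * M"]) auto
qed

section \<open>Sequential continuity in Euclidean coordinates\<close>

definition seq_conv :: "(nat \<Rightarrow> hpoint) \<Rightarrow> hpoint \<Rightarrow> bool" where
  "seq_conv X \<xi> \<longleftrightarrow> (\<lambda>k. nrm n (Pr1 (X k) - Pr1 \<xi>)) \<longlonglongrightarrow> 0 \<and> (\<lambda>k. ht (X k)) \<longlonglongrightarrow> ht \<xi>"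

lemma tendsto_hsymp:
  assumes "(\<lambda>k. nrm n (Z k - z)) \<longlonglongrightarrow> 0"
  shows "(\<lambda>k. hsymp n v (Z k)) \<longlonglongrightarrow> hsymp n v z"
proof -
  have "(\<lambda>k. hsymp n v (Z k - z)) \<longlonglongrightarrow> 0"
  proof (rule Lim_null_comparison)
    show "\<forall>\<^sub>F k in sequentially. norm (hsymp n v (Z k - z)) \<le> nrm n v * nrm n (Z k - z)"
      by (simp only: real_norm_def hsymp_le_nrm eventually_True)
    show "(\<lambda>k. nrm n v * nrm n (Z k - z)) \<longlonglongrightarrow> 0"
      using tendsto_mult_left[OF assms, of "nrm n v"] by simp
  qed
  then show ?thesis by (simp add: LIM_zero_iff)
qed

lemma seq_conv_hstep:
  assumes "seq_conv X \<xi>"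
  shows "seq_conv (\<lambda>k. hstep n (X k) v) (hstep n \<xi> v)"
  using assms tendsto_hsymp[of "\<lambda>k. Pr1 (X k)" "Pr1 \<xi>" v] unfolding seq_conv_def
  by (auto intro!: tendsto_intros)

text \<open>The symplectic correction in \<open>near\<close> is continuous and vanishes at the limit
  point, so it does not disturb Euclidean convergence.\<close>

lemma seq_conv_near:
  assumes "seq_conv X \<xi>" "0 < \<delta>"
  shows "\<forall>\<^sub>F k in sequentially. near n \<delta> \<xi> (X k)"
proof -
  have lim: "(\<lambda>k. nrm n (Pr1 (X k) - Pr1 \<xi>)) \<longlonglongrightarrow> 0" "(\<lambda>k. ht (X k)) \<longlonglongrightarrow> ht \<xi>"
    using assms(1) by (auto simp: seq_conv_def)
  have swap: "hsymp n (Pr1 (X k)) (Pr1 \<xi>) = - hsymp n (Pr1 \<xi>) (Pr1 (X k))" for k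
    by (rule hsymp_swap)
  have "(\<lambda>k. ht (X k) - ht \<xi> - 2 * (- hsymp n (Pr1 \<xi>) (Pr1 (X k)))) \<longlonglongrightarrow> ht \<xi> - ht \<xi> - 2 * (- hsymp n (Pr1 \<xi>) (Pr1 \<xi>))"
    by (intro tendsto_intros lim tendsto_hsymp)
  then have "(\<lambda>k. ht (X k) - ht \<xi> - 2 * hsymp n (Pr1 (X k)) (Pr1 \<xi>)) \<longlonglongrightarrow> 0"
    by (simp add: swap)
  from tendsto_rabs_zero[OF this]
  have "\<forall>\<^sub>F k in sequentially. \<bar>ht (X k) - ht \<xi> - 2 * hsymp n (Pr1 (X k)) (Pr1 \<xi>)\<bar> < \<delta>\<^sup>2"
    using assms(2) by (intro order_tendstoD) auto
  moreover have "\<forall>\<^sub>F k in sequentially. nrm n (Pr1 (X k) - Pr1 \<xi>) < \<delta>"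
    using assms unfolding seq_conv_def by (auto intro: order_tendstoD)
  ultimately show ?thesis
    by eventually_elim (simp add: near_def)
qed

lemma exists_near_hzero: "\<exists>r. near n r hzero \<xi>"
proof -
  have "\<bar>ht \<xi>\<bar> \<le> (1 + \<bar>ht \<xi>\<bar>)\<^sup>2"
    by (simp add: power2_eq_square algebra_simps)
  also have "\<dots> \<le> (nrm n (Pr1 \<xi>) + (1 + \<bar>ht \<xi>\<bar>))\<^sup>2"
    by (intro power_mono) auto
  finally have "near n (nrm n (Pr1 \<xi>) + (1 + \<bar>ht \<xi>\<bar>)) hzero \<xi>"
    by (simp add: near_hzero_iff)
  then show ?thesis ..
qed

lemma tendsto_F:
  assumes "seq_conv X \<xi>"
  shows "(\<lambda>k. F (X k)) \<longlonglongrightarrow> F \<xi>"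
proof (rule LIMSEQ_I)
  fix e :: real assume e: "0 < e"
  obtain r where r: "near n r hzero \<xi>" using exists_near_hzero by blast
  obtain C where C: "0 \<le> C" "\<And>\<xi>' \<tau>. near n \<tau> \<xi> \<xi>' \<Longrightarrow> 0 < \<tau> \<Longrightarrow> \<tau> \<le> 1/3 \<Longrightarrow> \<bar>F \<xi>' - F \<xi>\<bar> \<le> C * \<tau>"
    using lipschitz_local[of r] r by blast
  define \<tau> where "\<tau> = min (1/3) (e / (C + 1))"
  have \<tau>: "0 < \<tau>" "\<tau> \<le> 1/3" unfolding \<tau>_def using e C by (simp, intro min.cobounded1)
  have "C * \<tau> \<le> C * (e / (C + 1))" using C by (intro mult_left_mono) (auto simp: \<tau>_def)
  also have "\<dots> < e" using C e by (simp add: field_simps)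
  finally have small: "C * \<tau> < e" .
  obtain N where "\<And>k. k \<ge> N \<Longrightarrow> near n \<tau> \<xi> (X k)"
    using seq_conv_near[OF assms \<tau>(1)] unfolding eventually_sequentially by blast
  then have "\<bar>F (X k) - F \<xi>\<bar> < e" if "k \<ge> N" for k
    using C(2)[of \<tau> "X k"] \<tau> small that by force
  then have "\<forall>k\<ge>N. norm (F (X k) - F \<xi>) < e" by simp
  then show "\<exists>N. \<forall>k\<ge>N. norm (F (X k) - F \<xi>) < e" ..
qed

end

section \<open>Existence of horizontal subgradients\<close>

text \<open>Bolzano-Weierstrass for finitely many coordinates, passing to one further subsequence
  per coordinate.\<close>

lemma bounded_family_subsequence:
  fixes f :: "nat \<Rightarrow> 'b \<Rightarrow> real"
  assumes "finite D" "\<And>i k. i \<in> D \<Longrightarrow> \<bar>f k i\<bar> \<le> R"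
  shows "\<exists>r l. strict_mono (r :: nat \<Rightarrow> nat) \<and> (\<forall>i\<in>D. (\<lambda>k. f (r k) i) \<longlonglongrightarrow> l i)"
  using assms
proof (induction D rule: finite_induct)
  case empty
  then show ?case using strict_mono_id by auto
next
  case (insert a D)
  then obtain r l where r: "strict_mono (r :: nat \<Rightarrow> nat)" "\<forall>i\<in>D. (\<lambda>k. f (r k) i) \<longlonglongrightarrow> l i"
    by auto
  have "bounded (range (\<lambda>k. f (r k) a))"
    using insert.prems by (intro boundedI[of _ R]) auto
  then obtain m q where q: "strict_mono (q :: nat \<Rightarrow> nat)" "((\<lambda>k. f (r k) a) \<circ> q) \<longlonglongrightarrow> m"
    using bounded_imp_convergent_subsequence by blast
  have "(\<lambda>k. f ((r \<circ> q) k) i) \<longlonglongrightarrow> (l(a := m)) i" if "i \<in> insert a D" for i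
  proof (cases "i = a")
    case True
    then show ?thesis using q by (simp add: o_def)
  next
    case False
    then have "(\<lambda>k. f (r k) i) \<longlonglongrightarrow> l i" using r that by auto
    from LIMSEQ_subseq_LIMSEQ[OF this q(1)] False show ?thesis by (simp add: o_def)
  qed
  moreover have "strict_mono (r \<circ> q)" using r q by (simp add: strict_mono_o)
  ultimately show ?case by blast
qed

text \<open>The limit is set to zero beyond \<open>n\<close>, so it lies in the layer even when the
  sequence does not.\<close>

lemma nrm_bounded_subsequence:
  assumes "\<And>k. nrm n (Z k) \<le> R"
  obtains r z where "strict_mono (r :: nat \<Rightarrow> nat)" "z \<in> hlayer n" "(\<lambda>k. nrm n (Z (r k) - z)) \<longlonglongrightarrow> 0"
proof -
  have "\<bar>coord (Z k) p\<bar> \<le> R" if "p \<in> {..<n} \<times> UNIV" for p k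
    using that coord_le_nrm[of "fst p" n "Z k"] assms[of k] by (auto split: prod.splits)
  then obtain r l where r: "strict_mono (r :: nat \<Rightarrow> nat)"
    and l: "\<forall>p\<in>{..<n} \<times> UNIV. (\<lambda>k. coord (Z (r k)) p) \<longlonglongrightarrow> l p"
    using bounded_family_subsequence[of "{..<n} \<times> UNIV" "\<lambda>k. coord (Z k)" R] by auto
  define z :: hvec where "z = ((\<lambda>i. if i < n then l (i, True) else 0), (\<lambda>i. if i < n then l (i, False) else 0))"
  have "(\<lambda>k. \<bar>fst (Z (r k) - z) i\<bar> + \<bar>snd (Z (r k) - z) i\<bar>) \<longlonglongrightarrow> 0" if "i < n" for i
  proof -
    have "(\<lambda>k. fst (Z (r k)) i) \<longlonglongrightarrow> fst z i" "(\<lambda>k. snd (Z (r k)) i) \<longlonglongrightarrow> snd z i"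
      using bspec[OF l, of "(i, True)"] bspec[OF l, of "(i, False)"] that by (auto simp: z_def)
    then have "(\<lambda>k. \<bar>fst (Z (r k)) i - fst z i\<bar> + \<bar>snd (Z (r k)) i - snd z i\<bar>) \<longlonglongrightarrow> \<bar>fst z i - fst z i\<bar> + \<bar>snd z i - snd z i\<bar>"
      by (intro tendsto_intros)
    then show ?thesis by simp
  qed
  then have "(\<lambda>k. \<Sum>i<n. \<bar>fst (Z (r k) - z) i\<bar> + \<bar>snd (Z (r k) - z) i\<bar>) \<longlonglongrightarrow> (\<Sum>i<n. 0)"
    by (intro tendsto_sum) auto
  then have "(\<lambda>k. nrm n (Z (r k) - z)) \<longlonglongrightarrow> 0"
    by (intro Lim_null_comparison[of "\<lambda>k. nrm n (Z (r k) - z)" "\<lambda>k. \<Sum>i<n. \<bar>fst (Z (r k) - z) i\<bar> + \<bar>snd (Z (r k) - z) i\<bar>"])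
       (simp_all only: real_norm_def abs_of_nonneg[OF nrm_nonneg] nrm_le_sum eventually_True sum.neutral_const)
  moreover have "z \<in> hlayer n" by (simp add: z_def hlayer_iff)
  ultimately show thesis using r that by blast
qed

context hconvex_fun
begin

text \<open>Neither \<open>p\<close> nor \<open>v\<close> is confined to the layer; a subgradient is
  therefore determined at best up to \<open>vtrunc\<close>.\<close>

definition subg :: "hpoint \<Rightarrow> hvec \<Rightarrow> bool" where
  "subg \<xi> p \<longleftrightarrow> (\<forall>v. F \<xi> + hdot n p v \<le> F (hstep n \<xi> v))"

lemma subgD: "subg \<xi> p \<Longrightarrow> F \<xi> + hdot n p v \<le> F (hstep n \<xi> v)"
  unfolding subg_def by blast

text \<open>Testing the subgradient inequality on the unit vector along \<open>p\<close> bounds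
  \<open>nrm n p\<close> by the oscillation of \<open>F\<close>.\<close>

lemma subg_bounded: "\<exists>C. \<forall>\<xi> p. near n r hzero \<xi> \<and> subg \<xi> p \<longrightarrow> nrm n p \<le> C"
proof -
  obtain M where M: "0 \<le> M" "\<And>\<xi>. near n (r + 1) hzero \<xi> \<Longrightarrow> \<bar>F \<xi>\<bar> \<le> M"
    using bounded_local by blast
  have "nrm n p \<le> 2 * M" if \<xi>: "near n r hzero \<xi>" and p: "subg \<xi> p" for \<xi> p
  proof (cases "nrm n p = 0")
    case False
    define v where "v = (1 / nrm n p) *\<^sub>R p"
    have v: "nrm n v = 1" using False by (simp add: v_def)
    have "nrm n p = hdot n p v"
      using False by (simp add: v_def nrm_square[symmetric] power2_eq_square)
    moreover have "\<bar>F \<xi>\<bar> \<le> M" using near_mono[OF \<xi>] by (intro M) auto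
    moreover have "\<bar>F (hstep n \<xi> v)\<bar> \<le> M"
      using v by (intro M near_triangle[OF \<xi> near_hstep]) auto
    moreover have "F \<xi> + hdot n p v \<le> F (hstep n \<xi> v)" using p by (rule subgD)
    ultimately show ?thesis by linarith
  qed (use M in auto)
  then show ?thesis by blast
qed

lemma tendsto_hdot:
  assumes "(\<lambda>k. nrm n (P k - p)) \<longlonglongrightarrow> 0"
  shows "(\<lambda>k. hdot n (P k) v) \<longlonglongrightarrow> hdot n p v"
proof -
  have "(\<lambda>k. hdot n (P k - p) v) \<longlonglongrightarrow> 0"
  proof (rule Lim_null_comparison)
    show "\<forall>\<^sub>F k in sequentially. norm (hdot n (P k - p) v) \<le> nrm n (P k - p) * nrm n v"
      by (simp only: real_norm_def hdot_le_nrm eventually_True)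
    show "(\<lambda>k. nrm n (P k - p) * nrm n v) \<longlonglongrightarrow> 0"
      using tendsto_mult_right[OF assms, of "nrm n v"] by simp
  qed
  then show ?thesis by (simp add: LIM_zero_iff)
qed

lemma seq_conv_subseq: "seq_conv X \<xi> \<Longrightarrow> strict_mono r \<Longrightarrow> seq_conv (\<lambda>k. X (r k)) \<xi>"
  unfolding seq_conv_def using LIMSEQ_subseq_LIMSEQ[of _ _ r] by (fastforce simp: o_def)

text \<open>Subgradients at nearby points are bounded, hence subconvergent, and the subgradient
  inequality is closed because \<open>F\<close> is sequentially continuous.\<close>

lemma subg_limit:
  assumes X: "seq_conv X \<xi>" and p: "\<And>k. subg (X k) (p k)"
  obtains r q where "strict_mono (r :: nat \<Rightarrow> nat)" "q \<in> hlayer n" "subg \<xi> q" "(\<lambda>k. nrm n (p (r k) - q)) \<longlonglongrightarrow> 0"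
proof -
  obtain N where N: "\<And>k. k \<ge> N \<Longrightarrow> near n 1 \<xi> (X k)"
    using seq_conv_near[OF X, of 1] unfolding eventually_sequentially by auto
  obtain R where R: "near n R hzero \<xi>" using exists_near_hzero by blast
  obtain C where C: "\<And>\<xi> p. near n (R + 1) hzero \<xi> \<Longrightarrow> subg \<xi> p \<Longrightarrow> nrm n p \<le> C"
    using subg_bounded by blast
  have "nrm n (p (k + N)) \<le> C" for k
    by (rule C[OF near_triangle[OF R N] p]) simp
  then obtain r q where r: "strict_mono (r :: nat \<Rightarrow> nat)" and q: "q \<in> hlayer n"
    and lim: "(\<lambda>k. nrm n (p (r k + N) - q)) \<longlonglongrightarrow> 0"
    by (rule nrm_bounded_subsequence)
  define r' where "r' = (\<lambda>k. r k + N)"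
  have r': "strict_mono r'" using r by (simp add: r'_def strict_mono_def)
  have lim': "(\<lambda>k. nrm n (p (r' k) - q)) \<longlonglongrightarrow> 0" using lim by (simp add: r'_def)
  have X': "seq_conv (\<lambda>k. X (r' k)) \<xi>" using seq_conv_subseq[OF X r'] .
  have "subg \<xi> q"
    unfolding subg_def
  proof
    fix v
    have "(\<lambda>k. F (X (r' k)) + hdot n (p (r' k)) v) \<longlonglongrightarrow> F \<xi> + hdot n q v"
      by (intro tendsto_intros tendsto_F X' tendsto_hdot lim')
    moreover have "(\<lambda>k. F (hstep n (X (r' k)) v)) \<longlonglongrightarrow> F (hstep n \<xi> v)"
      by (intro tendsto_F seq_conv_hstep X')
    ultimately show "F \<xi> + hdot n q v \<le> F (hstep n \<xi> v)"
      by (rule LIMSEQ_le) (use subgD[OF p] in blast)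
  qed
  then show thesis using that r' q lim' by blast
qed

section \<open>Penalised minimisation and subgradients at every point\<close>

definition sqd :: "hpoint \<Rightarrow> hpoint \<Rightarrow> real" where
  "sqd \<xi>0 \<xi> = (nrm n (Pr1 \<xi> - Pr1 \<xi>0))\<^sup>2 + (ht \<xi> - ht \<xi>0)\<^sup>2"

definition cyl :: "hpoint \<Rightarrow> hpoint set" where
  "cyl \<xi>0 = {\<xi>. nrm n (Pr1 \<xi> - Pr1 \<xi>0) \<le> 1 \<and> \<bar>ht \<xi> - ht \<xi>0\<bar> \<le> 1}"

lemma cyl_seq_compact:
  assumes "\<And>k. X k \<in> cyl \<xi>0"
  obtains r \<xi> where "strict_mono (r :: nat \<Rightarrow> nat)" "\<xi> \<in> cyl \<xi>0" "seq_conv (\<lambda>k. X (r k)) \<xi>"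
proof -
  have "nrm n (Pr1 (X k) - Pr1 \<xi>0) \<le> 1" for k using assms by (simp add: cyl_def)
  then obtain r z where r: "strict_mono (r :: nat \<Rightarrow> nat)" and z: "(\<lambda>k. nrm n (Pr1 (X (r k)) - Pr1 \<xi>0 - z)) \<longlonglongrightarrow> 0"
    by (rule nrm_bounded_subsequence)
  have ht: "\<bar>ht (X k) - ht \<xi>0\<bar> \<le> 1" for k using assms by (simp add: cyl_def)
  have "bounded (range (\<lambda>k. ht (X (r k)) - ht \<xi>0))"
    using ht by (intro boundedI[of _ 1]) auto
  then obtain m q where q: "strict_mono (q :: nat \<Rightarrow> nat)" and m: "((\<lambda>k. ht (X (r k)) - ht \<xi>0) \<circ> q) \<longlonglongrightarrow> m"
    using bounded_imp_convergent_subsequence by blast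
  define \<xi> :: hpoint where "\<xi> = (fst (Pr1 \<xi>0 + z), snd (Pr1 \<xi>0 + z), ht \<xi>0 + m)"
  have \<xi>: "Pr1 \<xi> = Pr1 \<xi>0 + z" "ht \<xi> = ht \<xi>0 + m" unfolding \<xi>_def by (simp_all add: prod_eq_iff)
  have 1: "(\<lambda>k. nrm n (Pr1 (X (r (q k))) - Pr1 \<xi>)) \<longlonglongrightarrow> 0"
    using LIMSEQ_subseq_LIMSEQ[OF z q] by (simp add: \<xi> o_def diff_diff_eq)
  have 2: "(\<lambda>k. ht (X (r (q k)))) \<longlonglongrightarrow> ht \<xi>"
    using tendsto_add[OF m tendsto_const[of "ht \<xi>0"]] by (simp add: \<xi> o_def add.commute)
  have "nrm n (Pr1 \<xi> - Pr1 \<xi>0) \<le> 1"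
  proof (rule LIMSEQ_le_const)
    show "(\<lambda>k. 1 + nrm n (Pr1 (X (r (q k))) - Pr1 \<xi>)) \<longlonglongrightarrow> 1"
      using tendsto_add[OF tendsto_const 1, of 1] by simp
    have "nrm n (Pr1 \<xi> - Pr1 \<xi>0) \<le> 1 + nrm n (Pr1 (X (r (q k))) - Pr1 \<xi>)" for k
      using nrm_triangle_diff[of n "Pr1 (X (r (q k))) - Pr1 \<xi>0" "Pr1 (X (r (q k))) - Pr1 \<xi>"] assms[of "r (q k)"]
      by (simp add: cyl_def)
    then show "\<exists>N. \<forall>k\<ge>N. nrm n (Pr1 \<xi> - Pr1 \<xi>0) \<le> 1 + nrm n (Pr1 (X (r (q k))) - Pr1 \<xi>)" by blast
  qed
  moreover have "\<bar>ht \<xi> - ht \<xi>0\<bar> \<le> 1"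
    using tendsto_rabs[OF m] ht by (intro LIMSEQ_le_const2[of "\<lambda>k. \<bar>ht (X (r (q k))) - ht \<xi>0\<bar>"]) (auto simp: o_def \<xi>)
  ultimately have "\<xi> \<in> cyl \<xi>0" by (simp add: cyl_def)
  moreover have "seq_conv (\<lambda>k. X ((r \<circ> q) k)) \<xi>" using 1 2 by (simp add: seq_conv_def)
  ultimately show thesis using that[of "r \<circ> q" \<xi>] r q by (simp add: strict_mono_o)
qed

lemma cyl_bounded: "\<exists>M\<ge>0. \<forall>\<xi>\<in>cyl \<xi>0. \<bar>F \<xi>\<bar> \<le> M"
proof -
  define r where "r = nrm n (Pr1 \<xi>0) + \<bar>ht \<xi>0\<bar> + 1"
  have "near n r hzero \<xi>" if "\<xi> \<in> cyl \<xi>0" for \<xi>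
  proof -
    have "nrm n (Pr1 \<xi>) \<le> r"
      using nrm_triangle[of n "Pr1 \<xi> - Pr1 \<xi>0" "Pr1 \<xi>0"] that abs_ge_zero[of "ht \<xi>0"]
      by (simp add: cyl_def r_def del: abs_ge_zero)
    moreover have "\<bar>ht \<xi> - ht \<xi>0\<bar> \<le> 1" using that by (simp add: cyl_def)
    then have "\<bar>ht \<xi>\<bar> \<le> r" using nrm_nonneg[of n "Pr1 \<xi>0"] unfolding r_def by linarith
    moreover have "r * 1 \<le> r * r" using nrm_nonneg[of n "Pr1 \<xi>0"] by (intro mult_left_mono) (auto simp: r_def)
    ultimately show ?thesis by (simp add: near_hzero_iff power2_eq_square)
  qed
  then show ?thesis using bounded_local[of r] by blast
qed

lemma tendsto_sqd:
  assumes "seq_conv X \<xi>"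
  shows "(\<lambda>k. sqd \<xi>0 (X k)) \<longlonglongrightarrow> sqd \<xi>0 \<xi>"
proof -
  have "(\<lambda>k. nrm n (Pr1 (X k) - Pr1 \<xi>0) - nrm n (Pr1 \<xi> - Pr1 \<xi>0)) \<longlonglongrightarrow> 0"
  proof (rule Lim_null_comparison)
    have "\<bar>nrm n (Pr1 (X k) - Pr1 \<xi>0) - nrm n (Pr1 \<xi> - Pr1 \<xi>0)\<bar> \<le> nrm n (Pr1 (X k) - Pr1 \<xi>)" for k
      using nrm_triangle[of n "Pr1 (X k) - Pr1 \<xi>" "Pr1 \<xi> - Pr1 \<xi>0"]
        nrm_triangle_diff[of n "Pr1 (X k) - Pr1 \<xi>0" "Pr1 (X k) - Pr1 \<xi>"] by simp
    then show "\<forall>\<^sub>F k in sequentially. norm (nrm n (Pr1 (X k) - Pr1 \<xi>0) - nrm n (Pr1 \<xi> - Pr1 \<xi>0)) \<le> nrm n (Pr1 (X k) - Pr1 \<xi>)"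
      by simp
  qed (use assms in \<open>simp add: seq_conv_def\<close>)
  then have "(\<lambda>k. nrm n (Pr1 (X k) - Pr1 \<xi>0)) \<longlonglongrightarrow> nrm n (Pr1 \<xi> - Pr1 \<xi>0)"
    by (simp add: LIM_zero_iff)
  then show ?thesis
    unfolding sqd_def using assms
    by (intro tendsto_add tendsto_power tendsto_diff tendsto_const) (auto simp: seq_conv_def)
qed

text \<open>Direct method: a minimising sequence subconverges inside the cylinder, and the penalised
  function is sequentially continuous.\<close>

lemma exists_minimizer:
  assumes "0 \<le> c"
  obtains \<xi> where "\<xi> \<in> cyl \<xi>0" "\<And>\<eta>. \<eta> \<in> cyl \<xi>0 \<Longrightarrow> F \<xi> + c * sqd \<xi>0 \<xi> \<le> F \<eta> + c * sqd \<xi>0 \<eta>"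
proof -
  let ?f = "\<lambda>\<xi>. F \<xi> + c * sqd \<xi>0 \<xi>"
  define m where "m = Inf (?f ` cyl \<xi>0)"
  obtain M where M: "\<And>\<xi>. \<xi> \<in> cyl \<xi>0 \<Longrightarrow> \<bar>F \<xi>\<bar> \<le> M" using cyl_bounded by blast
  have "- M \<le> ?f \<xi>" if "\<xi> \<in> cyl \<xi>0" for \<xi>
  proof -
    have "0 \<le> c * sqd \<xi>0 \<xi>" using assms by (simp add: sqd_def)
    then show ?thesis using M[OF that] by linarith
  qed
  then have bdd: "bdd_below (?f ` cyl \<xi>0)" by (intro bdd_belowI[of _ "- M"]) blast
  have "\<xi>0 \<in> cyl \<xi>0" by (simp add: cyl_def)
  then have ne: "?f ` cyl \<xi>0 \<noteq> {}" by blast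
  have "\<exists>\<xi>\<in>cyl \<xi>0. ?f \<xi> < m + inverse (real (Suc k))" for k
  proof -
    have "Inf (?f ` cyl \<xi>0) < m + inverse (real (Suc k))" unfolding m_def by simp
    from cInf_lessD[OF ne this] show ?thesis by (simp only: bex_simps)
  qed
  then obtain X where X: "\<And>k. X k \<in> cyl \<xi>0" "\<And>k. ?f (X k) < m + inverse (real (Suc k))"
    by metis
  obtain r \<xi> where r: "strict_mono (r :: nat \<Rightarrow> nat)" and \<xi>: "\<xi> \<in> cyl \<xi>0" and lim: "seq_conv (\<lambda>k. X (r k)) \<xi>"
    by (rule cyl_seq_compact[OF X(1)])
  have "?f \<xi> \<le> m"
  proof (rule LIMSEQ_le)
    show "(\<lambda>k. ?f (X (r k))) \<longlonglongrightarrow> ?f \<xi>"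
      by (intro tendsto_intros tendsto_F tendsto_sqd lim)
    show "(\<lambda>k. m + inverse (real (Suc (r k)))) \<longlonglongrightarrow> m"
      using tendsto_add[OF tendsto_const LIMSEQ_subseq_LIMSEQ[OF LIMSEQ_inverse_real_of_nat r], of m] by (simp add: o_def)
    show "\<exists>N. \<forall>k\<ge>N. ?f (X (r k)) \<le> m + inverse (real (Suc (r k)))"
      using X(2) less_imp_le by blast
  qed
  moreover have "m \<le> ?f \<eta>" if "\<eta> \<in> cyl \<xi>0" for \<eta>
    unfolding m_def using that by (intro cInf_lower[OF _ bdd] imageI)
  ultimately show thesis using that[OF \<xi>] order_trans by blast
qed

text \<open>A smooth function touching \<open>F\<close> from below at \<open>\<xi>\<close> has its horizontal gradient there as a
  subgradient of \<open>F\<close>: along each horizontal line through \<open>\<xi>\<close> convexity turns the local inequality into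
  a global one.\<close>
lemma touching_subgradient:
  assumes \<xi>: "\<xi> \<in> cyl \<xi>0" and c: "0 \<le> c" and interior: "sqd \<xi>0 \<xi> < 1"
    and min: "\<And>\<eta>. \<eta> \<in> cyl \<xi>0 \<Longrightarrow> F \<xi> + c * sqd \<xi>0 \<xi> \<le> F \<eta> + c * sqd \<xi>0 \<eta>"
  shows "\<exists>p. subg \<xi> p"
proof -
  let ?d = "Pr1 \<xi> - Pr1 \<xi>0" and ?\<tau> = "ht \<xi> - ht \<xi>0"
  have "(nrm n ?d)\<^sup>2 < 1\<^sup>2" "\<bar>?\<tau>\<bar>\<^sup>2 < 1\<^sup>2"
    using interior by (auto simp: sqd_def intro: le_less_trans[rotated])
  then have d: "nrm n ?d < 1" and \<tau>: "\<bar>?\<tau>\<bar> < 1"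
    by (auto simp only: power_less_imp_less_base zero_le_one)
  \<comment> \<open>Minus the horizontal gradient of \<open>c * sqd \<xi>0\<close> at
    \<open>\<xi>\<close>. The rotated term arises because the height varies along \<open>v\<close>
    at rate \<open>2 * hsymp n v (Pr1 \<xi>)\<close>.\<close>
  define p where "p = (- c) *\<^sub>R (2 *\<^sub>R ?d + (4 * ?\<tau>) *\<^sub>R (snd (Pr1 \<xi>), - fst (Pr1 \<xi>)))"
  have "F \<xi> + hdot n p v \<le> F (hstep n \<xi> v)" for v
  proof (rule field_le_epsilon)
    fix e :: real assume e: "0 < e"
    let ?B = "hsymp n v (Pr1 \<xi>)"
    let ?q = "hdot n v v + 4 * ?B\<^sup>2"
    \<comment> \<open>Small enough to stay in the cylinder in both the horizontal and the vertical
      sense, and to make the quadratic error \<open>s * (c * ?q)\<close> at most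
      \<open>e\<close>.\<close>
    define s where "s = min (min 1 (e / (c * ?q + 1))) (min ((1 - nrm n ?d) / (nrm n v + 1)) ((1 - \<bar>?\<tau>\<bar>) / (2 * \<bar>?B\<bar> + 1)))"
    have q: "0 \<le> ?q" by (simp add: nrm_square[symmetric])
    have cq: "0 < c * ?q + 1" using mult_nonneg_nonneg[OF c q] by linarith
    have nv: "0 < nrm n v + 1" using nrm_nonneg[of n v] by linarith
    have s0: "0 < s" unfolding s_def using e cq nv d \<tau> by simp
    have s: "s \<le> 1" "s \<le> e / (c * ?q + 1)" "s \<le> (1 - nrm n ?d) / (nrm n v + 1)" "s \<le> (1 - \<bar>?\<tau>\<bar>) / (2 * \<bar>?B\<bar> + 1)"
      unfolding s_def by linarith+
    have s2: "s * (c * ?q + 1) \<le> e" using s(2) cq by (simp add: pos_le_divide_eq)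
    have s3: "s * (nrm n v + 1) \<le> 1 - nrm n ?d" using s(3) nv by (simp add: pos_le_divide_eq)
    have s4: "s * (2 * \<bar>?B\<bar> + 1) \<le> 1 - \<bar>?\<tau>\<bar>" using s(4) by (simp add: pos_le_divide_eq)
    let ?\<eta> = "hstep n \<xi> (s *\<^sub>R v)"
    have "nrm n (Pr1 ?\<eta> - Pr1 \<xi>0) \<le> nrm n ?d + s * nrm n v"
      using nrm_triangle[of n ?d "s *\<^sub>R v"] s0 by (simp add: algebra_simps)
    also have "\<dots> \<le> 1" using s3 s0 by (simp add: algebra_simps)
    finally have m1: "nrm n (Pr1 ?\<eta> - Pr1 \<xi>0) \<le> 1" .
    have "\<bar>ht ?\<eta> - ht \<xi>0\<bar> \<le> \<bar>?\<tau>\<bar> + \<bar>2 * s * ?B\<bar>" by simp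
    also have "\<bar>2 * s * ?B\<bar> = s * (2 * \<bar>?B\<bar>)" using s0 by (simp add: abs_mult)
    also have "\<bar>?\<tau>\<bar> + s * (2 * \<bar>?B\<bar>) \<le> 1" using s4 s0 by (simp add: algebra_simps)
    finally have "?\<eta> \<in> cyl \<xi>0" using m1 by (simp add: cyl_def)
    then have "F \<xi> + c * sqd \<xi>0 \<xi> \<le> F ?\<eta> + c * sqd \<xi>0 ?\<eta>" by (rule min)
    moreover have "F ?\<eta> \<le> (1 - s) * F \<xi> + s * F (hstep n \<xi> v)" using conv[of s] s0 s(1) by simp
    moreover have "(1 - s) * F \<xi> = F \<xi> - s * F \<xi>" by (simp add: algebra_simps)
    \<comment> \<open>The penalty is a quadratic polynomial along a horizontal line, so this
      expansion is exact.\<close>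
    moreover have "c * sqd \<xi>0 ?\<eta> = c * sqd \<xi>0 \<xi> + s * (c * (2 * hdot n ?d v + 4 * ?\<tau> * ?B)) + s * (s * (c * ?q))"
      unfolding sqd_def nrm_square using hdot_sym[of n v "Pr1 \<xi>"] hdot_sym[of n v "Pr1 \<xi>0"]
      by (simp add: power2_eq_square algebra_simps)
    moreover have lin: "c * (2 * hdot n ?d v + 4 * ?\<tau> * ?B) = - hdot n p v"
      unfolding p_def hsymp_eq_hdot using hdot_sym[of n v "(snd (Pr1 \<xi>), - fst (Pr1 \<xi>))"] by (simp del: scaleR_Pair)
    ultimately have "0 \<le> s * F (hstep n \<xi> v) - s * F \<xi> + s * (- hdot n p v) + s * (s * (c * ?q))"
      unfolding lin by linarith
    then have "0 \<le> s * (F (hstep n \<xi> v) - F \<xi> - hdot n p v + s * (c * ?q))"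
      by (simp only: algebra_simps)
    then have "0 \<le> F (hstep n \<xi> v) - F \<xi> - hdot n p v + s * (c * ?q)"
      using s0 by (simp add: zero_le_mult_iff)
    moreover have "s * (c * ?q) \<le> e" using s2 s0 by (simp add: algebra_simps)
    ultimately show "F \<xi> + hdot n p v \<le> F (hstep n \<xi> v) + e" by linarith
  qed
  then show ?thesis unfolding subg_def by blast
qed

text \<open>Comparing a minimiser with \<open>\<xi>0\<close> itself gives
  \<open>c * sqd \<le> 2 * M\<close>. As the penalty grows, the minimisers converge to
  \<open>\<xi>0\<close>, and so, along a subsequence, do subgradients found there.\<close>

lemma exists_subg: "\<exists>p\<in>hlayer n. subg \<xi>0 p"
proof -
  obtain M where M: "0 \<le> M" "\<And>\<xi>. \<xi> \<in> cyl \<xi>0 \<Longrightarrow> \<bar>F \<xi>\<bar> \<le> M" using cyl_bounded by blast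
  have mem0: "\<xi>0 \<in> cyl \<xi>0" by (simp add: cyl_def)
  \<comment> \<open>The summand \<open>2 * M + 1\<close> keeps \<open>2 * M / c k\<close> below 1,
    so that every minimiser is interior.\<close>
  define c where "c k = 2 * M + 1 + real k" for k
  have c: "0 < c k" for k using M by (simp add: c_def)
  have "\<exists>\<xi> p. subg \<xi> p \<and> sqd \<xi>0 \<xi> \<le> 2 * M / c k" for k
  proof -
    obtain \<xi> where \<xi>: "\<xi> \<in> cyl \<xi>0" and min: "\<And>\<eta>. \<eta> \<in> cyl \<xi>0 \<Longrightarrow> F \<xi> + c k * sqd \<xi>0 \<xi> \<le> F \<eta> + c k * sqd \<xi>0 \<eta>"
      using exists_minimizer[of "c k" \<xi>0] c[of k] by (metis less_imp_le)
    have "c k * sqd \<xi>0 \<xi> \<le> 2 * M" using min[OF mem0] M(2)[OF \<xi>] M(2)[OF mem0] by (simp add: sqd_def)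
    then have small: "sqd \<xi>0 \<xi> \<le> 2 * M / c k" using c[of k] by (simp add: field_simps)
    also have "\<dots> < 1" using M by (simp add: c_def field_simps)
    finally have "sqd \<xi>0 \<xi> < 1" .
    then show ?thesis using touching_subgradient[OF \<xi> _ _ min] c[of k] small less_imp_le by blast
  qed
  then obtain X p where X: "\<And>k. subg (X k) (p k)" "\<And>k. sqd \<xi>0 (X k) \<le> 2 * M / c k" by metis
  have "filterlim c at_top sequentially"
    unfolding c_def by (rule filterlim_tendsto_add_at_top[OF tendsto_const filterlim_real_sequentially])
  then have "(\<lambda>k. 2 * M / c k) \<longlonglongrightarrow> 0" by (rule real_tendsto_divide_at_top[OF tendsto_const])
  moreover have "norm (sqd \<xi>0 (X k)) \<le> 2 * M / c k" for k
    using X(2)[of k] by (simp add: sqd_def)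
  ultimately have "(\<lambda>k. sqd \<xi>0 (X k)) \<longlonglongrightarrow> 0"
    by (intro Lim_null_comparison[of "\<lambda>k. sqd \<xi>0 (X k)" "\<lambda>k. 2 * M / c k"] always_eventually allI)
  from tendsto_real_sqrt[OF this] have lim: "(\<lambda>k. sqrt (sqd \<xi>0 (X k))) \<longlonglongrightarrow> 0" by simp
  have 1: "norm (nrm n (Pr1 (X k) - Pr1 \<xi>0)) \<le> sqrt (sqd \<xi>0 (X k))"
    and 2: "norm (ht (X k) - ht \<xi>0) \<le> sqrt (sqd \<xi>0 (X k))" for k
    by (simp_all add: sqd_def real_le_rsqrt)
  have "(\<lambda>k. nrm n (Pr1 (X k) - Pr1 \<xi>0)) \<longlonglongrightarrow> 0"
    by (rule Lim_null_comparison[OF always_eventually[OF allI[OF 1]] lim])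
  moreover have "(\<lambda>k. ht (X k) - ht \<xi>0) \<longlonglongrightarrow> 0"
    by (rule Lim_null_comparison[OF always_eventually[OF allI[OF 2]] lim])
  ultimately have "seq_conv X \<xi>0" by (simp add: seq_conv_def LIM_zero_iff)
  then show ?thesis by (rule subg_limit[OF _ X(1)]) blast
qed

end

section \<open>Round sections\<close>

text \<open>The constant of \<open>doubling_real\<close>: the factor \<open>1 + 1 / \<kappa>\<close>
  with \<open>\<kappa> = K0 / 2\<close>, applied often enough for the steps to reach their goal, and
  two factors 2 from comparing slopes with excesses.\<close>

definition dbl :: "real \<Rightarrow> real" where
  "dbl K0 = 4 * (1 + 2 / K0) ^ nat \<lceil>8 / K0\<rceil>"

lemma dbl_ge_1: "0 < K0 \<Longrightarrow> 1 \<le> dbl K0"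
proof -
  assume "0 < K0"
  then have "1 \<le> (1 + 2 / K0) ^ nat \<lceil>8 / K0\<rceil>" by (intro one_le_power) simp
  then show ?thesis unfolding dbl_def by linarith
qed

text \<open>Here \<open>f\<close> is a slope selection of the convex function \<open>h\<close>. Roundness bounds the increment of \<open>f\<close>
  over an interval by its increment over a longer interval to the left; iterating this gives
  doubling.\<close>
lemma doubling_real:
  fixes h f :: "real \<Rightarrow> real"
  assumes K0: "0 < K0"
    and slope: "\<And>a b. h a + f a * (b - a) \<le> h b"
    and round: "\<And>a x y. \<bar>x\<bar> \<le> K0 * \<bar>y\<bar> \<Longrightarrow> h (a + x) - h a - f a * x \<le> h (a + y) - h a - f a * y"
  shows "h 2 - h 0 - 2 * f 0 \<le> dbl K0 * (h 1 - h 0 - f 0)"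
    and "h 0 - h 1 + f 1 \<le> dbl K0 * (h 1 - h 0 - f 0)"
proof -
  define \<kappa> where "\<kappa> = K0 / 2"
  have \<kappa>: "0 < \<kappa>" using K0 by (simp add: \<kappa>_def)
  have mono: "f a \<le> f b" if "a \<le> b" for a b
  proof (cases "a = b")
    case False
    have "(f b - f a) * (b - a) \<ge> 0" using slope[of a b] slope[of b a] by (simp add: algebra_simps)
    then show ?thesis using that False by (simp add: zero_le_mult_iff)
  qed simp
  \<comment> \<open>Roundness at \<open>x\<close> compares the excess at
    \<open>K0 * d = 2 * \<kappa> * d\<close> to the right with that at \<open>d\<close> to the left.
    The slope on the outer half bounds the former from below; the total slope increment bounds the
    latter from above.\<close>
  have key: "f (x + \<kappa> * d) - f x \<le> (1 / \<kappa>) * (f x - f (x - d))" if d: "0 < d" for x d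
  proof -
    have "(f (x + \<kappa> * d) - f x) * (\<kappa> * d) \<le> h (x + 2 * \<kappa> * d) - h x - f x * (2 * \<kappa> * d)"
      using slope[of "x + \<kappa> * d" "x + 2 * \<kappa> * d"] slope[of x "x + \<kappa> * d"] by (simp add: algebra_simps)
    also have "\<dots> \<le> h (x + (- d)) - h x - f x * (- d)"
      using d K0 by (intro round) (simp add: \<kappa>_def)
    also have "\<dots> \<le> (f x - f (x - d)) * d"
      using slope[of "x - d" x] by (simp add: algebra_simps)
    finally have "(f (x + \<kappa> * d) - f x) * \<kappa> \<le> f x - f (x - d)"
      using d by (simp add: mult.assoc[symmetric])
    then show ?thesis using \<kappa> by (simp add: field_simps)
  qed
  \<comment> \<open>Each application of \<open>key\<close> uses the whole interval back to
    \<open>x - d\<close>; the right end advances by at least \<open>\<kappa> * d\<close> while the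
    increment grows by at most the factor \<open>1 + 1 / \<kappa>\<close>.\<close>
  have iter: "f (x + real j * (\<kappa> * d)) - f (x - d) \<le> (1 + 1 / \<kappa>) ^ j * (f x - f (x - d))" if d: "0 < d" for x d j
  proof (induction j)
    case (Suc j)
    let ?x = "x + real j * (\<kappa> * d)"
    let ?d = "d + real j * (\<kappa> * d)"
    have j0: "0 \<le> real j * (\<kappa> * d)" using d \<kappa> by simp
    have "\<kappa> * d \<le> \<kappa> * ?d" using j0 \<kappa> by (intro mult_left_mono) auto
    then have "f (?x + \<kappa> * d) - f ?x \<le> f (?x + \<kappa> * ?d) - f ?x" by (intro diff_right_mono mono) simp
    also have "\<dots> \<le> (1 / \<kappa>) * (f ?x - f (?x - ?d))" using d j0 by (intro key) auto
    also have "?x - ?d = x - d" by simp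
    finally have "f (?x + \<kappa> * d) - f (x - d) \<le> (1 + 1 / \<kappa>) * (f ?x - f (x - d))" by (simp add: algebra_simps)
    also have "\<dots> \<le> (1 + 1 / \<kappa>) * ((1 + 1 / \<kappa>) ^ j * (f x - f (x - d)))"
      using Suc.IH \<kappa> by (intro mult_left_mono) auto
    also have "?x + \<kappa> * d = x + real (Suc j) * (\<kappa> * d)" by (simp add: algebra_simps)
    finally show ?case by (simp only: power_Suc mult.assoc)
  qed simp
  define J where "J = nat \<lceil>8 / K0\<rceil>"
  have "8 / K0 \<le> real J" unfolding J_def by linarith
  then have J: "4 \<le> real J * \<kappa>" using K0 by (simp add: \<kappa>_def field_simps)
  define A where "A = (1 + 1 / \<kappa>) ^ J"
  have A: "dbl K0 = 4 * A" by (simp add: dbl_def A_def J_def \<kappa>_def)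
  have A0: "0 \<le> A" using \<kappa> by (simp add: A_def)
  \<comment> \<open>With \<open>x = d = 1/2\<close> and \<open>J * \<kappa> \<ge> 4\<close>, the
    right end moves at least from \<open>1/2\<close> to \<open>5/2\<close>, past both points 1 and 2
    at which slopes are needed.\<close>
  have "f (5/2) \<le> f (1/2 + real J * (\<kappa> * (1/2)))" using J by (intro mono) simp
  then have up: "f (5/2) - f 0 \<le> A * (f (1/2) - f 0)" using iter[of "1/2" "1/2" J] by (simp add: A_def)
  let ?E = "h 1 - h 0 - f 0"
  have E: "f (1/2) - f 0 \<le> 2 * ?E" using slope[of 0 "1/2"] slope[of "1/2" 1] by simp
  have AE: "f (5/2) - f 0 \<le> A * (2 * ?E)" using up mult_left_mono[OF E A0] by linarith
  have dE: "dbl K0 * ?E = 2 * (A * (2 * ?E))" unfolding A by simp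
  have E0: "0 \<le> ?E" using slope[of 0 1] by simp
  have "h 2 - h 0 - 2 * f 0 \<le> 2 * (f 2 - f 0)" using slope[of 2 0] by simp
  then show "h 2 - h 0 - 2 * f 0 \<le> dbl K0 * ?E" using mono[of 2 "5/2"] AE unfolding dE by simp
  have "h 0 - h 1 + f 1 \<le> f 1 - f 0" using slope[of 0 1] by simp
  then show "h 0 - h 1 + f 1 \<le> dbl K0 * ?E"
    using mono[of 1 "5/2"] AE mult_nonneg_nonneg[OF A0 E0] unfolding dE by linarith
qed

section \<open>Uniqueness of subgradients under roundness\<close>

text \<open>Within the horizontal plane at \<open>\<xi>\<close> the gauge distance to
  \<open>\<xi>\<close> is \<open>nrm\<close> of the step, so the two balls become conditions on the
  step vector.\<close>

locale round_fun = hconvex_fun +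
  fixes K0 :: real
  assumes K0: "0 < K0" "K0 < 1"
    and round: "subg \<xi> p \<Longrightarrow> 0 < s \<Longrightarrow> \<exists>R>0.
      (\<forall>v. nrm n v \<le> K0 * R \<longrightarrow> F (hstep n \<xi> v) - F \<xi> - hdot n p v < s) \<and>
      (\<forall>v. F (hstep n \<xi> v) - F \<xi> - hdot n p v < s \<longrightarrow> nrm n v \<le> R)"
begin

text \<open>Any height \<open>s\<close> above the excess at \<open>w\<close> has outer radius at
  least \<open>nrm n w\<close>, so its inner ball contains the step \<open>v\<close>; then
  \<open>s\<close> decreases to the excess at \<open>w\<close>.\<close>

lemma excess_le:
  assumes p: "subg \<xi> p" and v: "nrm n v \<le> K0 * nrm n w"
  shows "F (hstep n \<xi> v) - F \<xi> - hdot n p v \<le> F (hstep n \<xi> w) - F \<xi> - hdot n p w"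
proof (rule dense_ge)
  fix s assume s: "F (hstep n \<xi> w) - F \<xi> - hdot n p w < s"
  then have "0 < s" using subgD[OF p, of w] by simp
  then obtain R where R: "\<forall>v. nrm n v \<le> K0 * R \<longrightarrow> F (hstep n \<xi> v) - F \<xi> - hdot n p v < s"
    "\<forall>v. F (hstep n \<xi> v) - F \<xi> - hdot n p v < s \<longrightarrow> nrm n v \<le> R"
    using round[OF p] by blast
  have "nrm n w \<le> R" using R(2) s by blast
  then have "nrm n v \<le> K0 * R" using v K0 mult_left_mono[of "nrm n w" R K0] by linarith
  then show "F (hstep n \<xi> v) - F \<xi> - hdot n p v \<le> s" using R(1) by (blast intro: less_imp_le)
qed

text \<open>By \<open>excess_le\<close>, linear growth of the excess along one ray forces linear
  growth in all directions at a common rate \<open>c\<close>, which absorbs a small perturbation of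
  the subgradient.\<close>

lemma subg_thick:
  assumes p: "subg \<xi> p" and e: "0 < e"
    and w: "\<And>s. 0 < s \<Longrightarrow> e * s < F (hstep n \<xi> (s *\<^sub>R w)) - F \<xi> - s * hdot n p w"
  shows "\<exists>c>0. \<forall>q. nrm n q \<le> c \<longrightarrow> subg \<xi> (p + q)"
proof -
  have "nrm n w \<noteq> 0"
  proof
    assume "nrm n w = 0"
    then have "F (hstep n \<xi> (1 *\<^sub>R w)) - F \<xi> - hdot n p (1 *\<^sub>R w) \<le> F (hstep n \<xi> 0) - F \<xi> - hdot n p 0"
      by (intro excess_le[OF p]) simp
    then show False using w[of 1] e by simp
  qed
  then have nw: "0 < nrm n w" using nrm_nonneg[of n w] by linarith
  define c where "c = e * K0 / nrm n w"
  have c: "0 < c" using e K0 nw by (simp add: c_def)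
  have grow: "c * nrm n v \<le> F (hstep n \<xi> v) - F \<xi> - hdot n p v" for v
  proof (cases "nrm n v = 0")
    case True
    then show ?thesis using subgD[OF p, of v] by simp
  next
    case False
    then have nv: "0 < nrm n v" using nrm_nonneg[of n v] by linarith
    define s where "s = K0 * nrm n v / nrm n w"
    have s: "0 < s" using K0 nv nw by (simp add: s_def)
    have "F (hstep n \<xi> (s *\<^sub>R w)) - F \<xi> - hdot n p (s *\<^sub>R w) \<le> F (hstep n \<xi> v) - F \<xi> - hdot n p v"
      using s nw K0 nv by (intro excess_le[OF p]) (simp add: s_def)
    moreover have "e * s = c * nrm n v" by (simp add: s_def c_def)
    ultimately show ?thesis using w[OF s] by simp
  qed
  have "subg \<xi> (p + q)" if q: "nrm n q \<le> c" for q
    unfolding subg_def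
  proof
    fix v
    have "hdot n q v \<le> nrm n q * nrm n v" using hdot_le_nrm[of n q v] by linarith
    also have "\<dots> \<le> c * nrm n v" using q by (intro mult_right_mono) auto
    finally show "F \<xi> + hdot n (p + q) v \<le> F (hstep n \<xi> v)" using grow[of v] by simp
  qed
  then show ?thesis using c by blast
qed

text \<open>If some directional derivative of \<open>F\<close> exceeded the linear function given by a subgradient, then
  by roundness all would, so the subdifferential would be a neighbourhood of that subgradient; the
  same would hold at a boundary point of the subdifferential.\<close>
lemma subg_derivative:
  assumes p: "subg \<xi> p" and e: "0 < e"
  shows "\<exists>s>0. F (hstep n \<xi> (s *\<^sub>R w)) - F \<xi> - s * hdot n p w \<le> e * s"
proof (rule ccontr)
  assume "\<not> ?thesis"
  then have "\<And>s. 0 < s \<Longrightarrow> e * s < F (hstep n \<xi> (s *\<^sub>R w)) - F \<xi> - s * hdot n p w"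
    by (meson not_le)
  from subg_thick[OF p e this] obtain c where c: "0 < c" "\<And>q. nrm n q \<le> c \<Longrightarrow> subg \<xi> (p + q)" by blast
  define A where "A = {l. subg \<xi> (p + l *\<^sub>R eX)}"
  have eX: "nrm n eX = 1" "hdot n eX eX = 1" using basis_facts[OF n] nrm_square[of n eX] by auto
  have cA: "c \<in> A" unfolding A_def using c(1) eX by (auto intro!: c(2))
  have "l \<le> F (hstep n \<xi> eX) - F \<xi> - hdot n p eX" if "l \<in> A" for l
    using subgD[of \<xi> "p + l *\<^sub>R eX" eX] that eX by (simp add: A_def)
  then have bdd: "bdd_above A" by (rule bdd_aboveI)
  define l where "l = Sup A"
  have l: "c \<le> l" unfolding l_def using cA bdd by (rule cSup_upper)
  have sub: "subg \<xi> (p + l *\<^sub>R eX)"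
    unfolding subg_def
  proof
    fix v
    have mem: "F \<xi> + hdot n p v + k * hdot n eX v \<le> F (hstep n \<xi> v)" if "k \<in> A" for k
      using subgD[of \<xi> "p + k *\<^sub>R eX" v] that by (simp add: A_def)
    show "F \<xi> + hdot n (p + l *\<^sub>R eX) v \<le> F (hstep n \<xi> v)"
    proof (cases "0 < hdot n eX v")
      case True
      have "l \<le> (F (hstep n \<xi> v) - F \<xi> - hdot n p v) / hdot n eX v"
        unfolding l_def
      proof (rule cSup_least)
        show "A \<noteq> {}" using cA by blast
      qed (use mem True in \<open>simp add: pos_le_divide_eq algebra_simps\<close>)
      then show ?thesis using True by (simp add: pos_le_divide_eq algebra_simps)
    next
      case False
      then have "l * hdot n eX v \<le> c * hdot n eX v" using l by (intro mult_right_mono_neg) auto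
      then show ?thesis using mem[OF cA] by simp
    qed
  qed
  have "0 < l / 2" using l c by simp
  \<comment> \<open>At the extreme subgradient the original \<open>p\<close> still supports
    \<open>F\<close>, so the excess along \<open>- eX\<close> grows at rate at least
    \<open>l\<close>. Thickness then pushes \<open>A\<close> beyond its supremum.\<close>
  moreover have "l / 2 * s < F (hstep n \<xi> (s *\<^sub>R (- eX))) - F \<xi> - s * hdot n (p + l *\<^sub>R eX) (- eX)" if "0 < s" for s
  proof -
    have "l / 2 * s < l * s" using that l c by simp
    then show ?thesis using subgD[OF p, of "s *\<^sub>R (- eX)"] eX by (simp add: algebra_simps)
  qed
  ultimately obtain c' where c': "0 < c'" "\<And>q. nrm n q \<le> c' \<Longrightarrow> subg \<xi> ((p + l *\<^sub>R eX) + q)"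
    using subg_thick[OF sub, of "l / 2" "- eX"] by blast
  then have "subg \<xi> ((p + l *\<^sub>R eX) + c' *\<^sub>R eX)" using eX by simp
  then have "l + c' \<in> A" by (simp add: A_def algebra_simps)
  then have "l + c' \<le> l" unfolding l_def using bdd by (rule cSup_upper)
  then show False using c'(1) by simp
qed

text \<open>By \<open>subg_derivative\<close> the directional derivative along \<open>v\<close> is
  at most the pairing of \<open>v\<close> with either subgradient, while each subgradient bounds it
  from below.\<close>

lemma subg_unique_dot:
  assumes p: "subg \<xi> p" and q: "subg \<xi> q"
  shows "hdot n p v = hdot n q v"
proof -
  have le: "hdot n q v \<le> hdot n p v" if p: "subg \<xi> p" and q: "subg \<xi> q" for p q v
  proof (rule field_le_epsilon)
    fix e :: real assume "0 < e"
    then obtain s where s: "0 < s" "F (hstep n \<xi> (s *\<^sub>R v)) - F \<xi> - s * hdot n p v \<le> e * s"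
      using subg_derivative[OF p] by blast
    have "s * hdot n q v \<le> s * (hdot n p v + e)"
      using subgD[OF q, of "s *\<^sub>R v"] s(2) by (simp add: algebra_simps)
    then show "hdot n q v \<le> hdot n p v + e" using s(1) by simp
  qed
  show ?thesis using le[OF p q, of v] le[OF q p, of v] by simp
qed

lemma subg_unique:
  assumes "subg \<xi> p" "subg \<xi> q" "p \<in> hlayer n" "q \<in> hlayer n"
  shows "p = q"
proof -
  have "nrm n (p - q) = 0"
    using subg_unique_dot[OF assms(1,2), of "p - q"] by (simp add: nrm_def)
  then have "vtrunc n (p - q) = 0" by (rule nrm_zero_imp_vtrunc)
  then show ?thesis using assms by simp
qed

section \<open>The excess over the tangent\<close>

definition gr :: "hpoint \<Rightarrow> hvec" where
  "gr \<xi> = (SOME p. p \<in> hlayer n \<and> subg \<xi> p)"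

lemma gr: "gr \<xi> \<in> hlayer n" "subg \<xi> (gr \<xi>)"
  using someI_ex[of "\<lambda>p. p \<in> hlayer n \<and> subg \<xi> p"] exists_subg[of \<xi>] unfolding gr_def by auto

definition exc :: "hpoint \<Rightarrow> hvec \<Rightarrow> real" where
  "exc \<xi> v = F (hstep n \<xi> v) - F \<xi> - hdot n (gr \<xi>) v"

lemma exc_nonneg: "0 \<le> exc \<xi> v"
  using subgD[OF gr(2), of \<xi> v] by (simp add: exc_def)

lemma exc_scale_le: "0 \<le> s \<Longrightarrow> s \<le> 1 \<Longrightarrow> exc \<xi> (s *\<^sub>R v) \<le> s * exc \<xi> v"
  using conv[of s \<xi> v] by (simp add: exc_def algebra_simps)

lemma exc_scale_ge:
  assumes "1 \<le> l"
  shows "l * exc \<xi> v \<le> exc \<xi> (l *\<^sub>R v)"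
  using exc_scale_le[of "1 / l" \<xi> "l *\<^sub>R v"] assms by (simp add: field_simps)

lemma exc_round: "nrm n v \<le> K0 * nrm n w \<Longrightarrow> exc \<xi> v \<le> exc \<xi> w"
  unfolding exc_def by (rule excess_le[OF gr(2)])

abbreviation D :: real where "D \<equiv> dbl K0"

lemma D1: "1 \<le> D" using dbl_ge_1[OF K0(1)] .

text \<open>Apply \<open>doubling_real\<close> to \<open>F\<close> on the line through
  \<open>\<xi>\<close> along \<open>v\<close>, with the slopes given by \<open>gr\<close>.
  \<open>exc_reverse\<close> views the same segment from its other end.\<close>

lemma exc_doubling: "exc \<xi> (2 *\<^sub>R v) \<le> D * exc \<xi> v" and exc_reverse: "exc (hstep n \<xi> v) (- v) \<le> D * exc \<xi> v"
proof -
  define h where "h s = F (hstep n \<xi> (s *\<^sub>R v))" for s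
  define f where "f s = hdot n (gr (hstep n \<xi> (s *\<^sub>R v))) v" for s
  have ex: "exc (hstep n \<xi> (a *\<^sub>R v)) (x *\<^sub>R v) = h (a + x) - h a - f a * x" for a x
    by (simp add: exc_def h_def f_def hstep_collinear mult.commute)
  have slope: "h a + f a * (b - a) \<le> h b" for a b
    using exc_nonneg[of "hstep n \<xi> (a *\<^sub>R v)" "(b - a) *\<^sub>R v"] unfolding ex by simp
  have rnd: "h (a + x) - h a - f a * x \<le> h (a + y) - h a - f a * y" if "\<bar>x\<bar> \<le> K0 * \<bar>y\<bar>" for a x y
    unfolding ex[symmetric] using mult_right_mono[OF that, of "nrm n v"]
    by (intro exc_round) (simp add: mult.assoc)
  have e0: "exc \<xi> (x *\<^sub>R v) = h x - h 0 - f 0 * x" for x using ex[of 0 x] by simp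
  have e1: "exc (hstep n \<xi> v) (- v) = h 0 - h 1 + f 1" using ex[of 1 "- 1"] by simp
  show "exc \<xi> (2 *\<^sub>R v) \<le> D * exc \<xi> v"
    using doubling_real(1)[of K0 h f, OF K0(1) slope rnd] e0[of 2] e0[of 1] by (simp add: mult.commute)
  show "exc (hstep n \<xi> v) (- v) \<le> D * exc \<xi> v"
    using doubling_real(2)[of K0 h f, OF K0(1) slope rnd] e1 e0[of 1] by simp
qed

lemma exc_pow: "exc \<xi> (2 ^ m *\<^sub>R v) \<le> D ^ m * exc \<xi> v"
proof (induction m)
  case (Suc m)
  have "exc \<xi> (2 ^ Suc m *\<^sub>R v) \<le> D * exc \<xi> (2 ^ m *\<^sub>R v)"
    using exc_doubling[of \<xi> "2 ^ m *\<^sub>R v"] by simp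
  also have "\<dots> \<le> D * (D ^ m * exc \<xi> v)" using Suc.IH D1 by (intro mult_left_mono) auto
  finally show ?case by (simp add: mult.assoc)
qed simp

text \<open>The number of doublings that makes up for the factor \<open>K0\<close> lost in
  roundness.\<close>

definition m0 :: nat where "m0 = nat \<lceil>1 / K0\<rceil>"

lemma m0: "1 \<le> K0 * 2 ^ m0"
proof -
  have "1 / K0 \<le> real m0" unfolding m0_def by linarith
  also have "\<dots> \<le> 2 ^ m0" using of_nat_less_two_power[of m0, where 'a = real] by linarith
  finally show ?thesis using K0 by (simp add: field_simps)
qed

lemma D_pow_mono: "i \<le> j \<Longrightarrow> D ^ i \<le> D ^ j"
  by (rule power_increasing[OF _ D1])

text \<open>After \<open>m0 + j\<close> doublings \<open>w\<close> is long enough for roundness to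
  apply, at the price of one factor \<open>D\<close> each.\<close>

lemma exc_compare:
  assumes "nrm n v \<le> 2 ^ j * nrm n w"
  shows "exc \<xi> v \<le> D ^ (m0 + j) * exc \<xi> w"
proof -
  have "2 ^ j * nrm n w * 1 \<le> 2 ^ j * nrm n w * (K0 * 2 ^ m0)" using m0 by (intro mult_left_mono) auto
  then have "exc \<xi> v \<le> exc \<xi> (2 ^ (m0 + j) *\<^sub>R w)" using assms by (intro exc_round) (simp add: power_add mult_ac)
  also have "\<dots> \<le> D ^ (m0 + j) * exc \<xi> w" by (rule exc_pow)
  finally show ?thesis .
qed

text \<open>A vanishing excess would by doubling vanish at all \<open>2 ^ k *\<^sub>R w\<close>,
  making a section unbounded.\<close>

lemma exc_pos:
  assumes "0 < nrm n w"
  shows "0 < exc \<xi> w"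
proof (rule ccontr)
  assume "\<not> 0 < exc \<xi> w"
  then have "exc \<xi> w = 0" using exc_nonneg[of \<xi> w] by simp
  then have 0: "exc \<xi> (2 ^ k *\<^sub>R w) \<le> 0" for k using exc_pow[of \<xi> k w] by simp
  obtain R where R: "\<forall>v. F (hstep n \<xi> v) - F \<xi> - hdot n (gr \<xi>) v < 1 \<longrightarrow> nrm n v \<le> R"
    using round[OF gr(2), of 1 \<xi>] by auto
  have le: "2 ^ k * nrm n w \<le> R" for k
  proof -
    have "exc \<xi> (2 ^ k *\<^sub>R w) < 1" using 0[of k] by linarith
    then have "nrm n (2 ^ k *\<^sub>R w) \<le> R" using R unfolding exc_def by blast
    then show ?thesis by simp
  qed
  obtain k where "R / nrm n w < 2 ^ k" using real_arch_pow[of 2 "R / nrm n w"] by auto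
  then show False using le[of k] assms by (simp add: field_simps)
qed

section \<open>Comparing growth at different points and radii\<close>

definition G :: "hpoint \<Rightarrow> real \<Rightarrow> real" where
  "G \<xi> r = exc \<xi> (r *\<^sub>R eX)"

lemma nrm_eX [simp]: "nrm n eX = 1" using basis_facts[OF n] by simp

lemma G_nonneg: "0 \<le> G \<xi> r" by (simp add: G_def exc_nonneg)

lemma G_pos: "0 < r \<Longrightarrow> 0 < G \<xi> r" by (simp add: G_def exc_pos)

lemma exc_le_G: "0 < r \<Longrightarrow> nrm n v \<le> 2 ^ j * r \<Longrightarrow> exc \<xi> v \<le> D ^ (m0 + j) * G \<xi> r"
  unfolding G_def by (rule exc_compare) simp

lemma G_le_exc: "0 < r \<Longrightarrow> r \<le> 2 ^ j * nrm n v \<Longrightarrow> G \<xi> r \<le> D ^ (m0 + j) * exc \<xi> v"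
  unfolding G_def by (rule exc_compare) simp

lemma G_le_G: "0 < r \<Longrightarrow> 0 < q \<Longrightarrow> r \<le> 2 ^ j * q \<Longrightarrow> G \<xi> r \<le> D ^ (m0 + j) * G \<xi> q"
  unfolding G_def by (rule exc_compare) simp

text \<open>All comparison constants are powers of \<open>D\<close>, so a chain of comparisons adds
  exponents.\<close>

lemma D_chain: "a \<le> D ^ i * b \<Longrightarrow> b \<le> D ^ j * c \<Longrightarrow> a \<le> D ^ (i + j) * c"
  using mult_left_mono[of b "D ^ j * c" "D ^ i"] order_trans[OF zero_le_one one_le_power[OF D1, of i]]
  by (simp add: power_add mult.assoc)

lemma F_cong: "ptrunc n \<xi> = ptrunc n \<xi>' \<Longrightarrow> F (hstep n \<xi> v) = F (hstep n \<xi>' v)"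
  by (metis F_ptrunc ptrunc_hstep)

text \<open>\<open>gr\<close> is chosen by a predicate that sees a point only through its
  truncation, so equal truncations give equal choices.\<close>

lemma G_cong:
  assumes "ptrunc n \<xi> = ptrunc n \<xi>'"
  shows "G \<xi> r = G \<xi>' r"
proof -
  have "F \<xi> = F \<xi>'" by (metis F_ptrunc assms)
  moreover from this have "gr \<xi> = gr \<xi>'" by (simp add: gr_def subg_def F_cong[OF assms])
  ultimately show ?thesis by (simp add: G_def exc_def F_cong[OF assms])
qed

text \<open>Both points lie on a line containing \<open>\<xi> \<circ> exp (- w)\<close>, with \<open>w\<close> of length \<open>r\<close> and parallel to \<open>v\<close>;
  going through that third point gives distances comparable to \<open>r\<close> from both.\<close>
lemma G_hstep:
  assumes r: "0 < r" and v: "nrm n v \<le> r"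
  shows "G (hstep n \<xi> v) r \<le> D ^ (3 * m0 + 3) * G \<xi> r"
proof (cases "nrm n v = 0")
  case True
  then have v0: "vtrunc n v = 0" by (rule nrm_zero_imp_vtrunc)
  have "ptrunc n (hstep n \<xi> v) = ptrunc n \<xi>" unfolding ptrunc_hstep v0 by simp
  then have "G (hstep n \<xi> v) r = G \<xi> r" by (rule G_cong)
  moreover have "1 * G \<xi> r \<le> D ^ (3 * m0 + 3) * G \<xi> r"
    using D1 by (intro mult_right_mono one_le_power G_nonneg)
  ultimately show ?thesis by simp
next
  case False
  then have nv: "0 < nrm n v" using nrm_nonneg[of n v] by linarith
  define w where "w = (r / nrm n v) *\<^sub>R v"
  define c where "c = nrm n v / r"
  have w: "nrm n w = r" using nv r by (simp add: w_def)
  have c: "0 \<le> c" "c \<le> 1" using nv r v by (auto simp: c_def)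
  have cw: "v = c *\<^sub>R w" using nv r by (simp add: c_def w_def)
  let ?a = "hstep n \<xi> (- w)" and ?b = "hstep n \<xi> v"
  have b: "?b = hstep n ?a ((1 + c) *\<^sub>R w)"
    unfolding cw using hstep_collinear[of n \<xi> "- 1" w "1 + c"] by simp
  have 1: "G ?b r \<le> D ^ (m0 + 0) * exc ?b (- ((1 + c) *\<^sub>R w))"
    using c r mult_right_mono[of 1 "1 + c" r] by (intro G_le_exc) (simp_all add: w)
  have 2: "exc ?b (- ((1 + c) *\<^sub>R w)) \<le> D ^ 1 * exc ?a ((1 + c) *\<^sub>R w)"
    unfolding b using exc_reverse by simp
  have 3: "exc ?a ((1 + c) *\<^sub>R w) \<le> D ^ (m0 + 1) * exc ?a w"
    using c r mult_right_mono[of "1 + c" 2 r] by (intro exc_compare) (simp add: w)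
  have 4: "exc ?a w \<le> D ^ 1 * exc \<xi> (- w)" using exc_reverse[of \<xi> "- w"] by simp
  have 5: "exc \<xi> (- w) \<le> D ^ (m0 + 0) * G \<xi> r" using r by (intro exc_le_G) (simp_all add: w)
  have "m0 + 0 + (1 + (m0 + 1 + (1 + (m0 + 0)))) = 3 * m0 + 3" by simp
  with D_chain[OF 1 D_chain[OF 2 D_chain[OF 3 D_chain[OF 4 5]]]] show ?thesis by (simp only:)
qed

text \<open>A generous exponent: the chain in \<open>G_near\<close> totals
  \<open>11 * m0 + j + 11\<close>.\<close>

definition a1 :: nat where "a1 = 13 * m0 + 11"

text \<open>Pass to the radius \<open>2 ^ (j + 2) * r\<close>, which exceeds the length of each of
  the three connecting steps, move along them by \<open>G_hstep\<close>, and return to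
  \<open>r\<close>.\<close>

lemma G_near:
  assumes r: "0 < r" and near: "near n (2 ^ j * r) \<xi> \<xi>'"
  shows "G \<xi>' r \<le> D ^ (a1 + 2 * j + 4) * G \<xi> r"
proof -
  obtain v1 v2 v3 where \<xi>': "\<xi>' = hstep n (hstep n (hstep n \<xi> v1) v2) v3"
    and v: "nrm n v1 \<le> 3 * (2 ^ j * r)" "nrm n v2 \<le> 3 * (2 ^ j * r)" "nrm n v3 \<le> 3 * (2 ^ j * r)"
    by (rule near_three_steps[OF n near])
  let ?q = "2 ^ (j + 2) * r"
  have le: "3 * (2 ^ j * r) \<le> ?q" and q: "0 < ?q" using r by simp_all
  note st = G_hstep[OF q order_trans[OF v(3) le], of "hstep n (hstep n \<xi> v1) v2"]
    G_hstep[OF q order_trans[OF v(2) le], of "hstep n \<xi> v1"]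
    G_hstep[OF q order_trans[OF v(1) le], of \<xi>]
  have "r * 1 \<le> r * 2 ^ (j + 2)" using r by (intro mult_left_mono one_le_power) auto
  then have 1: "G \<xi>' r \<le> D ^ (m0 + 0) * G \<xi>' ?q" using r by (intro G_le_G) (auto simp: mult_ac)
  have 2: "G \<xi> ?q \<le> D ^ (m0 + (j + 2)) * G \<xi> r" using r by (intro G_le_G) auto
  have "G \<xi>' r \<le> D ^ (m0 + 0 + (3 * m0 + 3 + (3 * m0 + 3 + (3 * m0 + 3 + (m0 + (j + 2)))))) * G \<xi> r"
    using D_chain[OF 1[unfolded \<xi>'] D_chain[OF st(1) D_chain[OF st(2) D_chain[OF st(3) 2]]]] unfolding \<xi>' .
  also have "\<dots> \<le> D ^ (a1 + 2 * j + 4) * G \<xi> r"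
    by (intro mult_right_mono D_pow_mono G_nonneg) (simp add: a1_def)
  finally show ?thesis .
qed

text \<open>Take the outer radius: \<open>2 * R\<close> along \<open>eX\<close> lies outside the
  section and \<open>K0 * R\<close> in its closed inner ball, and doubling turns both facts into
  bounds at \<open>R\<close>.\<close>

lemma exists_radius:
  assumes s: "0 < s"
  obtains R where "0 < R" "\<And>v. exc \<xi> v < s \<Longrightarrow> nrm n v \<le> R" "s \<le> D ^ 1 * G \<xi> R" "G \<xi> R \<le> D ^ (2 * m0) * s"
proof -
  obtain R where R: "0 < R" and in1: "\<forall>v. nrm n v \<le> K0 * R \<longrightarrow> F (hstep n \<xi> v) - F \<xi> - hdot n (gr \<xi>) v < s"
    and out: "\<forall>v. F (hstep n \<xi> v) - F \<xi> - hdot n (gr \<xi>) v < s \<longrightarrow> nrm n v \<le> R"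
    using round[OF gr(2) s] by blast
  have out': "nrm n v \<le> R" if "exc \<xi> v < s" for v using out that unfolding exc_def by blast
  have "\<not> exc \<xi> (2 *\<^sub>R R *\<^sub>R eX) < s" using out'[of "2 *\<^sub>R R *\<^sub>R eX"] R by auto
  then have 1: "s \<le> D ^ 1 * G \<xi> R" using exc_doubling[of \<xi> "R *\<^sub>R eX"] by (simp add: G_def)
  have "R * 1 \<le> R * (K0 * 2 ^ m0)" using m0 R by (intro mult_left_mono) auto
  then have "G \<xi> R \<le> D ^ (m0 + m0) * exc \<xi> ((K0 * R) *\<^sub>R eX)"
    using R K0 by (intro G_le_exc) (auto simp: mult_ac)
  also have "\<dots> \<le> D ^ (m0 + m0) * s"
  proof (intro mult_left_mono)
    show "exc \<xi> ((K0 * R) *\<^sub>R eX) \<le> s"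
      using in1[rule_format, of "(K0 * R) *\<^sub>R eX"] R K0 unfolding exc_def by simp
  qed (use D1 in simp)
  finally have "G \<xi> R \<le> D ^ (2 * m0) * s" by (simp add: mult_2)
  then show thesis using that R out' 1 by blast
qed

section \<open>Size of the three-step sections and engulfing\<close>

definition lam :: "nat \<Rightarrow> real" where "lam j = D ^ (m0 + (1 + (a1 + 2 * j + 4)))"

lemma lam1: "1 \<le> lam j" unfolding lam_def using D1 by (rule one_le_power)

text \<open>The excess grows at least linearly, and \<open>G \<xi>' R\<close> is comparable to at
  least \<open>s\<close>; \<open>lam j\<close> is exactly the loss in these comparisons, so a longer
  step would leave the section.\<close>

lemma section_step_bound:
  assumes R: "0 < R" and s: "s \<le> D ^ 1 * G \<xi> R" and near: "near n (2 ^ j * R) \<xi> \<xi>'" and v: "exc \<xi>' v < s"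
  shows "nrm n v \<le> lam j * R"
proof (rule ccontr)
  assume "\<not> ?thesis"
  then have "lam j * R \<le> 2 ^ 0 * nrm n v" by simp
  then have "G \<xi>' (lam j * R) \<le> D ^ (m0 + 0) * exc \<xi>' v"
    using R lam1[of j] by (intro G_le_exc mult_pos_pos) auto
  also have "\<dots> < D ^ (m0 + 0) * s" using v D1 by (intro mult_strict_left_mono) auto
  finally have 1: "G \<xi>' (lam j * R) < D ^ (m0 + 0) * s" .
  have "D ^ (m0 + 0) * s \<le> lam j * G \<xi>' R"
    unfolding lam_def using D_chain[OF order_refl D_chain[OF s G_near[OF R near_sym[OF near]]], of m0] by simp
  also have "\<dots> \<le> G \<xi>' (lam j * R)"
    using exc_scale_ge[OF lam1, of j \<xi>' "R *\<^sub>R eX"] by (simp add: G_def)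
  finally show False using 1 by simp
qed

text \<open>Since \<open>k < 2 ^ k\<close>, the power of 2 with this exponent dominates
  \<open>2 ^ j + lam j\<close>.\<close>

definition nxt :: "nat \<Rightarrow> nat" where "nxt j = nat \<lceil>2 ^ j + lam j\<rceil>"

lemma section_step_near:
  assumes R: "0 < R" and s: "s \<le> D ^ 1 * G \<xi> R" and near: "near n (2 ^ j * R) \<xi> \<xi>'" and v: "exc \<xi>' v < s"
  shows "near n (2 ^ nxt j * R) \<xi> (hstep n \<xi>' v)"
proof -
  have "2 ^ j + lam j \<le> real (nxt j)" unfolding nxt_def by linarith
  also have "\<dots> \<le> 2 ^ nxt j" using of_nat_less_two_power[of "nxt j", where 'a = real] by linarith
  finally have "(2 ^ j + lam j) * R \<le> 2 ^ nxt j * R" using R by (intro mult_right_mono) auto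
  then have "2 ^ j * R + lam j * R \<le> 2 ^ nxt j * R" by (simp add: algebra_simps)
  then show ?thesis
    using near_triangle[OF near near_hstep[OF section_step_bound[OF assms]]] near_mono by blast
qed

text \<open>What \<open>Hn_section\<close> becomes once the subgradient is unique and the unions
  over subgradients collapse.\<close>

definition sec :: "hpoint \<Rightarrow> real \<Rightarrow> hpoint set" where
  "sec \<xi> s = {\<xi>'. \<exists>v1\<in>hlayer n. \<exists>v2\<in>hlayer n. \<exists>v3\<in>hlayer n.
     \<xi>' = hstep n (hstep n (hstep n \<xi> v1) v2) v3 \<and>
     exc \<xi> v1 < s \<and> exc (hstep n \<xi> v1) v2 < s \<and> exc (hstep n (hstep n \<xi> v1) v2) v3 < s}"

definition kk :: nat where "kk = nxt (nxt (nxt 0))"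

lemma sec_near:
  assumes R: "0 < R" and s: "s \<le> D ^ 1 * G \<xi> R" and mem: "\<xi>' \<in> sec \<xi> s"
  shows "near n (2 ^ kk * R) \<xi> \<xi>'"
proof -
  from mem obtain v1 v2 v3 where \<xi>': "\<xi>' = hstep n (hstep n (hstep n \<xi> v1) v2) v3"
    and v: "exc \<xi> v1 < s" "exc (hstep n \<xi> v1) v2 < s" "exc (hstep n (hstep n \<xi> v1) v2) v3 < s"
    unfolding sec_def by blast
  have 0: "near n (2 ^ 0 * R) \<xi> \<xi>" using R by (simp add: near_refl)
  note 1 = section_step_near[OF R s 0 v(1)]
  note 2 = section_step_near[OF R s 1 v(2)]
  show ?thesis unfolding \<xi>' kk_def by (rule section_step_near[OF R s 2 v(3)])
qed

lemma exc_near: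
  assumes "0 < R" "near n (2 ^ j * R) \<xi> \<zeta>" "nrm n v \<le> 2 ^ i * R" "G \<xi> R \<le> D ^ (2 * m0) * s"
  shows "exc \<zeta> v \<le> D ^ (m0 + i + (a1 + 2 * j + 4 + 2 * m0)) * s"
  using D_chain[OF exc_le_G[OF assms(1,3)] D_chain[OF G_near[OF assms(1,2)] assms(4)]] .

text \<open>In \<open>sec_engulfing\<close> the steps have length at most
  \<open>2 ^ (kk + 3) * R\<close> and start within \<open>2 ^ (kk + 5) * R\<close> of the centre.
  The factor 2 makes the final bound strict.\<close>

definition eng :: real where "eng = 2 * D ^ (m0 + (kk + 3) + (a1 + 2 * (kk + 5) + 4 + 2 * m0))"

lemma eng_gt_1: "1 < eng"
  using one_le_power[OF D1] by (auto simp: eng_def intro: less_le_trans[of 1 "2 * 1"])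

text \<open>Both points are near the centre, hence near each other. Each of three steps joining them
  has its excess bounded through \<open>G \<xi> R\<close>, which is at most a multiple of
  \<open>s\<close>.\<close>

lemma sec_engulfing:
  assumes \<xi>: "\<xi>' \<in> heis n" "\<xi>'' \<in> heis n" and s: "0 < s" and mem: "\<xi>' \<in> sec \<xi> s" "\<xi>'' \<in> sec \<xi> s"
  shows "\<xi>'' \<in> sec \<xi>' (eng * s)"
proof -
  obtain R where R: "0 < R" "s \<le> D ^ 1 * G \<xi> R" "G \<xi> R \<le> D ^ (2 * m0) * s"
    using exists_radius[OF s] by blast
  have n1: "near n (2 ^ kk * R) \<xi> \<xi>'" and n2: "near n (2 ^ kk * R) \<xi> \<xi>''"
    using sec_near[OF R(1,2)] mem by auto
  obtain v1 v2 v3 where \<xi>'': "\<xi>'' = hstep n (hstep n (hstep n \<xi>' v1) v2) v3"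
    and v': "nrm n v1 \<le> 3 * (2 ^ kk * R + 2 ^ kk * R)" "nrm n v2 \<le> 3 * (2 ^ kk * R + 2 ^ kk * R)" "nrm n v3 \<le> 3 * (2 ^ kk * R + 2 ^ kk * R)"
    and lay: "v1 \<in> hlayer n" "v2 \<in> hlayer n" "v3 \<in> hlayer n"
    using near_three_steps[OF n near_triangle[OF near_sym[OF n1] n2]] \<xi> by metis
  have "3 * (2 ^ kk * R + 2 ^ kk * R) \<le> 2 ^ (kk + 3) * R" using R by (simp add: power_add)
  note v = v'[THEN order_trans, OF this]
  note m1 = near_triangle[OF n1 near_hstep[OF v(1)]]
  note m2 = near_triangle[OF m1 near_hstep[OF v(2)]]
  have pw: "2 ^ kk * R \<le> 2 ^ (kk + 5) * R" "2 ^ kk * R + 2 ^ (kk + 3) * R \<le> 2 ^ (kk + 5) * R"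
    "2 ^ kk * R + 2 ^ (kk + 3) * R + 2 ^ (kk + 3) * R \<le> 2 ^ (kk + 5) * R"
    using R by (simp_all add: power_add)
  let ?E = "D ^ (m0 + (kk + 3) + (a1 + 2 * (kk + 5) + 4 + 2 * m0))"
  have "1 \<le> ?E" by (rule one_le_power[OF D1])
  then have lt: "?E * s < eng * s" using s unfolding eng_def by (intro mult_strict_right_mono) auto
  have "exc \<xi>' v1 \<le> ?E * s" by (rule exc_near[OF R(1) near_mono[OF n1 pw(1)] v(1) R(3)])
  moreover have "exc (hstep n \<xi>' v1) v2 \<le> ?E * s" by (rule exc_near[OF R(1) near_mono[OF m1 pw(2)] v(2) R(3)])
  moreover have "exc (hstep n (hstep n \<xi>' v1) v2) v3 \<le> ?E * s"
    by (rule exc_near[OF R(1) near_mono[OF m2 pw(3)] v(3) R(3)])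
  ultimately show ?thesis unfolding sec_def \<xi>'' using lt lay by fastforce
qed

text \<open>The step between the two points is \<open>w - v\<close>, of length at most
  \<open>2 * R\<close>, so a single excess estimate suffices.\<close>

lemma horizontal_engulfing:
  assumes s: "0 < s" and v: "exc \<xi> v < s" and w: "exc \<xi> w < s" and eq: "hstep n (hstep n \<xi> v) u = hstep n \<xi> w"
  shows "exc (hstep n \<xi> v) u < eng * s"
proof -
  obtain R where R: "0 < R" "\<And>v. exc \<xi> v < s \<Longrightarrow> nrm n v \<le> R" "G \<xi> R \<le> D ^ (2 * m0) * s"
    using exists_radius[OF s] by blast
  have "Pr1 (hstep n (hstep n \<xi> v) u) = Pr1 (hstep n \<xi> w)" using eq by simp
  then have "u = w - v" by (simp add: algebra_simps)
  then have u: "nrm n u \<le> 2 ^ 1 * R" using nrm_triangle_diff[of n w v] R(2)[OF v] R(2)[OF w] by simp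
  have near: "near n (2 ^ 0 * R) \<xi> (hstep n \<xi> v)" using R(2)[OF v] by (simp add: near_hstep)
  let ?E = "D ^ (m0 + 1 + (a1 + 2 * 0 + 4 + 2 * m0))"
  have "exc (hstep n \<xi> v) u \<le> ?E * s" by (rule exc_near[OF R(1) near u R(3)])
  also have "\<dots> < eng * s"
  proof (intro mult_strict_right_mono s)
    have "1 \<le> ?E" by (rule one_le_power[OF D1])
    then have "?E < 2 * ?E" by linarith
    also have "\<dots> \<le> eng" unfolding eng_def by (intro mult_left_mono D_pow_mono) auto
    finally show "?E < eng" .
  qed
  finally show ?thesis .
qed

lemma sec_mono: "s \<le> s' \<Longrightarrow> sec \<xi> s \<subseteq> sec \<xi> s'"
  unfolding sec_def by fastforce

lemma sec_heis: "\<xi> \<in> heis n \<Longrightarrow> sec \<xi> s \<subseteq> heis n"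
  unfolding sec_def by auto

lemma sec_self: "0 < s \<Longrightarrow> \<xi> \<in> sec \<xi> s"
  unfolding sec_def by (auto simp: exc_def intro!: bexI[of _ 0])

lemma sec_exhausts:
  assumes "\<xi> \<in> heis n" "\<xi>' \<in> heis n"
  shows "\<exists>s>0. \<xi>' \<in> sec \<xi> s"
proof -
  obtain q r where "near n q hzero \<xi>" "near n r hzero \<xi>'" using exists_near_hzero by meson
  then have "near n (q + r) \<xi> \<xi>'" using near_triangle near_sym by blast
  then obtain v1 v2 v3 where \<xi>': "\<xi>' = hstep n (hstep n (hstep n \<xi> v1) v2) v3"
    and lay: "v1 \<in> hlayer n" "v2 \<in> hlayer n" "v3 \<in> hlayer n"
    using near_three_steps[OF n] assms by metis
  let ?s = "exc \<xi> v1 + exc (hstep n \<xi> v1) v2 + exc (hstep n (hstep n \<xi> v1) v2) v3 + 1"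
  note nonneg = exc_nonneg[of \<xi> v1] exc_nonneg[of "hstep n \<xi> v1" v2] exc_nonneg[of "hstep n (hstep n \<xi> v1) v2" v3]
  have "exc \<xi> v1 < ?s" "exc (hstep n \<xi> v1) v2 < ?s" "exc (hstep n (hstep n \<xi> v1) v2) v3 < ?s" "0 < ?s"
    using nonneg by linarith+
  moreover from this have "\<xi>' \<in> sec \<xi> ?s"
    unfolding sec_def using \<xi>' lay by blast
  ultimately show ?thesis by blast
qed

text \<open>The section of height \<open>G \<xi> (r / 2 ^ kk)\<close> lies within distance
  \<open>r\<close> of \<open>\<xi>\<close>, for every \<open>r\<close>.\<close>

lemma sec_separates:
  assumes "\<xi> \<in> heis n" "\<xi>' \<in> heis n" "\<And>s. 0 < s \<Longrightarrow> \<xi>' \<in> sec \<xi> s"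
  shows "\<xi>' = \<xi>"
proof -
  have near: "near n r \<xi> \<xi>'" if r: "0 < r" for r
  proof -
    have R: "0 < r / 2 ^ kk" using r by simp
    have "G \<xi> (r / 2 ^ kk) * 1 \<le> G \<xi> (r / 2 ^ kk) * D" using D1 G_nonneg by (intro mult_left_mono) auto
    then have "near n (2 ^ kk * (r / 2 ^ kk)) \<xi> \<xi>'"
      by (intro sec_near[OF R _ assms(3)[OF G_pos[OF R]]]) (simp add: mult.commute)
    then show ?thesis by simp
  qed
  have "nrm n (Pr1 \<xi>' - Pr1 \<xi>) \<le> 0"
    by (rule field_le_epsilon) (use near in \<open>simp add: near_def\<close>)
  then have "vtrunc n (Pr1 \<xi>' - Pr1 \<xi>) = 0"
    using nrm_nonneg by (intro nrm_zero_imp_vtrunc antisym)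
  then have eq: "Pr1 \<xi>' = Pr1 \<xi>" using assms(1,2) by (simp add: heis_iff)
  have "\<bar>ht \<xi>' - ht \<xi>\<bar> \<le> 0"
  proof (rule field_le_epsilon)
    fix e :: real assume "0 < e"
    then show "\<bar>ht \<xi>' - ht \<xi>\<bar> \<le> 0 + e" using near[of "sqrt e"] by (simp add: near_def eq)
  qed
  then show ?thesis using eq by (intro hpoint_eqI) auto
qed

end

section \<open>Differentiability and the quasi-metric\<close>

context round_fun
begin

lemma seq_conv_of_near:
  assumes "\<And>k. near n (d k) \<xi> (X k)" "d \<longlonglongrightarrow> 0"
  shows "seq_conv X \<xi>"
proof -
  have 1: "norm (nrm n (Pr1 (X k) - Pr1 \<xi>)) \<le> d k" for k using assms(1)[of k] by (simp add: near_def)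
  have Z: "(\<lambda>k. nrm n (Pr1 (X k) - Pr1 \<xi>)) \<longlonglongrightarrow> 0"
    by (rule Lim_null_comparison[OF always_eventually[OF allI[OF 1]] assms(2)])
  have 2: "norm (ht (X k) - ht \<xi> + 2 * hsymp n (Pr1 \<xi>) (Pr1 (X k))) \<le> (d k)\<^sup>2" for k
    using assms(1)[of k] hsymp_swap[of n "Pr1 (X k)" "Pr1 \<xi>"] by (simp add: near_def)
  have 3: "(\<lambda>k. (d k)\<^sup>2) \<longlonglongrightarrow> 0" using tendsto_power[OF assms(2), of 2] by simp
  have "(\<lambda>k. ht (X k) - ht \<xi> + 2 * hsymp n (Pr1 \<xi>) (Pr1 (X k))) \<longlonglongrightarrow> 0"
    by (rule Lim_null_comparison[OF always_eventually[OF allI[OF 2]] 3])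
  moreover have "(\<lambda>k. 2 * hsymp n (Pr1 \<xi>) (Pr1 (X k))) \<longlonglongrightarrow> 2 * hsymp n (Pr1 \<xi>) (Pr1 \<xi>)"
    by (intro tendsto_intros tendsto_hsymp Z)
  ultimately have "(\<lambda>k. ht (X k) - ht \<xi> + 2 * hsymp n (Pr1 \<xi>) (Pr1 (X k)) - 2 * hsymp n (Pr1 \<xi>) (Pr1 (X k)))
      \<longlonglongrightarrow> 0 - 2 * hsymp n (Pr1 \<xi>) (Pr1 \<xi>)"
    by (rule tendsto_diff)
  then have "(\<lambda>k. ht (X k) - ht \<xi>) \<longlonglongrightarrow> 0" by simp
  then show ?thesis using Z by (simp add: seq_conv_def LIM_zero_iff)
qed

text \<open>Gradients staying away from \<open>gr \<xi>\<close> along points converging to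
  \<open>\<xi>\<close> would subconverge to a second subgradient at \<open>\<xi>\<close>.\<close>

lemma gr_continuous:
  assumes "0 < e"
  shows "\<exists>d>0. \<forall>\<xi>'. near n d \<xi> \<xi>' \<longrightarrow> nrm n (gr \<xi>' - gr \<xi>) \<le> e"
proof (rule ccontr)
  assume neg: "\<not> ?thesis"
  have "\<exists>\<xi>'. near n (inverse (real (Suc k))) \<xi> \<xi>' \<and> e < nrm n (gr \<xi>' - gr \<xi>)" for k
  proof -
    have "0 < inverse (real (Suc k))" by simp
    with neg show ?thesis by (meson not_le)
  qed
  then obtain X where X: "\<And>k. near n (inverse (real (Suc k))) \<xi> (X k)" "\<And>k. e < nrm n (gr (X k) - gr \<xi>)" by metis
  have "seq_conv X \<xi>" by (rule seq_conv_of_near[OF X(1) LIMSEQ_inverse_real_of_nat])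
  then obtain r q where q: "q \<in> hlayer n" "subg \<xi> q" and lim: "(\<lambda>k. nrm n (gr (X (r k)) - q)) \<longlonglongrightarrow> 0"
    by (rule subg_limit[OF _ gr(2)])
  have "q = gr \<xi>" using q gr subg_unique by blast
  then have "\<forall>\<^sub>F k in sequentially. nrm n (gr (X (r k)) - gr \<xi>) < e"
    using lim assms by (intro order_tendstoD) auto
  then obtain k where "nrm n (gr (X (r k)) - gr \<xi>) < e" unfolding eventually_sequentially by blast
  then show False using X(2)[of "r k"] by simp
qed

text \<open>Each of the three horizontal steps from \<open>\<xi>\<close> to \<open>\<xi>'\<close> changes \<open>F\<close> by an amount lying between the
  slopes given by the subgradients at its endpoints, and these are close to \<open>gr \<xi>\<close>.\<close>
lemma F_expansion:
  assumes e: "0 < e"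
  shows "\<exists>d>0. \<forall>r \<xi>'. r \<le> d \<and> near n r \<xi> \<xi>' \<longrightarrow> \<bar>F \<xi>' - F \<xi> - hdot n (gr \<xi>) (Pr1 \<xi>' - Pr1 \<xi>)\<bar> \<le> e * r"
proof -
  \<comment> \<open>Each of three steps of length at most \<open>3 * r\<close> contributes an error
    \<open>e / 9 * (3 * r)\<close>, a third of \<open>e * r\<close>.\<close>
  obtain d where d: "0 < d" and gd: "\<And>\<xi>'. near n d \<xi> \<xi>' \<Longrightarrow> nrm n (gr \<xi>' - gr \<xi>) \<le> e / 9"
    using gr_continuous[of "e / 9" \<xi>] e by auto
  have step: "\<bar>F (hstep n \<zeta> v) - F \<zeta> - hdot n (gr \<xi>) v\<bar> \<le> e / 9 * (3 * r)"
    if "near n d \<xi> \<zeta>" "near n d \<xi> (hstep n \<zeta> v)" "nrm n v \<le> 3 * r" for \<zeta> v r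
  proof -
    have bd: "\<bar>hdot n (gr \<eta> - gr \<xi>) v\<bar> \<le> e / 9 * (3 * r)" if "near n d \<xi> \<eta>" for \<eta>
      using hdot_le_nrm[of n "gr \<eta> - gr \<xi>" v] mult_mono[OF gd[OF that] \<open>nrm n v \<le> 3 * r\<close>] e by force
    show ?thesis
      using bd[OF that(1)] bd[OF that(2)] subgD[OF gr(2), of \<zeta> v] subgD[OF gr(2), of "hstep n \<zeta> v" "- v"]
      unfolding hdot_linear hstep_minus_cancel abs_le_iff by linarith
  qed
  have "\<bar>F \<xi>' - F \<xi> - hdot n (gr \<xi>) (Pr1 \<xi>' - Pr1 \<xi>)\<bar> \<le> e * r" if r: "r \<le> d / 9" and near: "near n r \<xi> \<xi>'" for r \<xi>'
  proof -
    obtain v1 v2 v3 where \<xi>': "\<xi>' = hstep n (hstep n (hstep n \<xi> v1) v2) v3"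
      and v: "nrm n v1 \<le> 3 * r" "nrm n v2 \<le> 3 * r" "nrm n v3 \<le> 3 * r"
      by (rule near_three_steps[OF n near])
    have r0: "0 \<le> r" using v(1) nrm_nonneg[of n v1] by linarith
    note n0 = near_refl[OF order_refl, of n \<xi>]
    note n1 = near_triangle[OF n0 near_hstep[OF v(1)]]
    note n2 = near_triangle[OF n1 near_hstep[OF v(2)]]
    note n3 = near_triangle[OF n2 near_hstep[OF v(3)]]
    have nd: "near n d \<xi> \<xi>" "near n d \<xi> (hstep n \<xi> v1)" "near n d \<xi> (hstep n (hstep n \<xi> v1) v2)"
      "near n d \<xi> (hstep n (hstep n (hstep n \<xi> v1) v2) v3)"
      using r r0 d by (auto intro: near_mono[OF n0] near_mono[OF n1] near_mono[OF n2] near_mono[OF n3])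
    have "Pr1 \<xi>' - Pr1 \<xi> = v1 + v2 + v3" by (simp add: \<xi>')
    moreover have "e / 9 * (3 * r) = e * r / 3" by simp
    ultimately show ?thesis
      using step[OF nd(1,2) v(1)] step[OF nd(2,3) v(2)] step[OF nd(3,4) v(3)]
      unfolding \<xi>' by (simp only: hdot_linear abs_le_iff) linarith
  qed
  then show ?thesis using d by (intro exI[of _ "d / 9"]) auto
qed

end

section \<open>Translation of the group operations into horizontal steps\<close>

lemma hmul_parts [simp]: "Pr1 (hmul n \<xi> \<eta>) = Pr1 \<xi> + Pr1 \<eta>"
  "ht (hmul n \<xi> \<eta>) = ht \<xi> + ht \<eta> + 2 * hsymp n (Pr1 \<eta>) (Pr1 \<xi>)"
  by (cases \<xi>; cases \<eta>; simp add: hsymp_def plus_fun_def)+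

lemma hinv_parts [simp]: "Pr1 (hinv \<xi>) = - Pr1 \<xi>" "ht (hinv \<xi>) = - ht \<xi>"
  by (cases \<xi>; simp add: fun_eq_iff)+

lemma hdil_parts [simp]: "Pr1 (hdil l \<xi>) = l *\<^sub>R Pr1 \<xi>" "ht (hdil l \<xi>) = l\<^sup>2 * ht \<xi>"
  by (cases \<xi>; simp add: fun_eq_iff)+

lemma gauge_norm_eq: "gauge_norm n \<xi> = root 4 ((nrm n (Pr1 \<xi>)) ^ 4 + (ht \<xi>)\<^sup>2)"
proof -
  have "(L2_set x {..<n})\<^sup>2 = dot n x x" for x
    by (simp add: L2_set_def dot_def power2_eq_square sum_nonneg)
  then have "(L2_set (fst \<xi>) {..<n})\<^sup>2 + (L2_set (fst (snd \<xi>)) {..<n})\<^sup>2 = (nrm n (Pr1 \<xi>))\<^sup>2"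
    by (simp add: nrm_square hdot_eq Pr1_eq)
  then show ?thesis
    by (cases \<xi>) (simp flip: power_mult)
qed

lemma gauge_dist_hstep: "gauge_dist n \<xi> (hstep n \<xi> v) = nrm n v"
  by (simp add: gauge_dist_def gauge_norm_eq real_root_power_cancel hsymp_swap[of n "Pr1 \<xi>" v])

lemma hplane_eq:
  assumes "\<xi> \<in> heis n"
  shows "hplane n \<xi> = hstep n \<xi> ` hlayer n"
proof (intro set_eqI iffI)
  fix \<eta> assume \<eta>: "\<eta> \<in> hplane n \<xi>"
  then have "\<eta> \<in> heis n" "ht \<eta> = ht \<xi> + 2 * hsymp n (Pr1 \<eta>) (Pr1 \<xi>)"
    by (cases \<xi>; cases \<eta>; simp add: hsymp_def dot_sym)+
  then have "\<eta> = hstep n \<xi> (Pr1 \<eta> - Pr1 \<xi>)" "Pr1 \<eta> - Pr1 \<xi> \<in> hlayer n"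
    using assms by (auto intro!: hpoint_eqI simp: heis_iff)
  then show "\<eta> \<in> hstep n \<xi> ` hlayer n" by blast
next
  fix \<eta> assume "\<eta> \<in> hstep n \<xi> ` hlayer n"
  then obtain v where v: "v \<in> hlayer n" "\<eta> = hstep n \<xi> v" by blast
  then have "\<eta> \<in> heis n" using assms by simp
  moreover have "ht \<eta> = ht \<xi> + 2 * hsymp n (Pr1 \<eta>) (Pr1 \<xi>)" by (simp add: v)
  ultimately show "\<eta> \<in> hplane n \<xi>"
    by (cases \<xi>; cases \<eta>; simp add: hsymp_def dot_sym)
qed

lemma hsubdiff_iff:
  assumes "\<xi> \<in> heis n"
  shows "p \<in> hsubdiff n \<phi> \<xi> \<longleftrightarrow> p \<in> hlayer n \<and> (\<forall>v\<in>hlayer n. \<phi> \<xi> + hdot n p v \<le> \<phi> (hstep n \<xi> v))"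
  by (simp add: hsubdiff_def hplane_eq[OF assms])

lemma hsection_eq:
  assumes "\<xi> \<in> heis n"
  shows "hsection n \<phi> \<xi> p s = hstep n \<xi> ` {v \<in> hlayer n. \<phi> (hstep n \<xi> v) - \<phi> \<xi> - hdot n p v < s}"
  by (auto simp: hsection_def hplane_eq[OF assms])

lemma hconvex_fun_ptrunc:
  assumes n: "1 \<le> n" and \<phi>: "hconvex n \<phi>"
  shows "hconvex_fun n (\<lambda>\<xi>. \<phi> (ptrunc n \<xi>))"
proof
  fix s :: real and \<xi> v assume s: "0 \<le> s" "s \<le> 1"
  let ?\<xi> = "ptrunc n \<xi>" and ?v = "vtrunc n v"
  have "hmul n ?\<xi> (hdil s (hmul n (hinv ?\<xi>) (hstep n ?\<xi> ?v))) = hstep n ?\<xi> (s *\<^sub>R ?v)"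
    by (rule hpoint_eqI) (simp_all del: Pr1_ptrunc)
  moreover have "hstep n ?\<xi> ?v \<in> hplane n ?\<xi>" by (simp add: hplane_eq)
  ultimately have "\<phi> (hstep n ?\<xi> (s *\<^sub>R ?v)) \<le> (1 - s) * \<phi> ?\<xi> + s * \<phi> (hstep n ?\<xi> ?v)"
    using \<phi> s unfolding hconvex_def by (metis ptrunc_heis atLeastAtMost_iff)
  moreover have "vtrunc n (s *\<^sub>R v) = s *\<^sub>R ?v" by (auto simp: vtrunc_def fun_eq_iff prod_eq_iff)
  ultimately show "\<phi> (ptrunc n (hstep n \<xi> (s *\<^sub>R v))) \<le> (1 - s) * \<phi> ?\<xi> + s * \<phi> (ptrunc n (hstep n \<xi> v))"
    by (simp add: ptrunc_hstep)
qed (use n in auto)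

lemma round_fun_ptrunc:
  assumes n: "1 \<le> n" and \<phi>: "hconvex n \<phi>" and round: "round_hsections n K0 \<phi>" and K0: "0 < K0" "K0 < 1"
  shows "round_fun n (\<lambda>\<xi>. \<phi> (ptrunc n \<xi>)) K0"
proof -
  interpret hconvex_fun n "\<lambda>\<xi>. \<phi> (ptrunc n \<xi>)" by (rule hconvex_fun_ptrunc[OF n \<phi>])
  show ?thesis
  proof (unfold_locales)
    fix \<xi> p and s :: real
    assume p: "subg \<xi> p" and s: "0 < s"
    let ?\<xi> = "ptrunc n \<xi>" and ?p = "vtrunc n p"
    have "?p \<in> hsubdiff n \<phi> ?\<xi>"
      unfolding hsubdiff_iff[OF ptrunc_heis]
    proof (intro conjI ballI)
      fix v assume "v \<in> hlayer n"
      then show "\<phi> ?\<xi> + hdot n ?p v \<le> \<phi> (hstep n ?\<xi> v)" using subgD[OF p, of v] by (simp add: ptrunc_hstep)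
    qed simp
    then obtain R where R: "0 < R" and in1: "gauge_ball n ?\<xi> (K0 * R) \<inter> hplane n ?\<xi> \<subseteq> hsection n \<phi> ?\<xi> ?p s"
      and out: "hsection n \<phi> ?\<xi> ?p s \<subseteq> gauge_ball n ?\<xi> R \<inter> hplane n ?\<xi>"
      using round s ptrunc_heis unfolding round_hsections_def by meson
    have "\<phi> (ptrunc n (hstep n \<xi> v)) - \<phi> ?\<xi> - hdot n p v < s" if "nrm n v \<le> K0 * R" for v
    proof -
      have "hstep n ?\<xi> (vtrunc n v) \<in> gauge_ball n ?\<xi> (K0 * R) \<inter> hplane n ?\<xi>"
        using that by (simp add: gauge_ball_def gauge_dist_hstep hplane_eq)
      then show ?thesis using in1 by (auto simp: hsection_def ptrunc_hstep)
    qed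
    moreover have "nrm n v \<le> R" if "\<phi> (ptrunc n (hstep n \<xi> v)) - \<phi> ?\<xi> - hdot n p v < s" for v
    proof -
      have "hstep n ?\<xi> (vtrunc n v) \<in> hsection n \<phi> ?\<xi> ?p s"
        using that by (simp add: hsection_def hplane_eq ptrunc_hstep)
      then have "hstep n ?\<xi> (vtrunc n v) \<in> gauge_ball n ?\<xi> R" using out by blast
      then show ?thesis by (simp add: gauge_ball_def gauge_dist_hstep)
    qed
    ultimately show "\<exists>R>0. (\<forall>v. nrm n v \<le> K0 * R \<longrightarrow> \<phi> (ptrunc n (hstep n \<xi> v)) - \<phi> ?\<xi> - hdot n p v < s) \<and>
        (\<forall>v. \<phi> (ptrunc n (hstep n \<xi> v)) - \<phi> ?\<xi> - hdot n p v < s \<longrightarrow> nrm n v \<le> R)"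
      using R by blast
  qed (use K0 in auto)
qed

section \<open>Uniqueness of the horizontal gradient\<close>

lemma continuous_gauge_norm: "continuous_on UNIV (gauge_norm n)"
proof -
  have 0: "continuous_on UNIV (\<lambda>x::nat \<Rightarrow> real. x i)" for i by (rule continuous_on_product_coordinates)
  have 1: "continuous_on UNIV (\<lambda>\<xi>::hpoint. fst \<xi> i)" "continuous_on UNIV (\<lambda>\<xi>::hpoint. fst (snd \<xi>) i)" for i
    by (rule continuous_on_compose2[OF 0]; (intro continuous_intros)?; simp)+
  have "gauge_norm n = (\<lambda>\<xi>. root 4 ((dot n (fst \<xi>) (fst \<xi>) + dot n (fst (snd \<xi>)) (fst (snd \<xi>)))\<^sup>2 + (ht \<xi>)\<^sup>2))"
  proof
    fix \<xi>
    have "(nrm n (Pr1 \<xi>)) ^ 4 = ((nrm n (Pr1 \<xi>))\<^sup>2)\<^sup>2" by simp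
    then show "gauge_norm n \<xi> = root 4 ((dot n (fst \<xi>) (fst \<xi>) + dot n (fst (snd \<xi>)) (fst (snd \<xi>)))\<^sup>2 + (ht \<xi>)\<^sup>2)"
      unfolding gauge_norm_eq by (simp add: nrm_square hdot_eq Pr1_eq)
  qed
  moreover have "continuous_on UNIV (\<lambda>\<xi>. root 4 ((dot n (fst \<xi>) (fst \<xi>) + dot n (fst (snd \<xi>)) (fst (snd \<xi>)))\<^sup>2 + (ht \<xi>)\<^sup>2))"
    unfolding dot_def by (intro continuous_intros 1)
  ultimately show ?thesis by simp
qed

lemma gauge_norm_hzero: "gauge_norm n hzero = 0"
  by (simp add: hzero_def L2_set_def)

text \<open>Two gradients differ by a linear form that is small compared with the gauge norm. Along
  the curve \<open>\<gamma>\<close>, which is \<open>exp (s v)\<close> for their difference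
  \<open>v\<close>, the form is \<open>s * (nrm n v)\<^sup>2\<close> and the gauge norm only
  \<open>s * nrm n v\<close>.\<close>

lemma has_hgrad_unique:
  assumes p: "has_hgrad n \<phi> p \<xi>" and q: "has_hgrad n \<phi> q \<xi>"
  shows "p = q"
proof -
  define v where "v = q - p"
  have v: "v \<in> hlayer n" using p q by (simp add: v_def has_hgrad_def)
  have "(\<lambda>\<eta>. (\<phi> (hmul n \<xi> \<eta>) - \<phi> \<xi> - hdot n p (Pr1 \<eta>)) - (\<phi> (hmul n \<xi> \<eta>) - \<phi> \<xi> - hdot n q (Pr1 \<eta>)))
      \<in> o[at hzero within heis n](gauge_norm n)"
    using p q unfolding has_hgrad_def by (elim conjE) (rule sum_in_smallo(2))
  then have small: "(\<lambda>\<eta>. hdot n v (Pr1 \<eta>)) \<in> o[at hzero within heis n](gauge_norm n)"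
    by (simp add: v_def)
  have "nrm n v = 0"
  proof (rule ccontr)
    assume "nrm n v \<noteq> 0"
    then have nv: "0 < nrm n v" using nrm_nonneg[of n v] by linarith
    define \<gamma> :: "real \<Rightarrow> hpoint" where "\<gamma> s = ((\<lambda>i. s * fst v i), (\<lambda>i. s * snd v i), 0)" for s
    have \<gamma>: "Pr1 (\<gamma> s) = s *\<^sub>R v" "ht (\<gamma> s) = 0" for s
      by (simp_all add: \<gamma>_def prod_eq_iff fun_eq_iff)
    have "continuous_on UNIV \<gamma>"
      unfolding \<gamma>_def by (intro continuous_on_Pair continuous_on_coordinatewise_then_product continuous_intros)
    then have "(\<gamma> \<longlongrightarrow> \<gamma> 0) (at_right 0)"
      using continuous_on_def[of UNIV \<gamma>] filterlim_at_split tendsto_within_subset by (metis UNIV_I subset_UNIV)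
    then have lim: "(\<gamma> \<longlongrightarrow> hzero) (at_right 0)" by (simp add: \<gamma>_def hzero_def)
    have ne: "\<gamma> s \<noteq> hzero" if "0 < s" for s
    proof
      assume "\<gamma> s = hzero"
      then have "s *\<^sub>R v = Pr1 hzero" using \<gamma>(1)[of s] by simp
      moreover have "Pr1 hzero = 0" by (simp add: hzero_def zero_prod_def zero_fun_def)
      ultimately have "nrm n (s *\<^sub>R v) = nrm n 0" by (simp only:)
      then show False using that nv by simp
    qed
    have "\<gamma> s \<in> heis n" for s using v \<gamma>(1)[of s] by (simp add: heis_iff)
    then have "filterlim \<gamma> (at hzero within heis n) (at_right 0)"
      using lim ne by (auto simp: filterlim_at eventually_at_filter)
    moreover have "\<forall>\<^sub>F \<eta> in at hzero within heis n. norm (hdot n v (Pr1 \<eta>)) \<le> nrm n v / 2 * norm (gauge_norm n \<eta>)"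
      using landau_o.smallD[OF small, of "nrm n v / 2"] nv by simp
    ultimately have "\<forall>\<^sub>F s in at_right 0. norm (hdot n v (Pr1 (\<gamma> s))) \<le> nrm n v / 2 * norm (gauge_norm n (\<gamma> s))"
      by (rule eventually_compose_filterlim[rotated])
    then obtain s where s: "0 < s" "norm (hdot n v (Pr1 (\<gamma> s))) \<le> nrm n v / 2 * norm (gauge_norm n (\<gamma> s))"
      by (metis (mono_tags, lifting) eventually_at_right_field dense)
    have "gauge_norm n (\<gamma> s) = s * nrm n v" using s(1) by (simp add: gauge_norm_eq \<gamma> real_root_power_cancel)
    moreover have "hdot n v (Pr1 (\<gamma> s)) = s * (nrm n v * nrm n v)"
      by (simp add: \<gamma> nrm_square[symmetric] power2_eq_square)
    ultimately have "s * (nrm n v * nrm n v) \<le> s * (nrm n v * nrm n v) / 2" using s by simp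
    moreover have "0 < s * (nrm n v * nrm n v)" using s(1) nv by simp
    ultimately show False by linarith
  qed
  then have "vtrunc n v = 0" by (rule nrm_zero_imp_vtrunc)
  then show ?thesis using v by (simp add: v_def)
qed

section \<open>Quasi-metrics from engulfing families\<close>

text \<open>Engulfing makes membership symmetric up to the factor \<open>K\<close>. For the triangle
  inequality both outer points lie in one section centred at the middle point \<open>z\<close>, so
  each engulfs the other at height \<open>K * s\<close>.\<close>

lemma quasi_metric_of_sections:
  fixes S :: "'a \<Rightarrow> real \<Rightarrow> 'a set"
  defines "A \<equiv> \<lambda>x y. {s. 0 < s \<and> x \<in> S y s \<and> y \<in> S x s}"
  assumes K: "1 < K"
    and engulf: "\<And>x y z s. \<lbrakk>x \<in> X; 0 < s; y \<in> S x s; z \<in> S x s\<rbrakk> \<Longrightarrow> z \<in> S y (K * s)"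
    and mono: "\<And>x s t. \<lbrakk>x \<in> X; s \<le> t\<rbrakk> \<Longrightarrow> S x s \<subseteq> S x t"
    and sub: "\<And>x s. x \<in> X \<Longrightarrow> S x s \<subseteq> X"
    and self: "\<And>x s. \<lbrakk>x \<in> X; 0 < s\<rbrakk> \<Longrightarrow> x \<in> S x s"
    and exhaust: "\<And>x y. \<lbrakk>x \<in> X; y \<in> X\<rbrakk> \<Longrightarrow> \<exists>s>0. y \<in> S x s"
    and separate: "\<And>x y. \<lbrakk>x \<in> X; y \<in> X; \<And>s. 0 < s \<Longrightarrow> y \<in> S x s\<rbrakk> \<Longrightarrow> y = x"
  shows "\<forall>x\<in>X. \<forall>y\<in>X. A x y \<noteq> {}"
    and "quasi_metric_on X (\<lambda>x y. Inf (A x y))"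
    and "\<forall>x\<in>X. \<forall>r>0. S x (r / (2 * K)) \<subseteq> {y \<in> X. Inf (A x y) < r} \<and> {y \<in> X. Inf (A x y) < r} \<subseteq> S x r"
proof -
  have bdd: "bdd_below (A x y)" for x y
    by (rule bdd_belowI[of _ 0]) (simp add: A_def)
  have centre: "x \<in> S y (K * s)" if "x \<in> X" "0 < s" "y \<in> S x s" for x y s
    using engulf[OF that self[OF that(1,2)]] .
  have memA: "K * s \<in> A x y" if "x \<in> X" "0 < s" "y \<in> S x s" for x y s
  proof -
    have "1 * s \<le> K * s" using K that(2) by (intro mult_right_mono) auto
    then have "y \<in> S x (K * s)" using mono[OF that(1), of s "K * s"] that(3) by auto
    then show ?thesis using centre[OF that] K that(2) by (simp add: A_def)
  qed
  show ne: "\<forall>x\<in>X. \<forall>y\<in>X. A x y \<noteq> {}"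
    using exhaust memA by blast
  have sym: "A x y = A y x" for x y
    by (auto simp: A_def)
  have nonneg: "0 \<le> Inf (A x y)" if "x \<in> X" "y \<in> X" for x y
    using ne that by (intro cInf_greatest) (auto simp: A_def)
  have mem: "y \<in> S x s" if "x \<in> X" "y \<in> X" and lt: "Inf (A x y) < s" for x y s
  proof -
    have "A x y \<noteq> {}" using ne that by blast
    then obtain t where "t \<in> A x y" "t < s" using cInf_lessD[OF _ lt] by blast
    then have "y \<in> S x t" "t \<le> s" by (auto simp: A_def)
    then show ?thesis using mono[OF that(1)] by blast
  qed
  have zero: "Inf (A x y) = 0 \<longleftrightarrow> x = y" if xy: "x \<in> X" "y \<in> X" for x y
  proof
    assume "Inf (A x y) = 0"
    then have "\<And>s. 0 < s \<Longrightarrow> y \<in> S x s" using mem[OF xy] by simp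
    then show "x = y" using separate[OF xy] by blast
  next
    assume "x = y"
    then have "s \<in> A x y" if "0 < s" for s using self[OF xy(1) that] that by (simp add: A_def)
    then have "Inf (A x y) \<le> 0 + s" if "0 < s" for s using that bdd by (simp add: cInf_lower)
    then show "Inf (A x y) = 0" using nonneg[OF xy] field_le_epsilon antisym by metis
  qed
  have triangle: "Inf (A x y) \<le> K * (Inf (A x z) + Inf (A z y))" if "x \<in> X" "y \<in> X" "z \<in> X" for x y z
  proof (rule field_le_epsilon)
    fix e :: real assume e: "0 < e"
    \<comment> \<open>The slack \<open>e / K\<close> makes both distances strictly smaller than
      \<open>s\<close> and becomes \<open>e\<close> after multiplication by
      \<open>K\<close>.\<close>
    define s where "s = Inf (A x z) + Inf (A z y) + e / K"
    have eK: "0 < e / K" using e K by simp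
    have s: "0 < s" "Inf (A z x) < s" "Inf (A z y) < s"
      using nonneg[OF that(1,3)] nonneg[OF that(3,2)] eK by (simp_all add: s_def sym[of z x])
    have x: "x \<in> S z s" and y: "y \<in> S z s" using mem that s by auto
    have "K * s \<in> A x y"
      using engulf[OF that(3) s(1) x y] engulf[OF that(3) s(1) y x] K s(1) by (simp add: A_def)
    then have "Inf (A x y) \<le> K * s" by (rule cInf_lower[OF _ bdd])
    also have "\<dots> = K * (Inf (A x z) + Inf (A z y)) + e" using K by (simp add: s_def algebra_simps)
    finally show "Inf (A x y) \<le> K * (Inf (A x z) + Inf (A z y)) + e" .
  qed
  show "quasi_metric_on X (\<lambda>x y. Inf (A x y))"
    unfolding quasi_metric_on_def using nonneg zero sym triangle K
    by (intro conjI exI[of _ K] ballI) auto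
  have "y \<in> X \<and> Inf (A x y) < r" if "x \<in> X" "0 < r" "y \<in> S x (r / (2 * K))" for x y r
  proof -
    have "0 < r / (2 * K)" using that K by simp
    from memA[OF that(1) this that(3)] have "r / 2 \<in> A x y" using K by simp
    then have "Inf (A x y) \<le> r / 2" by (rule cInf_lower[OF _ bdd])
    then show ?thesis using that sub by auto
  qed
  then show "\<forall>x\<in>X. \<forall>r>0. S x (r / (2 * K)) \<subseteq> {y \<in> X. Inf (A x y) < r} \<and> {y \<in> X. Inf (A x y) < r} \<subseteq> S x r"
    using mem by blast
qed

section \<open>Transfer to the original function\<close>

context
  fixes n :: nat and K0 :: real and \<phi> :: "hpoint \<Rightarrow> real"
  assumes n: "1 \<le> n" and \<phi>: "hconvex n \<phi>" "round_hsections n K0 \<phi>" and K0: "0 < K0" "K0 < 1"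
begin

interpretation round_fun n "\<lambda>\<xi>. \<phi> (ptrunc n \<xi>)" K0
  by (rule round_fun_ptrunc[OF n \<phi> K0])

lemma hsubdiff_eq:
  assumes "\<xi> \<in> heis n"
  shows "hsubdiff n \<phi> \<xi> = {gr \<xi>}"
proof -
  have "p \<in> hsubdiff n \<phi> \<xi> \<longleftrightarrow> p \<in> hlayer n \<and> subg \<xi> p" for p
    unfolding hsubdiff_iff[OF assms] subg_def
    using assms by (metis hdot_vtrunc(2) hlayer_closed(6) ptrunc_hstep ptrunc_ident vtrunc_ident)
  then show ?thesis using gr subg_unique by blast
qed

lemma hsection_gr:
  assumes "\<xi> \<in> heis n"
  shows "hsection n \<phi> \<xi> (gr \<xi>) s = hstep n \<xi> ` {v \<in> hlayer n. exc \<xi> v < s}"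
  unfolding hsection_eq[OF assms] exc_def using assms by (intro image_cong) auto

lemma Hn_section_eq:
  assumes \<xi>: "\<xi> \<in> heis n"
  shows "Hn_section n \<phi> \<xi> (gr \<xi>) s = sec \<xi> s"
proof -
  have "Hn_section n \<phi> \<xi> (gr \<xi>) s = (\<Union>v1\<in>{v \<in> hlayer n. exc \<xi> v < s}.
      \<Union>v2\<in>{v \<in> hlayer n. exc (hstep n \<xi> v1) v < s}.
      hstep n (hstep n (hstep n \<xi> v1) v2) ` {v \<in> hlayer n. exc (hstep n (hstep n \<xi> v1) v2) v < s})"
    unfolding Hn_section_def hsection_gr[OF \<xi>] using \<xi> by (auto simp: hsubdiff_eq hsection_gr)
  also have "\<dots> = sec \<xi> s" unfolding sec_def by blast
  finally show ?thesis .
qed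

lemma has_hgrad_gr:
  assumes \<xi>: "\<xi> \<in> heis n"
  shows "has_hgrad n \<phi> (gr \<xi>) \<xi>"
  unfolding has_hgrad_def
proof (intro conjI gr landau_o.smallI)
  fix c :: real assume "0 < c"
  then obtain d where d: "0 < d" and exp: "\<And>r \<xi>'. r \<le> d \<Longrightarrow> near n r \<xi> \<xi>' \<Longrightarrow>
      \<bar>\<phi> (ptrunc n \<xi>') - \<phi> (ptrunc n \<xi>) - hdot n (gr \<xi>) (Pr1 \<xi>' - Pr1 \<xi>)\<bar> \<le> c * r"
    using F_expansion by meson
  have "(gauge_norm n \<longlongrightarrow> gauge_norm n hzero) (at hzero within heis n)"
    using continuous_on_subset[OF continuous_gauge_norm, of "insert hzero (heis n)"]
    by (metis UNIV_I continuous_gauge_norm continuous_on_def subset_UNIV tendsto_within_subset)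
  then have "\<forall>\<^sub>F \<eta> in at hzero within heis n. gauge_norm n \<eta> < d"
    using d by (intro order_tendstoD) (auto simp: gauge_norm_hzero)
  moreover have "\<forall>\<^sub>F \<eta> in at hzero within heis n. \<eta> \<in> heis n"
    by (simp add: eventually_at_filter)
  ultimately show "\<forall>\<^sub>F \<eta> in at hzero within heis n.
      norm (\<phi> (hmul n \<xi> \<eta>) - \<phi> \<xi> - hdot n (gr \<xi>) (Pr1 \<eta>)) \<le> c * norm (gauge_norm n \<eta>)"
  proof eventually_elim
    case (elim \<eta>)
    let ?r = "gauge_norm n \<eta>"
    \<comment> \<open>The fourth power of the gauge norm dominates both summands, so the gauge norm
      itself serves as radius in \<open>near\<close>.\<close>
    have r: "0 \<le> ?r" "?r ^ 4 = (nrm n (Pr1 \<eta>)) ^ 4 + (ht \<eta>)\<^sup>2" by (simp_all add: gauge_norm_eq)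
    have "(nrm n (Pr1 \<eta>)) ^ 4 \<le> ?r ^ 4" using r(2) by simp
    then have "nrm n (Pr1 \<eta>) \<le> ?r" using r(1) power_mono_iff[of "nrm n (Pr1 \<eta>)" ?r 4] by simp
    moreover have "(?r\<^sup>2)\<^sup>2 = ?r ^ 4" by (simp only: power_mult[symmetric] mult_2 numeral_plus_numeral add_num_simps)
    then have "\<bar>ht \<eta>\<bar>\<^sup>2 \<le> (?r\<^sup>2)\<^sup>2" using r(2) by simp
    then have "\<bar>ht \<eta>\<bar> \<le> ?r\<^sup>2" by (rule power2_le_imp_le) simp
    ultimately have "near n ?r \<xi> (hmul n \<xi> \<eta>)" by (simp add: near_def)
    moreover have "hmul n \<xi> \<eta> \<in> heis n" using \<xi> elim(2) by (simp add: heis_iff)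
    ultimately show ?case using exp[of ?r "hmul n \<xi> \<eta>"] elim(1) \<xi> r(1) by simp
  qed
qed

lemma hgrad_eq:
  assumes "\<xi> \<in> heis n"
  shows "hgrad n \<phi> \<xi> = gr \<xi>"
  unfolding hgrad_def using has_hgrad_gr[OF assms] has_hgrad_unique by blast

lemma Hn_section_grad_eq: "\<xi> \<in> heis n \<Longrightarrow> Hn_section_grad n \<phi> \<xi> s = sec \<xi> s"
  by (simp add: Hn_section_grad_def hgrad_eq Hn_section_eq)

lemma engulfing_Hn_eng: "engulfing_Hn n eng \<phi>"
  unfolding engulfing_Hn_def
proof (intro ballI allI impI subsetI)
  fix \<xi> p s \<xi>' q \<xi>''
  assume \<xi>: "\<xi> \<in> heis n" and s: "(0::real) < s" and p: "p \<in> hsubdiff n \<phi> \<xi>"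
    and \<xi>': "\<xi>' \<in> Hn_section n \<phi> \<xi> p s" and q: "q \<in> hsubdiff n \<phi> \<xi>'" and \<xi>'': "\<xi>'' \<in> Hn_section n \<phi> \<xi> p s"
  have m: "\<xi>' \<in> sec \<xi> s" "\<xi>'' \<in> sec \<xi> s" using p \<xi>' \<xi>'' \<xi> by (auto simp: hsubdiff_eq Hn_section_eq)
  then have h: "\<xi>' \<in> heis n" "\<xi>'' \<in> heis n" using sec_heis[OF \<xi>] by auto
  show "\<xi>'' \<in> Hn_section n \<phi> \<xi>' q (eng * s)"
    using sec_engulfing[OF h s m] q h by (simp add: hsubdiff_eq Hn_section_eq)
qed

lemma engulfing_H_eng: "engulfing_H n eng \<phi>"
  unfolding engulfing_H_def
proof (intro ballI allI impI subsetI)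
  fix \<xi> p s \<xi>' q \<xi>''
  assume \<xi>: "\<xi> \<in> heis n" and s: "(0::real) < s" and p: "p \<in> hsubdiff n \<phi> \<xi>"
    and \<xi>': "\<xi>' \<in> hsection n \<phi> \<xi> p s" and q: "q \<in> hsubdiff n \<phi> \<xi>'"
    and \<xi>'': "\<xi>'' \<in> hsection n \<phi> \<xi> p s \<inter> hplane n \<xi>'"
  have p': "p = gr \<xi>" using p \<xi> by (simp add: hsubdiff_eq)
  obtain v where v: "v \<in> hlayer n" "\<xi>' = hstep n \<xi> v" "exc \<xi> v < s"
    using \<xi>' hsection_gr[OF \<xi>] unfolding p' by auto
  obtain w where w: "w \<in> hlayer n" "\<xi>'' = hstep n \<xi> w" "exc \<xi> w < s"
    using \<xi>'' hsection_gr[OF \<xi>] unfolding p' by auto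
  have h: "\<xi>' \<in> heis n" using v \<xi> by simp
  obtain u where u: "u \<in> hlayer n" "\<xi>'' = hstep n \<xi>' u" using \<xi>'' hplane_eq[OF h] by auto
  have "exc \<xi>' u < eng * s"
    using horizontal_engulfing[OF s v(3) w(3)] u v(2) w(2) by simp
  moreover have "q = gr \<xi>'" using q h by (simp add: hsubdiff_eq)
  ultimately have "\<xi>'' \<in> hsection n \<phi> \<xi>' q (eng * s)" using hsection_gr[OF h] u by auto
  moreover have "\<xi>'' \<in> hplane n \<xi>" using w hplane_eq[OF \<xi>] by blast
  ultimately show "\<xi>'' \<in> hsection n \<phi> \<xi>' q (eng * s) \<inter> hplane n \<xi>" by blast
qed

lemma dphi_sections:
  shows "\<forall>\<xi>\<in>heis n. \<forall>\<xi>'\<in>heis n. dphi_set n \<phi> \<xi> \<xi>' \<noteq> {}"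
    and "quasi_metric_on (heis n) (dphi n \<phi>)"
    and "\<forall>\<xi>\<in>heis n. \<forall>r>0. Hn_section_grad n \<phi> \<xi> (r / (2 * eng)) \<subseteq> dphi_ball n \<phi> \<xi> r \<and>
      dphi_ball n \<phi> \<xi> r \<subseteq> Hn_section_grad n \<phi> \<xi> r"
proof -
  let ?S = "Hn_section_grad n \<phi>"
  have engulf: "z \<in> ?S y (eng * s)" if "x \<in> heis n" "0 < s" "y \<in> ?S x s" "z \<in> ?S x s" for x y z s
    using that sec_heis[of x s] sec_engulfing[of y z s x] by (auto simp: Hn_section_grad_eq subset_eq)
  have mono: "?S x s \<subseteq> ?S x t" if "x \<in> heis n" "s \<le> t" for x s t
    using that sec_mono by (simp add: Hn_section_grad_eq)
  have sub: "?S x s \<subseteq> heis n" if "x \<in> heis n" for x s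
    using that sec_heis by (simp add: Hn_section_grad_eq)
  have self: "x \<in> ?S x s" if "x \<in> heis n" "0 < s" for x s
    using that sec_self by (simp add: Hn_section_grad_eq)
  have exhaust: "\<exists>s>0. y \<in> ?S x s" if "x \<in> heis n" "y \<in> heis n" for x y
    using that sec_exhausts by (simp add: Hn_section_grad_eq)
  have separate: "y = x" if "x \<in> heis n" "y \<in> heis n" "\<And>s. 0 < s \<Longrightarrow> y \<in> ?S x s" for x y
    using that(3) by (intro sec_separates that(1,2)) (simp add: Hn_section_grad_eq that(1))
  note sections = quasi_metric_of_sections[where S = ?S and X = "heis n", OF eng_gt_1 engulf mono sub self exhaust separate]
  show "\<forall>\<xi>\<in>heis n. \<forall>\<xi>'\<in>heis n. dphi_set n \<phi> \<xi> \<xi>' \<noteq> {}"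
    unfolding dphi_set_def by (rule sections(1))
  have dphi: "dphi n \<phi> = (\<lambda>x y. Inf {s. 0 < s \<and> x \<in> ?S y s \<and> y \<in> ?S x s})"
    unfolding dphi_def dphi_set_def by (rule refl)
  show "quasi_metric_on (heis n) (dphi n \<phi>)"
    unfolding dphi by (rule sections(2))
  show "\<forall>\<xi>\<in>heis n. \<forall>r>0. ?S \<xi> (r / (2 * eng)) \<subseteq> dphi_ball n \<phi> \<xi> r \<and> dphi_ball n \<phi> \<xi> r \<subseteq> ?S \<xi> r"
    unfolding dphi_ball_def dphi by (rule sections(3))
qed

end

theorem theorem1p1:
  fixes K0 :: real
  assumes "0 < K0" and "K0 < 1"
  shows "(\<forall>n\<ge>1. \<forall>\<phi>. hconvex n \<phi> \<and> round_hsections n K0 \<phi> \<longrightarrow>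
            (\<exists>K>1. engulfing_Hn n K \<phi>) \<and>
            ((\<exists>K>1. engulfing_H n K \<phi>) \<longleftrightarrow> (\<exists>K>1. engulfing_Hn n K \<phi>))) \<and>
         (\<exists>H>0. \<forall>n\<ge>1. \<forall>\<phi>. hconvex n \<phi> \<and> round_hsections n K0 \<phi> \<longrightarrow>
            (\<forall>\<xi>\<in>heis n. \<forall>\<xi>'\<in>heis n. dphi_set n \<phi> \<xi> \<xi>' \<noteq> {}) \<and>
            quasi_metric_on (heis n) (dphi n \<phi>) \<and>
            (\<forall>\<xi>\<in>heis n. \<forall>r>0.
               Hn_section_grad n \<phi> \<xi> (r / (2 * H)) \<subseteq> dphi_ball n \<phi> \<xi> r \<and>
               dphi_ball n \<phi> \<xi> r \<subseteq> Hn_section_grad n \<phi> \<xi> r))"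
proof (intro conjI)
  \<comment> \<open>\<open>eng\<close> is built from \<open>K0\<close> alone, so one constant serves
    all \<open>n\<close> and \<open>\<phi>\<close>.\<close>
  let ?K = "round_fun.eng K0"
  show "\<forall>n\<ge>1. \<forall>\<phi>. hconvex n \<phi> \<and> round_hsections n K0 \<phi> \<longrightarrow>
            (\<exists>K>1. engulfing_Hn n K \<phi>) \<and>
            ((\<exists>K>1. engulfing_H n K \<phi>) \<longleftrightarrow> (\<exists>K>1. engulfing_Hn n K \<phi>))"
  proof (intro allI impI)
    fix n :: nat and \<phi>
    assume n: "1 \<le> n" and \<phi>: "hconvex n \<phi> \<and> round_hsections n K0 \<phi>"
    note hyps = n \<phi>[THEN conjunct1] \<phi>[THEN conjunct2] assms
    show "(\<exists>K>1. engulfing_Hn n K \<phi>) \<and>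
            ((\<exists>K>1. engulfing_H n K \<phi>) \<longleftrightarrow> (\<exists>K>1. engulfing_Hn n K \<phi>))"
      \<comment> \<open>Roundness yields both engulfing properties outright, so the equivalence is
        immediate.\<close>
      using engulfing_Hn_eng[OF hyps] engulfing_H_eng[OF hyps] round_fun.eng_gt_1[OF round_fun_ptrunc[OF hyps]] by blast
  qed
  show "\<exists>H>0. \<forall>n\<ge>1. \<forall>\<phi>. hconvex n \<phi> \<and> round_hsections n K0 \<phi> \<longrightarrow>
            (\<forall>\<xi>\<in>heis n. \<forall>\<xi>'\<in>heis n. dphi_set n \<phi> \<xi> \<xi>' \<noteq> {}) \<and>
            quasi_metric_on (heis n) (dphi n \<phi>) \<and>
            (\<forall>\<xi>\<in>heis n. \<forall>r>0.
               Hn_section_grad n \<phi> \<xi> (r / (2 * H)) \<subseteq> dphi_ball n \<phi> \<xi> r \<and>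
               dphi_ball n \<phi> \<xi> r \<subseteq> Hn_section_grad n \<phi> \<xi> r)"
  \<comment> \<open>\<open>?K > 1\<close> is obtained from a given function with round sections; the
    maximum makes the constant positive before one is chosen.\<close>
  proof (rule exI[of _ "max 1 ?K"], intro conjI[of "0 < max 1 ?K"] allI impI)
    show "0 < max 1 ?K" by simp
    fix n :: nat and \<phi>
    assume n: "1 \<le> n" and \<phi>: "hconvex n \<phi> \<and> round_hsections n K0 \<phi>"
    note hyps = n \<phi>[THEN conjunct1] \<phi>[THEN conjunct2] assms
    have K: "max 1 ?K = ?K" using round_fun.eng_gt_1[OF round_fun_ptrunc[OF hyps]] by simp
    show "(\<forall>\<xi>\<in>heis n. \<forall>\<xi>'\<in>heis n. dphi_set n \<phi> \<xi> \<xi>' \<noteq> {}) \<and>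
            quasi_metric_on (heis n) (dphi n \<phi>) \<and>
            (\<forall>\<xi>\<in>heis n. \<forall>r>0.
               Hn_section_grad n \<phi> \<xi> (r / (2 * max 1 ?K)) \<subseteq> dphi_ball n \<phi> \<xi> r \<and>
               dphi_ball n \<phi> \<xi> r \<subseteq> Hn_section_grad n \<phi> \<xi> r)"
      unfolding K by (intro conjI dphi_sections[OF hyps])
  qed
qed

end
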